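(* Let $\gamma>2$. There exists a constant $C_\gamma$ (depending only on $\gamma$) such that for any two weak solutions $f,g\in L^1_{\mathrm{loc}}\bigl(\mathbb{R}_+,(\mathcal{P}_1\cap L^\infty_\gamma)(\mathbb{R}^4)\bigr)$ of the equation $$\partial_t f_t+\mathcal{V}[f_t]\cdot\nabla_x f_t+\mathcal{A}[f_t]\cdot\nabla_v f_t=0,\qquad t>0,\ (x,v)\in\mathbb{R}^2\times\mathbb{R}^2,$$ with respective initial data $f_0$ and $g_0$, one has for all $t\ge 0$ $$W_1(f_t,g_t)\le W_1(f_0,g_0)\,\exp\Bigl(C_\gamma\int_0^t\bigl(\|f_s\|_\gamma+\|g_s\|_\gamma\bigr)\,ds\Bigr).$$
   Context: For $u=(u_1,u_2)\in\mathbb{R}^2$, ${}^\perp u=(u_2,-u_1)$. For $x,v\in\mathbb{R}^2$, $(x,v)\neq(0,0)$, $J(x,v)=\frac{{}^\perp x}{2\pi|x|^2}\mathbf{1}_{|x|\ge|v|}$ (so $J(0,v)=0$ for $v\ne0$). The fields are $$\mathcal{V}[f](x,v)=\int_{\mathbb{R}^4}J(x-y,v-w)f(y,w)\,dy\,dw,\qquad \mathcal{A}[f](x,v)=\int_{\mathbb{R}^4}J(v-w,x-y)f(y,w)\,dy\,dw.$$ Norm: for $\gamma>0$, $\|f\|_\gamma=\operatorname{ess\,sup}_{(x,v)\in\mathbb{R}^2\times\mathbb{R}^2}(1+|x|)^\gamma(1+|v|)^\gamma|f(x,v)|$ and $L^\infty_\gamma(\mathbb{R}^4)=\{f\in L^\infty(\mathbb{R}^4):\|f\|_\gamma<\infty\}$.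 $\mathcal{P}(\mathbb{R}^4)$ is the set of probability measures on $\mathbb{R}^4$, and $\mathcal{P}_1(\mathbb{R}^4)$ is the subset of those with finite first moment $\int(|x|+|v|)\,\mu(dx,dv)<\infty$. Measures are identified with their densities. $f\in L^1_{\mathrm{loc}}(\mathbb{R}_+,(\mathcal{P}_1\cap L^\infty_\gamma)(\mathbb{R}^4))$ means $f_t\in\mathcal{P}_1\cap L^\infty_\gamma$ for a.e. $t$ and $t\mapsto\|f_t\|_\gamma$ is locally integrable on $\mathbb{R}_+=[0,\infty)$. Weak solution: $f\in L^1_{\mathrm{loc}}(\mathbb{R}_+;(L^1\cap L^\infty)(\mathbb{R}^4))$ is a weak solution with initial datum $f_0\in\mathcal{P}(\mathbb{R}^4)$ if for all $\psi\in C^1_c(\mathbb{R}_+\times\mathbb{R}^4)$ $$\int_{\mathbb{R}_+\times\mathbb{R}^4}f(t,x,v)\bigl(\partial_t+\mathcal{V}[f_t](x,v)\cdot\nabla_x+\mathcal{A}[f_t](x,v)\cdot\nabla_v\bigr)\psi(t,x,v)\,dt\,dx\,dv=-\int_{\mathbb{R}^4}\psi(0,x,v)\,f_0(dx,dv).$$ Here $f_t=f(t,\cdot,\cdot)$; statements at a given time $t$ refer to the representative of $f$ that is weakly continuous in time with value $f_0$ at $t=0$. Wasserstein distance of order $1$: $W_1(\mu,\nu)=\inf_{\pi\in\Pi(\mu,\nu)}\int|z-z'|\,d\pi(z,z')$, where $\Pi(\mu,\nu)$ is the set of probability measures on $\mathbb{R}^4\times\mathbb{R}^4$ with marginals $\mu$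 and $\nu$ (finite when $\mu,\nu\in\mathcal{P}_1(\mathbb{R}^4)$). *)

theory Defs
  imports "HOL-Probability.Probability"
begin

type_synonym plane = "real^2"
type_synonym phase = "plane \<times> plane"  \<comment> \<open>the product norm is the Euclidean norm of R^4\<close>

definition perp :: "plane \<Rightarrow> plane" where
  "perp u = vector [u $ 2, - (u $ 1)]"

definition J :: "plane \<Rightarrow> plane \<Rightarrow> plane" where
  "J x v = (if norm v \<le> norm x then (1 / (2 * pi * (norm x)\<^sup>2)) *\<^sub>R perp x else 0)"

definition V_field :: "(phase \<Rightarrow> real) \<Rightarrow> phase \<Rightarrow> plane" where
  "V_field h = (\<lambda>(x, v). \<integral>(y, w). h (y, w) *\<^sub>R J (x - y) (v - w) \<partial>lborel)"

definition A_field :: "(phase \<Rightarrow> real) \<Rightarrow> phase \<Rightarrow> plane" where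
  "A_field h = (\<lambda>(x, v). \<integral>(y, w). h (y, w) *\<^sub>R J (v - w) (x - y) \<partial>lborel)"

definition L1_norm :: "(phase \<Rightarrow> real) \<Rightarrow> ennreal" where
  "L1_norm h = (\<integral>\<^sup>+z. ennreal \<bar>h z\<bar> \<partial>lborel)"

definition Linf_norm :: "(phase \<Rightarrow> real) \<Rightarrow> ennreal" where
  "Linf_norm h = esssup lborel (\<lambda>z. ennreal \<bar>h z\<bar>)"

definition weighted_norm :: "real \<Rightarrow> (phase \<Rightarrow> real) \<Rightarrow> ennreal" where
  "weighted_norm \<gamma> h = esssup lborel
     (\<lambda>(x, v). ennreal ((1 + norm x) powr \<gamma> * (1 + norm v) powr \<gamma> * \<bar>h (x, v)\<bar>))"

definition L1_space :: "(phase \<Rightarrow> real) set" where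
  "L1_space = {h. integrable lborel h}"

definition Linf_space :: "(phase \<Rightarrow> real) set" where
  "Linf_space = {h \<in> borel_measurable lborel. Linf_norm h < \<infinity>}"

definition Linf_weighted :: "real \<Rightarrow> (phase \<Rightarrow> real) set" where
  "Linf_weighted \<gamma> = {h \<in> Linf_space. weighted_norm \<gamma> h < \<infinity>}"

definition Prob :: "phase measure set" where
  "Prob = {\<mu>. prob_space \<mu> \<and> sets \<mu> = sets borel}"

definition Prob1 :: "phase measure set" where
  "Prob1 = {\<mu> \<in> Prob. (\<integral>\<^sup>+(x, v). ennreal (norm x + norm v) \<partial>\<mu>) < \<infinity>}"

definition measure_of_density :: "(phase \<Rightarrow> real) \<Rightarrow> phase measure" where
  "measure_of_density h = density lborel (\<lambda>z. ennreal (h z))"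

text \<open>Since \<open>ennreal\<close> truncates negative numbers to 0, non-negativity of a density has to be
  required separately.\<close>

definition Prob1_densities :: "(phase \<Rightarrow> real) set" where
  "Prob1_densities = {h \<in> borel_measurable lborel.
     (AE z in lborel. 0 \<le> h z) \<and> measure_of_density h \<in> Prob1}"

text \<open>\<open>L1_loc X N\<close> is the space of locally integrable functions on \<open>[0, \<infinity>)\<close> with values
  in the function space \<open>X\<close> normed by \<open>N\<close>; an equivalence class is represented by a
  jointly Borel function. Values at negative times are irrelevant throughout.\<close>

definition L1_loc ::
  "(phase \<Rightarrow> real) set \<Rightarrow> ((phase \<Rightarrow> real) \<Rightarrow> ennreal) \<Rightarrow> (real \<Rightarrow> phase \<Rightarrow> real) set" where
  "L1_loc X N = {f.
     (\<lambda>(t, z). f t z) \<in> borel_measurable (restrict_space borel {0..} \<Otimes>\<^sub>M borel) \<and>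
     (AE t in lborel. 0 \<le> t \<longrightarrow> f t \<in> X) \<and>
     (\<forall>T\<ge>0. (\<integral>\<^sup>+t\<in>{0..T}. N (f t) \<partial>lborel) < \<infinity>)}"

abbreviation half_space :: "(real \<times> phase) set" where
  "half_space \<equiv> {0..} \<times> UNIV"

text \<open>\<open>\<psi>\<close> is a \<open>C\<^sup>1\<close> function with compact support on the closed half space
  (the support may meet \<open>t = 0\<close>), and \<open>D = (\<partial>\<^sub>t \<psi>, \<nabla>\<^sub>x \<psi>, \<nabla>\<^sub>v \<psi>)\<close> is its gradient there.\<close>

definition test_function :: "(real \<times> phase \<Rightarrow> real) \<Rightarrow> (real \<times> phase \<Rightarrow> real \<times> phase) \<Rightarrow> bool" where
  "test_function \<psi> D \<longleftrightarrow>
     (\<forall>p\<in>half_space. (\<psi> has_derivative (\<lambda>h. D p \<bullet> h)) (at p within half_space)) \<and>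
     continuous_on half_space D \<and>
     (\<exists>K. compact K \<and> (\<forall>p\<in>half_space - K. \<psi> p = 0))"

definition weak_solution :: "(real \<Rightarrow> phase \<Rightarrow> real) \<Rightarrow> phase measure \<Rightarrow> bool" where
  "weak_solution f f0 \<longleftrightarrow>
     f \<in> L1_loc (L1_space \<inter> Linf_space) (\<lambda>h. L1_norm h + Linf_norm h) \<and>
     f0 \<in> Prob \<and>
     (\<forall>\<psi> D. test_function \<psi> D \<longrightarrow>
        (LINT (t, z):half_space|lborel.
           f t z * (D (t, z) \<bullet> (1, V_field (f t) z, A_field (f t) z)))
        = - (\<integral>z. \<psi> (0, z) \<partial>f0))"

definition weakly_continuous :: "(real \<Rightarrow> phase measure) \<Rightarrow> bool" where
  "weakly_continuous \<mu> \<longleftrightarrow>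
     (\<forall>\<phi> :: phase \<Rightarrow> real. continuous_on UNIV \<phi> \<and> bounded (range \<phi>) \<longrightarrow>
        continuous_on {0..} (\<lambda>t. \<integral>z. \<phi> z \<partial>\<mu> t))"

definition weak_representative ::
  "(real \<Rightarrow> phase \<Rightarrow> real) \<Rightarrow> phase measure \<Rightarrow> (real \<Rightarrow> phase measure) \<Rightarrow> bool" where
  "weak_representative f f0 \<mu> \<longleftrightarrow>
     (\<forall>t\<ge>0. \<mu> t \<in> Prob) \<and> weakly_continuous \<mu> \<and> \<mu> 0 = f0 \<and>
     (AE t in lborel. 0 \<le> t \<longrightarrow> \<mu> t = measure_of_density (f t))"

text \<open>The value at time \<open>t\<close> of the weakly continuous representative, which is unique
  on \<open>[0, \<infinity>)\<close> by \<open>weak_representative_unique\<close> below.\<close>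

definition at_time :: "(real \<Rightarrow> phase \<Rightarrow> real) \<Rightarrow> phase measure \<Rightarrow> real \<Rightarrow> phase measure" where
  "at_time f f0 t = (THE m. \<exists>\<mu>. weak_representative f f0 \<mu> \<and> \<mu> t = m)"

definition couplings :: "phase measure \<Rightarrow> phase measure \<Rightarrow> (phase \<times> phase) measure set" where
  "couplings \<mu> \<nu> = {\<pi>. prob_space \<pi> \<and> sets \<pi> = sets borel \<and>
     distr \<pi> borel fst = \<mu> \<and> distr \<pi> borel snd = \<nu>}"

definition W1 :: "phase measure \<Rightarrow> phase measure \<Rightarrow> ennreal" where
  "W1 \<mu> \<nu> = (INF \<pi>\<in>couplings \<mu> \<nu>. \<integral>\<^sup>+(z, z'). ennreal (norm (z - z')) \<partial>\<pi>)"

lemma Prob_eqI: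
  assumes "M \<in> Prob" "N \<in> Prob"
    and eq: "\<And>\<phi> :: phase \<Rightarrow> real. continuous_on UNIV \<phi> \<Longrightarrow> bounded (range \<phi>) \<Longrightarrow>
      (\<integral>z. \<phi> z \<partial>M) = (\<integral>z. \<phi> z \<partial>N)"
  shows "M = N"
proof -
  interpret M: prob_space M using assms by (auto simp: Prob_def)
  interpret N: prob_space N using assms by (auto simp: Prob_def)
  have [measurable_cong, simp]: "sets M = sets borel" "sets N = sets borel"
    using assms by (auto simp: Prob_def)
  have sp [simp]: "space M = UNIV" "space N = UNIV"
    using sets_eq_imp_space_eq[of M borel] sets_eq_imp_space_eq[of N borel] by auto
  have closed_eq: "emeasure M C = emeasure N C" if C: "closed C" for C
  proof (cases "C = {}")
    case False
    define \<phi> where "\<phi> n z = max 0 (1 - real n * infdist z C)" for n z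
    have cont: "continuous_on UNIV (\<phi> n)" for n
      unfolding \<phi>_def by (intro continuous_intros)
    have bd: "\<bar>\<phi> n z\<bar> \<le> 1" for n z
      unfolding \<phi>_def using infdist_nonneg[of z C] by (auto simp: max_def)
    have bdd: "bounded (range (\<phi> n))" for n
      using bd by (intro boundedI[where B = 1]) auto
    have [measurable]: "\<phi> n \<in> borel_measurable borel" for n
      using cont by (rule borel_measurable_continuous_onI)
    have [measurable]: "C \<in> sets borel" using C by simp
    have lim: "(\<lambda>n. \<phi> n z) \<longlonglongrightarrow> indicator C z" for z
    proof (cases "z \<in> C")
      case True then show ?thesis by (simp add: \<phi>_def)
    next
      case zC: False
      have pos: "infdist z C > 0"
        using infdist_pos_not_in_closed[OF C False zC] .
      obtain m :: nat where m: "real m * infdist z C > 1"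
        using reals_Archimedean3[OF pos] by blast
      have "\<phi> n z = 0" if "n \<ge> m" for n
      proof -
        have "real m * infdist z C \<le> real n * infdist z C"
          using that pos by (intro mult_right_mono) auto
        then show ?thesis using m by (simp add: \<phi>_def)
      qed
      then have "eventually (\<lambda>n. \<phi> n z = 0) sequentially"
        by (auto simp: eventually_sequentially)
      then show ?thesis using zC by (simp add: tendsto_eventually)
    qed
    have "(\<lambda>n. \<integral>z. \<phi> n z \<partial>M) \<longlonglongrightarrow> (\<integral>z. indicator C z \<partial>M)"
      by (rule integral_dominated_convergence[where w = "\<lambda>_. 1"]) (use lim bd in auto)
    moreover have "(\<lambda>n. \<integral>z. \<phi> n z \<partial>N) \<longlonglongrightarrow> (\<integral>z. indicator C z \<partial>N)"
      by (rule integral_dominated_convergence[where w = "\<lambda>_. 1"]) (use lim bd in auto)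
    ultimately have "(\<integral>z. indicator C z \<partial>M) = (\<integral>z. indicator C z \<partial>N :: real)"
      using eq[OF cont bdd] LIMSEQ_unique by simp
    then show ?thesis
      by (simp add: M.emeasure_eq_measure N.emeasure_eq_measure)
  qed simp
  show ?thesis
  proof (rule measure_eqI_generator_eq[where E = "Collect closed" and \<Omega> = UNIV and A = "\<lambda>_. UNIV"])
    show "Int_stable (Collect (closed :: phase set \<Rightarrow> bool))"
      by (auto simp: Int_stable_def)
    show "sets M = sigma_sets UNIV (Collect closed)" "sets N = sigma_sets UNIV (Collect closed)"
      by (simp_all add: borel_eq_closed)
  qed (use closed_eq in auto)
qed

lemma weak_representative_unique:
  assumes \<mu>: "weak_representative f f0 \<mu>" and \<nu>: "weak_representative f f0 \<nu>" and t: "0 \<le> t"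
  shows "\<mu> t = \<nu> t"
proof (rule Prob_eqI)
  show "\<mu> t \<in> Prob" "\<nu> t \<in> Prob" using \<mu> \<nu> t by (auto simp: weak_representative_def)
  fix \<phi> :: "phase \<Rightarrow> real" assume \<phi>: "continuous_on UNIV \<phi>" "bounded (range \<phi>)"
  define d where "d s = (\<integral>z. \<phi> z \<partial>\<mu> s) - (\<integral>z. \<phi> z \<partial>\<nu> s)" for s
  have cont: "continuous_on {0..} d"
    unfolding d_def using \<mu> \<nu> \<phi>
    by (intro continuous_intros) (auto simp: weak_representative_def weakly_continuous_def)
  have ae: "AE s in lborel. 0 \<le> s \<longrightarrow> d s = 0"
    using \<mu> \<nu> unfolding weak_representative_def d_def by auto
  have "d t = 0"
  proof (rule ccontr)
    assume "d t \<noteq> 0"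
    then obtain e where e: "e > 0" "\<And>s. s \<ge> 0 \<Longrightarrow> dist s t < e \<Longrightarrow> dist (d s) (d t) < \<bar>d t\<bar>"
      using cont t unfolding continuous_on_iff by (metis atLeast_iff zero_less_abs_iff)
    have nz: "d s \<noteq> 0" if "s \<in> {t<..<t+e}" for s
      using e(2)[of s] that t by (auto simp: dist_real_def)
    have "AE s in lborel. s \<notin> {t<..<t+e}"
      using ae by eventually_elim (use nz t in force)
    then have "emeasure lborel {t<..<t+e} = 0"
      by (subst (asm) AE_iff_measurable[where N = "{t<..<t+e}"]) auto
    then show False using e(1) by simp
  qed
  then show "(\<integral>z. \<phi> z \<partial>\<mu> t) = (\<integral>z. \<phi> z \<partial>\<nu> t)" by (simp add: d_def)
qed

lemma at_time_eq:
  assumes "weak_representative f f0 \<mu>" "0 \<le> t"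
  shows "at_time f f0 t = \<mu> t"
  unfolding at_time_def using assms weak_representative_unique by (intro the_equality) blast+

end

theory Submission
  imports Defs
begin

text \<open>The kernel \<open>J\<close> is discontinuous, but its modulus of continuity in \<open>L\<^sup>1\<close> with weight
  \<open>(1 + \<bar>x\<bar>) powr (-\<gamma>) * (1 + \<bar>v\<bar>) powr (-\<gamma>)\<close> is linear. Hence the field of a density \<open>h\<close> is bounded and
  Lipschitz with constant \<open>C * \<parallel>h\<parallel>\<close>, and a weak solution is the image of its initial datum under
  the flow of its own field. This uniqueness statement for the linear equation is obtained by
  duality: test functions carried by the flow are merely Lipschitz, and mollifying them in phase
  space costs a commutator that is linear in the mollification scale.
  Given a coupling of \<open>f0\<close> and \<open>g0\<close>, move its two components \<open>X\<close>, \<open>Y\<close> with the two flows.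
  Then \<open>\<bar>X - Y\<bar>\<close> grows through the Lipschitz bound of the first field, and through the difference
  of the two fields along \<open>Y\<close>. As \<open>Y\<close> has law \<open>g\<close> at each time, the average of the latter is the
  integral of \<open>\<bar>J (z - X) - J (z - Y)\<bar>\<close> against \<open>g\<close>, which is again at most \<open>C * \<parallel>g\<parallel> * \<bar>X - Y\<bar>\<close>.
  Gronwall's inequality concludes.\<close>

subsection \<open>Gronwall's inequality with an integrable weight\<close>

text \<open>The indicator in \<open>J\<close> is what saves a logarithm. Without it, two kernels of
  size 1/|x| at distance d differ by about d/|x|^2, which is not integrable at the origin of the
  plane and would leave a field that is only log-Lipschitz. With it, the factor 1/|x|^2 lives on |v|
  <= |x|, a disc of area pi |x|^2 in the other variable, and integrating that variable first cancels
  the singularity. The jump created by the indicator costs an annulus, whose integral is controlled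
  by its width and not by its radius. The second obstacle is time. Norms and fields are merely
  locally integrable in time, and the equation ties them to the solution only at almost every time,
  so nothing is differentiated in time. Differential inequalities are replaced by estimates of
  increments in terms of \<open>K s t\<close>, the integral of the rate over the time interval.
  Terms quadratic in \<open>K s t\<close> may carry any constant, even one that explodes as the
  mollification scale tends to 0; they disappear under subdivision before that scale is
  moved.\<close>

locale local_weight =
  fixes k :: "real \<Rightarrow> real"
  assumes k_measurable [measurable]: "k \<in> borel_measurable borel"
    and k_nonneg: "0 \<le> k t"
    and k_set_integrable: "set_integrable lborel {s..t} k"
begin

text \<open>The clock of the problem: time intervals are measured by their \<open>k\<close>-length
  instead of their duration. For \<open>t < s\<close> the interval is empty and the value is 0, so
  positivity and continuity hold on the whole line.\<close>

abbreviation K :: "real \<Rightarrow> real \<Rightarrow> real" where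
  "K s t \<equiv> integral {s..t} k"

lemma k_integrable_on: "k integrable_on {s..t}"
  using k_set_integrable by (rule set_borel_integral_eq_integral)

lemma K_nonneg: "0 \<le> K s t"
  using k_nonneg by (intro integral_nonneg k_integrable_on) auto

lemma K_combine: "s \<le> r \<Longrightarrow> r \<le> t \<Longrightarrow> K s r + K r t = K s t"
  by (intro Henstock_Kurzweil_Integration.integral_combine k_integrable_on) auto

lemma K_mono: "s \<le> s' \<Longrightarrow> t' \<le> t \<Longrightarrow> K s' t' \<le> K s t"
  using k_nonneg by (intro integral_subset_le k_integrable_on) auto

lemma integrable_on_bounded_by:
  fixes g :: "real \<Rightarrow> 'b::euclidean_space"
  assumes [measurable]: "g \<in> borel_measurable borel"
    and "\<And>r. r \<in> {s..t} \<Longrightarrow> norm (g r) \<le> c * k r"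
  shows "g integrable_on {s..t}" "set_integrable lborel {s..t} g"
proof -
  have "integrable lborel (\<lambda>r. c *\<^sub>R (indicator {s..t} r *\<^sub>R k r))"
    using k_set_integrable[of s t] unfolding set_integrable_def by (intro integrable_scaleR_right) auto
  then show *: "set_integrable lborel {s..t} g"
    unfolding set_integrable_def
    by (rule Bochner_Integration.integrable_bound)
       (auto simp: indicator_def intro!: AE_I2 order_trans[OF assms(2)])
  show "g integrable_on {s..t}" using * by (rule set_borel_integral_eq_integral)
qed

lemma norm_integral_le_K:
  fixes g :: "real \<Rightarrow> 'b::euclidean_space"
  assumes "g integrable_on {s..t}" "\<And>r. r \<in> {s..t} \<Longrightarrow> norm (g r) \<le> c * k r"
  shows "norm (integral {s..t} g) \<le> c * K s t"
proof -
  have "norm (integral {s..t} g) \<le> integral {s..t} (\<lambda>r. c * k r)"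
    by (intro Henstock_Kurzweil_Integration.integral_norm_bound_integral assms
        integrable_on_mult_right k_integrable_on)
  then show ?thesis by simp
qed

lemma continuous_on_primitive:
  fixes g :: "real \<Rightarrow> 'b::euclidean_space"
  assumes "\<And>t. g integrable_on {s..t}"
  shows "continuous_on UNIV (\<lambda>t. integral {s..t} g)"
proof -
  have *: "continuous_on {s..} (\<lambda>t. integral {s..t} g)"
    unfolding continuous_on_eq_continuous_within
  proof
    fix x assume x: "x \<in> {s..}"
    have "continuous_on {s..x+1} (\<lambda>t. integral {s..t} g)"
      by (rule indefinite_integral_continuous_1[OF assms])
    then have "continuous (at x within {s..x+1}) (\<lambda>t. integral {s..t} g)"
      using x by (auto simp: continuous_on_eq_continuous_within)
    moreover have "at x within {s..x+1} = at x within {s..}"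
      by (rule at_within_nhd[of _ "{..<x+1}"]) auto
    ultimately show "continuous (at x within {s..}) (\<lambda>t. integral {s..t} g)"
      by (simp add: continuous_within)
  qed
  \<comment> \<open>Before \<open>s\<close> the primitive is 0, its value at \<open>s\<close>;
    replacing \<open>t\<close> by \<open>max s t\<close> therefore extends continuity from the half
    line to the whole line.\<close>
  have "continuous_on UNIV (\<lambda>t. integral {s..max s t} g)"
    by (rule continuous_on_compose2[OF *]) (auto intro!: continuous_intros)
  moreover have "integral {s..max s t} g = integral {s..t} g" for t
    by (cases "s \<le> t") (auto simp: max_def)
  ultimately show ?thesis by simp
qed

lemma continuous_on_K: "continuous_on UNIV (K s)"
  by (intro continuous_on_primitive k_integrable_on)

text \<open>Any increment estimate whose error is quadratic in the \<open>k\<close>-length of short intervals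
  telescopes to a linear one.\<close>

lemma increment_bound:
  assumes dense: "\<And>x y. S \<le> x \<Longrightarrow> x < y \<Longrightarrow> y \<le> T \<Longrightarrow> \<exists>r\<in>G. x < r \<and> r < y"
    and ST: "S \<in> G" "T \<in> G" "S \<le> T" and \<tau>: "0 < \<tau>" and c: "0 \<le> c"
    and step: "\<And>s t. s \<in> G \<Longrightarrow> t \<in> G \<Longrightarrow> S \<le> s \<Longrightarrow> s \<le> t \<Longrightarrow> t \<le> T \<Longrightarrow> K s t \<le> \<tau> \<Longrightarrow>
      F t - F s \<le> a * K s t + c * (K s t)\<^sup>2"
  shows "F T - F S \<le> a * K S T"
proof -
  have bound: "F T - F S \<le> (a + c * \<sigma>) * K S T" if \<sigma>: "0 < \<sigma>" "\<sigma> \<le> \<tau>" for \<sigma>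
  proof -
    \<comment> \<open>Uniform continuity of \<open>K S\<close> turns the bound
      \<open>\<sigma>\<close> on the \<open>k\<close>-length into a bound \<open>\<eta>\<close> on
      the duration, in which steps can be counted.\<close>
    have "uniformly_continuous_on {S..T} (K S)"
      by (rule compact_uniformly_continuous[OF continuous_on_subset[OF continuous_on_K]]) auto
    then obtain \<eta> where \<eta>: "\<eta> > 0"
      "\<And>x y. x \<in> {S..T} \<Longrightarrow> y \<in> {S..T} \<Longrightarrow> dist y x < \<eta> \<Longrightarrow> dist (K S y) (K S x) < \<sigma>"
      using \<sigma> unfolding uniformly_continuous_on_def by metis
    have short: "F t - F s \<le> (a + c * \<sigma>) * K s t"
      if "s \<in> G" "t \<in> G" "S \<le> s" "s \<le> t" "t \<le> T" "t - s < \<eta>" for s t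
    proof -
      have "K s t = K S t - K S s" using K_combine[of S s t] that by simp
      also have "\<dots> < \<sigma>" using \<eta>(2)[of s t] that by (auto simp: dist_real_def)
      finally have *: "K s t < \<sigma>" .
      have "F t - F s \<le> a * K s t + c * (K s t)\<^sup>2" using step[of s t] that * \<sigma> by auto
      also have "c * (K s t)\<^sup>2 \<le> c * (\<sigma> * K s t)"
        unfolding power2_eq_square using * c K_nonneg[of s t] by (intro mult_left_mono mult_right_mono) auto
      finally show ?thesis by (simp add: algebra_simps)
    qed
    have "F t - F S \<le> (a + c * \<sigma>) * K S t"
      if "t \<in> G" "S \<le> t" "t \<le> T" "t - S < real (Suc n) * (\<eta> / 2)" for n t
      using that
    proof (induction n arbitrary: t)
      case 0
      then show ?case using \<eta>(1) ST by (intro short) auto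
    next
      case (Suc n)
      show ?case
      proof (cases "t - S < \<eta>")
        case True
        then show ?thesis using Suc.prems ST by (intro short) auto
      next
        case False
        \<comment> \<open>Subdivision points must lie in \<open>G\<close>, so exact spacing is out
          of reach. The window leaves a last piece shorter than \<open>\<eta>\<close> while moving
          back by more than \<open>\<eta> / 2\<close>, which is what the induction counts.\<close>
        then obtain r where r: "r \<in> G" "t - \<eta> < r" "r < t - \<eta> / 2"
          using dense[of "t - \<eta>" "t - \<eta>/2"] \<eta>(1) Suc.prems by auto
        have "F r - F S \<le> (a + c * \<sigma>) * K S r"
          using Suc.prems r False \<eta>(1) by (intro Suc.IH) (auto simp: algebra_simps)
        moreover have "F t - F r \<le> (a + c * \<sigma>) * K r t"
          using Suc.prems r False \<eta>(1) by (intro short) auto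
        moreover have "K S r + K r t = K S t"
          using r False \<eta>(1) by (intro K_combine) auto
        ultimately show ?thesis by (simp add: algebra_simps flip: distrib_left)
           (smt (verit) distrib_left mult.commute)
      qed
    qed
    moreover obtain n where "(T - S) / (\<eta> / 2) < real n" using reals_Archimedean2 by blast
    then have "T - S < real (Suc n) * (\<eta> / 2)" using \<eta>(1) by (simp add: field_simps)
    ultimately show ?thesis using ST by blast
  qed
  have "((\<lambda>\<sigma>. (a + c * \<sigma>) * K S T) \<longlongrightarrow> (a + c * 0) * K S T) (at_right 0)"
    by (intro tendsto_intros)
  moreover have "eventually (\<lambda>\<sigma>. F T - F S \<le> (a + c * \<sigma>) * K S T) (at_right 0)"
    using eventually_at_right[of 0 1] \<tau> by (subst eventually_at_right[of 0 1]) (auto intro!: exI[of _ \<tau>] bound)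
  ultimately show ?thesis
    using tendsto_lowerbound by fastforce
qed

lemma increment_bound_interval:
  assumes "S \<le> T" "0 < \<tau>" "0 \<le> c"
    and "\<And>s t. S \<le> s \<Longrightarrow> s \<le> t \<Longrightarrow> t \<le> T \<Longrightarrow> K s t \<le> \<tau> \<Longrightarrow> F t - F s \<le> a * K s t + c * (K s t)\<^sup>2"
  shows "F T - F S \<le> a * K S T"
  using assms by (intro increment_bound[of S T UNIV \<tau> c F a]) (auto intro: dense)

lemma integrable_on_mult_continuous:
  assumes "continuous_on UNIV u"
  shows "(\<lambda>r. k r * u r) integrable_on {s..t}"
proof -
  have "bounded (u ` {s..t})"
    using assms by (intro compact_imp_bounded compact_continuous_image) (auto intro: continuous_on_subset)
  then obtain M where M: "\<And>r. r \<in> {s..t} \<Longrightarrow> \<bar>u r\<bar> \<le> M" unfolding bounded_iff by fastforce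
  have [measurable]: "u \<in> borel_measurable borel"
    using assms by (rule borel_measurable_continuous_onI)
  have "norm (k r * u r) \<le> M * k r" if "r \<in> {s..t}" for r
    using mult_right_mono[OF M[OF that] k_nonneg[of r]] k_nonneg[of r] by (simp add: abs_mult mult.commute)
  then show ?thesis by (intro integrable_on_bounded_by(1)[where c=M]) auto
qed

text \<open>The primitive of the integrand is \<open>exp (2 * K s r) / 2\<close>, but
  \<open>k\<close> is only integrable; instead, the difference \<open>F\<close> of the two sides is
  shown to have increments of second order in \<open>K\<close>. The 2 in the exponent produces the
  contraction factor 1/2 of the Picard iteration.\<close>

lemma integral_exp_K_le:
  assumes "s \<le> t"
  shows "integral {s..t} (\<lambda>r. k r * exp (2 * K s r)) \<le> exp (2 * K s t) / 2"
proof -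
  have int: "(\<lambda>r. k r * exp (2 * K s r)) integrable_on {x..y}" for x y
    using continuous_on_K by (intro integrable_on_mult_continuous continuous_intros)
  define F where "F x = integral {s..x} (\<lambda>r. k r * exp (2 * K s r)) - exp (2 * K s x) / 2" for x
  have "F t - F s \<le> 0 * K s t"
  proof (rule increment_bound_interval[where \<tau>=1 and c="2 * exp (2 * K s t)"])
    fix x y assume xy: "s \<le> x" "x \<le> y" "y \<le> t"
    define d where "d = K x y"
    have d0: "0 \<le> d" unfolding d_def by (rule K_nonneg)
    have Ky: "K s y = K s x + d" using K_combine[of s x y] xy by (simp add: d_def)
    have "integral {s..y} (\<lambda>r. k r * exp (2 * K s r)) - integral {s..x} (\<lambda>r. k r * exp (2 * K s r))
      = integral {x..y} (\<lambda>r. k r * exp (2 * K s r))"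
      using Henstock_Kurzweil_Integration.integral_combine[OF xy(1,2) int] by simp
    also have "\<dots> \<le> integral {x..y} (\<lambda>r. k r * exp (2 * K s y))"
      using xy k_nonneg
      by (intro integral_le int integrable_on_mult_left k_integrable_on)
         (auto intro!: mult_left_mono K_mono)
    also have "\<dots> = d * exp (2 * K s y)" by (simp add: d_def)
    finally have 1: "F y - F x \<le> d * exp (2 * K s y) - (exp (2 * K s y) - exp (2 * K s x)) / 2"
      by (simp add: F_def field_simps)
    define E where "E = exp (2 * K s y)"
    have E: "exp (2 * K s x) = E * exp (- (2 * d))" unfolding E_def Ky by (simp flip: exp_add)
    have e1: "exp (- (2 * d)) \<ge> 1 - 2 * d" using exp_ge_add_one_self[of "-(2*d)"] by simp
    have e2: "exp (2 * K s y) - exp (2 * K s x) \<ge> 2 * d * exp (2 * K s x)"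
    proof -
      have "exp (2 * K s y) = exp (2 * K s x) * exp (2 * d)" unfolding Ky by (simp flip: exp_add add: algebra_simps)
      moreover have "exp (2 * K s x) * exp (2 * d) \<ge> exp (2 * K s x) * (1 + 2 * d)"
        by (intro mult_left_mono exp_ge_add_one_self) auto
      ultimately show ?thesis by (simp add: algebra_simps)
    qed
    have "F y - F x \<le> d * (E - E * exp (- (2 * d)))"
    proof -
      have "d * (E - E * exp (- (2 * d))) = d * exp (2 * K s y) - d * exp (2 * K s x)"
        unfolding E[symmetric] by (simp add: E_def right_diff_distrib)
      moreover have "d * exp (2 * K s x) \<le> (exp (2 * K s y) - exp (2 * K s x)) / 2" using e2 by simp
      ultimately show ?thesis using 1 by linarith
    qed
    also have "\<dots> = d * (E * (1 - exp (-(2*d))))" by (simp add: algebra_simps)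
    also have "\<dots> \<le> d * (E * (2 * d))"
      using e1 d0 by (intro mult_left_mono) (auto simp: E_def)
    also have "\<dots> = 2 * E * d\<^sup>2" by (simp add: power2_eq_square)
    also have "\<dots> \<le> 2 * exp (2 * K s t) * d\<^sup>2"
      using xy by (intro mult_right_mono) (auto simp: E_def intro: K_mono)
    finally show "F y - F x \<le> 0 * K x y + 2 * exp (2 * K s t) * (K x y)\<^sup>2" by (simp add: d_def)
  qed (use assms in auto)
  then show ?thesis by (simp add: F_def)
qed

text \<open>The logarithm of the majorant \<open>U\<close> has increments at most
  \<open>K + 2 * K^2\<close>: where \<open>K x y\<close> is at most 1/2, monotonicity gives
  \<open>U y * (1 - K x y) <= U x\<close>, and \<open>ln (1 - d) >= - d - 2 * d^2\<close>. The
  quadratic term is dropped by \<open>increment_bound_interval\<close>.\<close>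

lemma gronwall:
  assumes st: "s \<le> t" and u: "continuous_on UNIV u" "\<And>r. 0 \<le> u r" and c: "0 \<le> c"
    and le: "\<And>r. s \<le> r \<Longrightarrow> r \<le> t \<Longrightarrow> u r \<le> c + integral {s..r} (\<lambda>x. k x * u x)"
  shows "u t \<le> c * exp (K s t)"
proof -
  have int: "(\<lambda>r. k r * u r) integrable_on {x..y}" for x y
    by (rule integrable_on_mult_continuous[OF u(1)])
  \<comment> \<open>A strictly positive constant keeps the logarithm defined; \<open>c\<close>
    itself is reached in the limit.\<close>
  have pos: "u t \<le> c' * exp (K s t)" if c': "0 < c'" "c \<le> c'" for c'
  proof -
    define U where "U r = c' + integral {s..r} (\<lambda>x. k x * u x)" for r
    have uU: "u r \<le> U r" if "s \<le> r" "r \<le> t" for r using le[OF that] c' by (simp add: U_def)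
    have Umono: "U x \<le> U y" if "x \<le> y" for x y
      unfolding U_def using that k_nonneg u(2)
      by (intro add_left_mono integral_subset_le int) auto
    have Upos: "0 < U r" for r
      using c' u(2) k_nonneg unfolding U_def by (intro add_pos_nonneg integral_nonneg int) auto
    have "ln (U t) - ln (U s) \<le> 1 * K s t"
    proof (rule increment_bound_interval[where \<tau>="1/2" and c=2])
      fix x y assume xy: "s \<le> x" "x \<le> y" "y \<le> t" and d: "K x y \<le> 1 / 2"
      have "U y - U x = integral {x..y} (\<lambda>r. k r * u r)"
        unfolding U_def using Henstock_Kurzweil_Integration.integral_combine[OF xy(1,2) int] by simp
      also have "\<dots> \<le> integral {x..y} (\<lambda>r. k r * U y)"
        using xy k_nonneg order_trans[OF uU Umono]
        by (intro integral_le int integrable_on_mult_left k_integrable_on)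
           (auto intro!: mult_left_mono)
      finally have "U y * (1 - K x y) \<le> U x" by (simp add: algebra_simps)
      then have "ln (U y * (1 - K x y)) \<le> ln (U x)"
        using Upos[of y] d by (subst ln_le_cancel_iff) (auto simp: Upos)
      moreover have "ln (U y * (1 - K x y)) = ln (U y) + ln (1 - K x y)"
        using Upos[of y] d by (intro ln_mult_pos) auto
      moreover have "- K x y - 2 * (K x y)\<^sup>2 \<le> ln (1 - K x y)"
        using d K_nonneg by (intro ln_one_minus_pos_lower_bound)
      ultimately show "ln (U y) - ln (U x) \<le> 1 * K x y + 2 * (K x y)\<^sup>2" by simp
    qed (use st in auto)
    then have "ln (U t) \<le> ln (c' * exp (K s t))"
      using c' by (simp add: U_def ln_mult_pos)
    then have "U t \<le> c' * exp (K s t)" using Upos[of t] c' by (subst (asm) ln_le_cancel_iff) auto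
    then show ?thesis using uU[OF st order_refl] by simp
  qed
  have "((\<lambda>e. (c + e) * exp (K s t)) \<longlongrightarrow> (c + 0) * exp (K s t)) (at_right 0)"
    by (intro tendsto_intros)
  moreover have "eventually (\<lambda>e. u t \<le> (c + e) * exp (K s t)) (at_right 0)"
    using c by (subst eventually_at_right[of 0 1]) (auto intro!: exI[of _ 1] pos)
  ultimately show ?thesis using tendsto_lowerbound by fastforce
qed

end

subsection \<open>The flow of a Caratheodory field\<close>

text \<open>One integrable function serves as bound and as Lipschitz constant, since both estimates
  for the field of a density are proportional to its weighted norm.\<close>

locale caratheodory_field = local_weight k for k :: "real \<Rightarrow> real" +
  fixes b :: "real \<Rightarrow> 'a::euclidean_space \<Rightarrow> 'a"
  assumes b_measurable: "(\<lambda>(t, z). b t z) \<in> borel_measurable borel"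
    and b_bound: "norm (b t z) \<le> k t"
    and b_lipschitz: "norm (b t z - b t w) \<le> k t * norm (z - w)"
begin

lemma b_measurable_compose [measurable (raw)]:
  assumes "f \<in> borel_measurable M" "g \<in> borel_measurable M"
  shows "(\<lambda>x. b (f x) (g x)) \<in> borel_measurable M"
  using measurable_compose[OF borel_measurable_Pair[OF assms] b_measurable] by simp

lemma continuous_on_b: "continuous_on UNIV (b t)"
proof (rule continuous_on_subset[OF lipschitz_on_continuous_on])
  show "(k t)-lipschitz_on UNIV (b t)"
    using b_lipschitz k_nonneg by (auto simp: lipschitz_on_def dist_norm)
qed simp

lemma b_integrable_on:
  assumes [measurable]: "X \<in> borel_measurable borel"
  shows "(\<lambda>r. b r (X r)) integrable_on {s..t}"
  by (rule integrable_on_bounded_by(1)[where c=1]) (auto simp: b_bound)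

text \<open>The integral equation is the right notion for a field without continuity in time. Before
  \<open>s\<close> only continuity is asked, so the same function remains a trajectory when
  restarted later.\<close>

definition trajectory :: "real \<Rightarrow> 'a \<Rightarrow> (real \<Rightarrow> 'a) \<Rightarrow> bool" where
  "trajectory s z X \<longleftrightarrow> continuous_on UNIV X \<and>
     (\<forall>t\<ge>s. X t = z + integral {s..t} (\<lambda>r. b r (X r)))"

lemma trajectory_measurable: "trajectory s z X \<Longrightarrow> X \<in> borel_measurable borel"
  by (auto simp: trajectory_def intro: borel_measurable_continuous_onI)

lemma trajectory_integrable: "trajectory s z X \<Longrightarrow> (\<lambda>r. b r (X r)) integrable_on {r1..r2}"
  by (intro b_integrable_on trajectory_measurable)

lemma trajectory_start: "trajectory s z X \<Longrightarrow> X s = z"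
  by (auto simp: trajectory_def)

lemma trajectory_increment:
  assumes "trajectory s z X" "s \<le> r" "r \<le> t"
  shows "X t = X r + integral {r..t} (\<lambda>r. b r (X r))"
proof -
  have eq: "X q = z + integral {s..q} (\<lambda>r. b r (X r))" if "s \<le> q" for q
    using assms(1) that unfolding trajectory_def by blast
  have "integral {s..r} (\<lambda>r. b r (X r)) + integral {r..t} (\<lambda>r. b r (X r)) = integral {s..t} (\<lambda>r. b r (X r))"
    by (rule Henstock_Kurzweil_Integration.integral_combine[OF assms(2,3) trajectory_integrable[OF assms(1)]])
  then show ?thesis unfolding eq[OF assms(2)] eq[OF order_trans[OF assms(2,3)]] by (simp add: add.assoc)
qed

lemma trajectory_restart:
  assumes "trajectory s z X" "s \<le> r"
  shows "trajectory r (X r) X"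
  using assms trajectory_increment[OF assms] unfolding trajectory_def by blast

lemma trajectory_displacement:
  assumes "trajectory s z X" "s \<le> t"
  shows "norm (X t - z) \<le> K s t"
proof -
  have "norm (integral {s..t} (\<lambda>r. b r (X r))) \<le> 1 * K s t"
    by (intro norm_integral_le_K trajectory_integrable[OF assms(1)]) (simp add: b_bound)
  then show ?thesis using assms by (auto simp: trajectory_def)
qed

text \<open>Gronwall applied to the distance. With equal starting points it is uniqueness, hence the
  semigroup law of the flow; in general it makes the flow Lipschitz in its starting point.\<close>

lemma trajectory_dist:
  assumes X: "trajectory s x X" and Y: "trajectory s y Y" and "s \<le> t"
  shows "norm (X t - Y t) \<le> norm (x - y) * exp (K s t)"
proof (rule gronwall[OF assms(3)])
  show cont: "continuous_on UNIV (\<lambda>r. norm (X r - Y r))"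
    using X Y by (auto simp: trajectory_def intro!: continuous_intros)
  fix r assume r: "s \<le> r" "r \<le> t"
  have "X r - Y r = x - y + integral {s..r} (\<lambda>q. b q (X q) - b q (Y q))"
    using X Y r
    by (subst Henstock_Kurzweil_Integration.integral_diff)
       (auto simp: trajectory_def intro!: trajectory_integrable)
  also have "norm \<dots> \<le> norm (x - y) + norm (integral {s..r} (\<lambda>q. b q (X q) - b q (Y q)))"
    by (rule norm_triangle_ineq)
  also have "norm (integral {s..r} (\<lambda>q. b q (X q) - b q (Y q))) \<le>
      integral {s..r} (\<lambda>q. k q * norm (X q - Y q))"
    by (intro Henstock_Kurzweil_Integration.integral_norm_bound_integral b_lipschitz
        integrable_on_mult_continuous cont Henstock_Kurzweil_Integration.integrable_diff trajectory_integrable[OF X]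
        trajectory_integrable[OF Y])
  finally show "norm (X r - Y r) \<le> norm (x - y) + integral {s..r} (\<lambda>q. k q * norm (X q - Y q))"
    by simp
qed auto

section \<open>Existence of trajectories by Picard iteration\<close>

primrec picard :: "real \<Rightarrow> 'a \<Rightarrow> nat \<Rightarrow> real \<Rightarrow> 'a" where
  "picard s z 0 = (\<lambda>t. z)"
| "picard s z (Suc n) = (\<lambda>t. z + integral {s..t} (\<lambda>r. b r (picard s z n r)))"

lemma picard_continuous: "continuous_on UNIV (picard s z n)"
proof (induction n)
  case (Suc n)
  have [measurable]: "picard s z n \<in> borel_measurable borel"
    by (rule borel_measurable_continuous_onI[OF Suc])
  show ?case unfolding picard.simps
    by (intro continuous_intros continuous_on_primitive b_integrable_on) measurable
qed simp

lemma picard_integrable: "(\<lambda>r. b r (picard s z n r)) integrable_on {r1..r2}"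
  by (intro b_integrable_on borel_measurable_continuous_onI picard_continuous)

text \<open>Measured against the growing weight \<open>exp (2 * K s t)\<close>, each iteration gains
  1/2 on intervals of any length, so existence is global at once.\<close>

lemma picard_increment:
  assumes "s \<le> t"
  shows "norm (picard s z (Suc n) t - picard s z n t) \<le> (1/2)^n * exp (2 * K s t)"
  using assms
proof (induction n arbitrary: t)
  case 0
  have "norm (integral {s..t} (\<lambda>r. b r z)) \<le> 1 * K s t"
    by (intro norm_integral_le_K b_integrable_on) (auto simp: b_bound)
  also have "\<dots> \<le> exp (2 * K s t)"
    using exp_ge_add_one_self[of "2 * K s t"] K_nonneg[of s t] by linarith
  finally show ?case by simp
next
  case (Suc n)
  have expint: "(\<lambda>r. k r * exp (2 * K s r)) integrable_on {s..t}"
    using continuous_on_K by (intro integrable_on_mult_continuous continuous_intros)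
  have "picard s z (Suc (Suc n)) t - picard s z (Suc n) t =
      integral {s..t} (\<lambda>r. b r (picard s z (Suc n) r)) - integral {s..t} (\<lambda>r. b r (picard s z n r))"
    by (simp only: picard.simps add_diff_cancel_left)
  also have "\<dots> = integral {s..t} (\<lambda>r. b r (picard s z (Suc n) r) - b r (picard s z n r))"
    by (rule Henstock_Kurzweil_Integration.integral_diff[OF picard_integrable picard_integrable, symmetric])
  also have "norm \<dots> \<le> integral {s..t} (\<lambda>r. (1/2)^n * (k r * exp (2 * K s r)))"
  proof (intro Henstock_Kurzweil_Integration.integral_norm_bound_integral
      Henstock_Kurzweil_Integration.integrable_diff picard_integrable integrable_on_mult_right expint)
    fix r assume "r \<in> {s..t}"
    then have "norm (picard s z (Suc n) r - picard s z n r) \<le> (1/2)^n * exp (2 * K s r)"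
      by (intro Suc.IH) auto
    then have "k r * norm (picard s z (Suc n) r - picard s z n r) \<le> k r * ((1/2)^n * exp (2 * K s r))"
      by (intro mult_left_mono k_nonneg)
    with b_lipschitz[of r "picard s z (Suc n) r" "picard s z n r"]
    show "norm (b r (picard s z (Suc n) r) - b r (picard s z n r)) \<le> (1/2)^n * (k r * exp (2 * K s r))"
      by (simp add: mult.left_commute del: picard.simps)
  qed
  also have "\<dots> = (1/2)^n * integral {s..t} (\<lambda>r. k r * exp (2 * K s r))" by simp
  also have "\<dots> \<le> (1/2)^n * (exp (2 * K s t) / 2)"
    by (intro mult_left_mono integral_exp_K_le Suc) auto
  finally show ?case by simp
qed

lemma trajectory_exists: "\<exists>X. trajectory s z X"
proof -
  define X where "X t = z + (\<Sum>i. picard s z (Suc i) t - picard s z i t)" for t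
  \<comment> \<open>Integrals from \<open>s\<close> to an earlier time are over empty intervals.
    Convergence is thus uniform on \<open>{..T}\<close>, and the limit is continuous on the whole
    line, as \<open>trajectory\<close> demands.\<close>
  have below: "picard s z n t = z" if "t \<le> s" for n t
    using that by (cases n) (auto simp: less_eq_real_def)
  have ulim: "uniform_limit {..T} (\<lambda>n. picard s z n) X sequentially" for T
  proof -
    have "uniform_limit {..T} (\<lambda>n t. \<Sum>i<n. picard s z (Suc i) t - picard s z i t)
        (\<lambda>t. \<Sum>i. picard s z (Suc i) t - picard s z i t) sequentially"
    proof (rule Weierstrass_m_test)
      fix n t assume t: "t \<in> {..T}"
      show "norm (picard s z (Suc n) t - picard s z n t) \<le> (1/2)^n * exp (2 * K s T)"
      proof (cases "s \<le> t")
        case True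
        have "(1/2)^n * exp (2 * K s t) \<le> (1/2)^n * exp (2 * K s T)"
          using t by (auto intro!: mult_left_mono K_mono)
        then show ?thesis using picard_increment[OF True] order_trans by blast
      next
        case False
        then have "picard s z (Suc n) t - picard s z n t = 0"
          using below[of t "Suc n"] below[of t n] by (simp del: picard.simps)
        then show ?thesis by (simp del: picard.simps)
      qed
    qed (intro summable_mult2 summable_geometric, simp)
    then have "uniform_limit {..T} (\<lambda>n t. z + (\<Sum>i<n. picard s z (Suc i) t - picard s z i t)) X sequentially"
      unfolding X_def by (intro uniform_limit_intros)
    moreover have "z + (\<Sum>i<n. picard s z (Suc i) t - picard s z i t) = picard s z n t" for n t
      by (subst sum_lessThan_telescope) simp
    ultimately show ?thesis by (simp del: picard.simps)
  qed
  have contT: "continuous_on {..T} X" for T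
    by (rule uniform_limit_theorem[OF _ ulim])
       (auto intro!: always_eventually continuous_on_subset[OF picard_continuous])
  have cont: "continuous_on UNIV X"
    unfolding continuous_on_eq_continuous_at[OF open_UNIV]
  proof
    fix t show "isCont X t"
      using contT[of "t + 1"] continuous_on_interior[of "{..t+1}" X t] by simp
  qed
  have lim: "(\<lambda>n. picard s z n t) \<longlonglongrightarrow> X t" for t
    using tendsto_uniform_limitI[OF ulim[of t], of t] by simp
  have "X t = z + integral {s..t} (\<lambda>r. b r (X r))" for t
  proof -
    have "(\<lambda>n. integral {s..t} (\<lambda>r. b r (picard s z n r))) \<longlonglongrightarrow> integral {s..t} (\<lambda>r. b r (X r))"
    proof (rule dominated_convergence(2))
      show "(\<lambda>n. b r (picard s z n r)) \<longlonglongrightarrow> b r (X r)" for r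
        using continuous_on_b lim by (rule continuous_on_tendsto_compose) auto
    qed (auto intro: picard_integrable k_integrable_on b_bound)
    then have "(\<lambda>n. picard s z (Suc n) t) \<longlonglongrightarrow> z + integral {s..t} (\<lambda>r. b r (X r))"
      unfolding picard.simps by (intro tendsto_intros)
    then show ?thesis using LIMSEQ_Suc[OF lim[of t]] LIMSEQ_unique by blast
  qed
  then show ?thesis using cont unfolding trajectory_def by blast
qed

section \<open>The flow map and its regularity\<close>

definition flow :: "real \<Rightarrow> 'a \<Rightarrow> real \<Rightarrow> 'a" where
  "flow s z = (SOME X. trajectory s z X)"

lemma flow_trajectory: "trajectory s z (flow s z)"
  unfolding flow_def using trajectory_exists by (rule someI_ex)

lemmas flow_start [simp] = trajectory_start[OF flow_trajectory]
  and flow_displacement = trajectory_displacement[OF flow_trajectory]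
  and flow_lipschitz = trajectory_dist[OF flow_trajectory flow_trajectory]
  and flow_increment = trajectory_increment[OF flow_trajectory]

lemma flow_continuous: "continuous_on UNIV (flow s z)"
  using flow_trajectory[of s z] unfolding trajectory_def by (rule conjunct1)

lemma flow_continuous_start: "s \<le> t \<Longrightarrow> continuous_on UNIV (\<lambda>z. flow s z t)"
proof (rule lipschitz_on_continuous_on[where L="exp (K s t)"], rule lipschitz_onI)
  fix z w assume "s \<le> t"
  then show "dist (flow s z t) (flow s w t) \<le> exp (K s t) * dist z w"
    using flow_lipschitz[of s t z w] by (simp add: dist_norm mult.commute)
qed simp

lemma flow_semigroup:
  assumes "s \<le> r" "r \<le> t"
  shows "flow r (flow s z r) t = flow s z t"
proof -
  have "norm (flow r (flow s z r) t - flow s z t) \<le> norm (flow s z r - flow s z r) * exp (K r t)"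
    by (rule trajectory_dist[OF flow_trajectory trajectory_restart[OF flow_trajectory assms(1)] assms(2)])
  then show ?thesis by simp
qed

text \<open>\<open>SOME\<close> fixes the values of \<open>flow s z\<close> before time
  \<open>s\<close> without any regularity in \<open>z\<close>; the truncation \<open>max s r\<close>
  discards them. Joint continuity later makes the trajectories jointly measurable in starting point
  and time.\<close>

lemma flow_joint_continuous: "continuous_on UNIV (\<lambda>(z, r). flow s z (max s r))"
  unfolding continuous_on_eq_continuous_at[OF open_UNIV]
proof
  fix p :: "'a \<times> real"
  obtain z r where p: "p = (z, r)" by (meson surj_pair)
  define B where "B w q = norm (w - z) * exp (K s (max s q)) + norm (flow s z (max s q) - flow s z (max s r))" for w q
  have "(fst \<longlongrightarrow> z) (at p)" and "(snd \<longlongrightarrow> r) (at p)"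
    using tendsto_fst[OF tendsto_ident_at[of p UNIV]] tendsto_snd[OF tendsto_ident_at[of p UNIV]]
    by (simp_all add: p)
  then have lim_fst: "((\<lambda>x. norm (fst x - z)) \<longlongrightarrow> 0) (at p)"
    and lim_max: "((\<lambda>x. max s (snd x)) \<longlongrightarrow> max s r) (at p)"
    by (auto intro: tendsto_norm_zero LIM_zero tendsto_max)
  have limK: "((\<lambda>x. K s (max s (snd x))) \<longlongrightarrow> K s (max s r)) (at p)"
    by (rule continuous_on_tendsto_compose[OF continuous_on_K lim_max]) auto
  have lim_flow: "((\<lambda>x. flow s z (max s (snd x))) \<longlongrightarrow> flow s z (max s r)) (at p)"
    by (rule continuous_on_tendsto_compose[OF flow_continuous lim_max]) auto
  have "((\<lambda>x. norm (flow s z (max s (snd x)) - flow s z (max s r))) \<longlongrightarrow> 0) (at p)"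
    using tendsto_norm_zero[OF LIM_zero[OF lim_flow]] .
  from tendsto_add[OF tendsto_mult[OF lim_fst tendsto_exp[OF limK]] this]
  have B: "((\<lambda>x. B (fst x) (snd x)) \<longlongrightarrow> 0) (at p)" by (simp add: B_def)
  have le: "norm (flow s w (max s q) - flow s z (max s r)) \<le> B w q" for w q
  proof -
    have "norm (flow s w (max s q) - flow s z (max s r)) \<le>
      norm (flow s w (max s q) - flow s z (max s q)) + norm (flow s z (max s q) - flow s z (max s r))"
      by (metis diff_add_cancel add_diff_eq norm_triangle_ineq)
    then show ?thesis using flow_lipschitz[of s "max s q" w z] by (simp add: B_def)
  qed
  have "((\<lambda>x. flow s (fst x) (max s (snd x)) - flow s z (max s r)) \<longlongrightarrow> 0) (at p)"
    by (rule Lim_null_comparison[OF _ B]) (auto intro!: always_eventually le)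
  then show "isCont (\<lambda>(z, r). flow s z (max s r)) p"
    unfolding isCont_def by (simp add: p LIM_zero_iff case_prod_unfold)
qed

text \<open>The field is frozen at \<open>z\<close>, not at the starting point \<open>w\<close>, so
  that one displacement can serve all points near \<open>z\<close>. Along the trajectory the
  distance to \<open>z\<close> is at most \<open>K s t + norm (w - z)\<close>, and the Lipschitz
  constant integrates to another \<open>K s t\<close>.\<close>

lemma flow_Euler:
  assumes "s \<le> t"
  shows "norm (flow s w t - (w + integral {s..t} (\<lambda>r. b r z))) \<le> K s t * (K s t + norm (w - z))"
proof -
  have "flow s w t - (w + integral {s..t} (\<lambda>r. b r z)) = integral {s..t} (\<lambda>r. b r (flow s w r) - b r z)"
    using flow_increment[OF order_refl assms, of w]
      Henstock_Kurzweil_Integration.integral_diff[OF trajectory_integrable[OF flow_trajectory]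
        b_integrable_on[OF borel_measurable_const]]
    by (metis (no_types, lifting) add_diff_add add.commute add_diff_cancel_left flow_start)
  also have "norm \<dots> \<le> (K s t + norm (w - z)) * K s t"
  proof (rule norm_integral_le_K)
    show "(\<lambda>r. b r (flow s w r) - b r z) integrable_on {s..t}"
      by (rule Henstock_Kurzweil_Integration.integrable_diff[OF trajectory_integrable[OF flow_trajectory]
        b_integrable_on[OF borel_measurable_const]])
    fix r assume r: "r \<in> {s..t}"
    have "norm (flow s w r - z) \<le> norm (flow s w r - w) + norm (w - z)"
      by (metis diff_add_cancel add_diff_eq norm_triangle_ineq)
    also have "norm (flow s w r - w) \<le> K s t"
      using flow_displacement[of s r w] K_mono[of s s r t] r by auto
    finally have "k r * norm (flow s w r - z) \<le> k r * (K s t + norm (w - z))"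
      using k_nonneg by (intro mult_left_mono) auto
    then show "norm (b r (flow s w r) - b r z) \<le> (K s t + norm (w - z)) * k r"
      using b_lipschitz[of r "flow s w r" z] by (simp add: mult.commute)
  qed
  finally show ?thesis by (simp add: mult.commute)
qed

end

subsection \<open>Mollification\<close>

lemma lborel_distr_reflect: "distr lborel borel (\<lambda>x::'a::euclidean_space. z - x) = lborel"
proof -
  have "(lborel :: 'a measure) = density (distr lborel borel (\<lambda>x. z + (-1) *\<^sub>R x)) (\<lambda>_. ennreal (\<bar>-1\<bar>^DIM('a)))"
    using lborel_affine[of "-1" z] by simp
  then show ?thesis by (simp add: density_1)
qed

lemma lborel_integral_reflect:
  fixes f :: "'a::euclidean_space \<Rightarrow> 'b::{banach, second_countable_topology}"
  assumes [measurable]: "f \<in> borel_measurable borel"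
  shows "(\<integral>y. f (z - y) \<partial>lborel) = (\<integral>y. f y \<partial>lborel)"
proof -
  have "(\<integral>y. f y \<partial>distr lborel borel (\<lambda>x::'a. z - x)) = (\<integral>y. f (z - y) \<partial>lborel)"
    by (subst integral_distr) auto
  then show ?thesis by (simp add: lborel_distr_reflect)
qed

lemma integrable_compact_support:
  fixes f :: "'a::euclidean_space \<Rightarrow> 'b::euclidean_space"
  assumes "continuous_on UNIV f" "\<And>x. R < norm x \<Longrightarrow> f x = 0"
  shows "integrable lborel f"
proof -
  have "integrable lborel (\<lambda>x. indicator (cball 0 R) x *\<^sub>R f x)"
    by (intro borel_integrable_compact continuous_on_subset[OF assms(1)]) auto
  moreover have "indicator (cball 0 R) x *\<^sub>R f x = f x" for x
    using assms(2)[of x] by (cases "norm x \<le> R") auto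
  ultimately show ?thesis by (simp only:)
qed

text \<open>A uniform second-order Taylor remainder, the working form of C^{1,1}. It passes through
  integrals, and it yields differentiability as well as the size and the Lipschitz constant of
  \<open>D\<close>.\<close>

definition C11_bound :: "('a::euclidean_space \<Rightarrow> real) \<Rightarrow> ('a \<Rightarrow> 'a) \<Rightarrow> real \<Rightarrow> bool" where
  "C11_bound \<phi> D A \<longleftrightarrow> (\<forall>z h. \<bar>\<phi> (z + h) - \<phi> z - D z \<bullet> h\<bar> \<le> A * (norm h)\<^sup>2)"

lemma C11_boundD: "C11_bound \<phi> D A \<Longrightarrow> \<bar>\<phi> (z + h) - \<phi> z - D z \<bullet> h\<bar> \<le> A * (norm h)\<^sup>2"
  by (simp add: C11_bound_def)

lemma C11_bound_nonneg:
  fixes \<phi> :: "'a::euclidean_space \<Rightarrow> real"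
  assumes "C11_bound \<phi> D A"
  shows "0 \<le> A"
proof -
  obtain h :: 'a where "norm h = 1" using vector_choose_size[of 1] by auto
  then show ?thesis using C11_boundD[OF assms, of 0 h] by simp
qed

text \<open>Taylor along \<open>h\<close> parallel to \<open>D z\<close> of length
  \<open>\<tau>\<close> gives \<open>norm (D z) <= L + A * \<tau>\<close>; then
  \<open>\<tau>\<close> tends to 0. Being local, the argument also shows that gradients vanish
  outside the support.\<close>

lemma C11_bound_inner_le:
  assumes \<phi>: "C11_bound \<phi> D A" and e: "0 < e"
    and lip: "\<And>h. norm h < e \<Longrightarrow> \<bar>\<phi> (z + h) - \<phi> z\<bar> \<le> L * norm h"
  shows "norm (D z) \<le> L"
proof (cases "D z = 0")
  case True
  obtain h :: 'a where "norm h = e / 2" using vector_choose_size[of "e/2"] e by auto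
  then have "0 \<le> L * (e / 2)" using lip[of h] e by (smt (verit) field_sum_of_halves)
  then show ?thesis using True e by (simp add: zero_le_mult_iff)
next
  case False
  define n where "n = norm (D z)"
  have n: "n > 0" using False by (simp add: n_def)
  have le: "n \<le> L + A * \<tau>" if \<tau>: "0 < \<tau>" "\<tau> < e" for \<tau>
  proof -
    define h where "h = (\<tau> / n) *\<^sub>R D z"
    have h: "norm h = \<tau>" using n \<tau> by (simp add: h_def n_def[symmetric])
    have "D z \<bullet> h = \<tau> * n" using n by (simp add: h_def n_def dot_square_norm power2_eq_square)
    then have "\<tau> * n \<le> L * \<tau> + A * \<tau>\<^sup>2"
      using C11_boundD[OF \<phi>, of z h] lip[of h] h \<tau> by simp
    then have "\<tau> * n \<le> \<tau> * (L + A * \<tau>)" by (simp add: algebra_simps power2_eq_square)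
    then show ?thesis using \<tau> by simp
  qed
  have "((\<lambda>\<tau>. L + A * \<tau>) \<longlongrightarrow> L + A * 0) (at_right 0)" by (intro tendsto_intros)
  moreover have "eventually (\<lambda>\<tau>. n \<le> L + A * \<tau>) (at_right 0)"
    using e by (subst eventually_at_right[of 0 1]) (auto intro!: exI[of _ e] le)
  ultimately show ?thesis unfolding n_def using tendsto_lowerbound by fastforce
qed

lemma C11_bound_grad_zero:
  assumes "C11_bound \<phi> D A" "\<And>x. R < norm x \<Longrightarrow> \<phi> x = 0" "R < norm z"
  shows "D z = 0"
proof -
  have "norm (D z) \<le> 0"
  proof (rule C11_bound_inner_le[OF assms(1), of "norm z - R"])
    fix h :: 'a assume "norm h < norm z - R"
    then have "R < norm (z + h)" using norm_diff_ineq[of z h] by linarith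
    then show "\<bar>\<phi> (z + h) - \<phi> z\<bar> \<le> 0 * norm h" using assms(2,3) by simp
  qed (use assms in auto)
  then show ?thesis by simp
qed

text \<open>Three expansions, at \<open>z\<close> by \<open>h\<close> and at \<open>w\<close> by
  \<open>z - w\<close> and \<open>z - w + h\<close>, are compared for \<open>h\<close> of length
  \<open>d = norm (z - w)\<close> in the direction \<open>D z - D w\<close>. Their remainders
  \<open>A * d^2\<close>, \<open>A * d^2\<close> and \<open>A * (2 * d)^2\<close> add up to the
  6.\<close>

lemma C11_bound_grad_lipschitz:
  assumes \<phi>: "C11_bound \<phi> D A"
  shows "norm (D z - D w) \<le> 6 * A * norm (z - w)"
proof (cases "D z = D w")
  case True
  then show ?thesis using C11_bound_nonneg[OF \<phi>] by simp
next
  case False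
  define d where "d = norm (z - w)"
  define n where "n = norm (D z - D w)"
  have pos: "n > 0" "d > 0" using False by (auto simp: n_def d_def)
  define h where "h = (d / n) *\<^sub>R (D z - D w)"
  have h: "norm h = d" using pos by (simp add: h_def n_def[symmetric])
  have A: "0 \<le> A" by (rule C11_bound_nonneg[OF \<phi>])
  have "(D z - D w) \<bullet> h = d * n"
    using pos by (simp add: h_def n_def dot_square_norm power2_eq_square)
  moreover have "\<bar>\<phi> (z + h) - \<phi> z - D z \<bullet> h\<bar> \<le> A * d\<^sup>2" using C11_boundD[OF \<phi>, of z h] h by simp
  moreover have "\<bar>\<phi> z - \<phi> w - D w \<bullet> (z - w)\<bar> \<le> A * d\<^sup>2"
    using C11_boundD[OF \<phi>, of w "z - w"] by (simp add: d_def)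
  moreover have "\<bar>\<phi> (z + h) - \<phi> w - D w \<bullet> (z - w + h)\<bar> \<le> A * (2 * d)\<^sup>2"
  proof -
    have "norm (z - w + h) \<le> 2 * d" using norm_triangle_ineq[of "z - w" h] h by (simp add: d_def)
    then have "A * (norm (z - w + h))\<^sup>2 \<le> A * (2 * d)\<^sup>2" using A by (intro mult_left_mono power_mono) auto
    then show ?thesis using C11_boundD[OF \<phi>, of w "z - w + h"] by (simp add: algebra_simps)
  qed
  ultimately have "d * n \<le> A * (2 * d)\<^sup>2 + A * d\<^sup>2 + A * d\<^sup>2"
    unfolding inner_diff_left inner_add_right by linarith
  also have "\<dots> = d * (6 * A * d)" by (simp add: power2_eq_square)
  finally show ?thesis using pos by (simp add: n_def d_def)
qed

lemma C11_bound_has_derivative: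
  fixes \<phi> :: "'a::euclidean_space \<Rightarrow> real"
  assumes \<phi>: "C11_bound \<phi> D A"
  shows "(\<phi> has_derivative (\<lambda>h. D z \<bullet> h)) (at z)"
  unfolding has_derivative_at
proof
  show "bounded_linear ((\<bullet>) (D z))" by (rule bounded_linear_inner_right)
  have "((\<lambda>h::'a. A * norm h) \<longlongrightarrow> A * norm (0::'a)) (at 0)"
    by (rule tendsto_mult_left[OF tendsto_norm[OF tendsto_ident_at]])
  then have lim: "((\<lambda>h::'a. A * norm h) \<longlongrightarrow> 0) (at 0)" by simp
  show "(\<lambda>h. norm (\<phi> (z + h) - \<phi> z - D z \<bullet> h) / norm h) \<midarrow>0\<rightarrow> 0"
  proof (rule Lim_null_comparison[OF _ lim])
    show "\<forall>\<^sub>F h in at 0. norm (norm (\<phi> (z + h) - \<phi> z - D z \<bullet> h) / norm h) \<le> A * norm h"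
    proof (intro always_eventually allI)
      fix h
      show "norm (norm (\<phi> (z + h) - \<phi> z - D z \<bullet> h) / norm h) \<le> A * norm h"
        using C11_boundD[OF \<phi>, of z h] by (cases "h = 0") (auto simp: field_simps power2_eq_square)
    qed
  qed
qed

lemma C11_bound_grad_continuous:
  assumes "C11_bound \<phi> D A"
  shows "continuous_on UNIV D"
  by (rule lipschitz_on_continuous_on[where L="6 * A"], rule lipschitz_onI)
     (use C11_bound_grad_lipschitz[OF assms] C11_bound_nonneg[OF assms] in \<open>auto simp: dist_norm\<close>)

text \<open>The square of a positive part is only C^{1,1}, which already makes mollified functions
  admissible as C^1 test functions, and its remainder can be computed by hand.\<close>

definition bump :: "real \<Rightarrow> 'a::euclidean_space \<Rightarrow> real" where
  "bump e z = (max 0 (e\<^sup>2 - (norm z)\<^sup>2))\<^sup>2"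

definition bump_grad :: "real \<Rightarrow> 'a::euclidean_space \<Rightarrow> 'a" where
  "bump_grad e z = (- 4 * max 0 (e\<^sup>2 - (norm z)\<^sup>2)) *\<^sub>R z"

lemma bump_nonneg: "0 \<le> bump e z"
  by (simp add: bump_def)

lemma bump_outside:
  assumes "0 < e" "e \<le> norm z"
  shows "bump e z = 0" "bump_grad e z = 0"
proof -
  have "e\<^sup>2 \<le> (norm z)\<^sup>2" using assms by (intro power_mono) auto
  then show "bump e z = 0" "bump_grad e z = 0" by (auto simp: bump_def bump_grad_def)
qed

lemma bump_continuous: "continuous_on UNIV (bump e)" "continuous_on UNIV (bump_grad e)"
  unfolding bump_def[abs_def] bump_grad_def[abs_def] by (intro continuous_intros)+

text \<open>The derivative \<open>2 * max 0 x\<close> is Lipschitz with constant 2, so the remainder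
  is at most \<open>d^2\<close>; this is checked in the four sign cases.\<close>

lemma square_pos_part_taylor:
  fixes x d :: real
  shows "\<bar>(max 0 (x + d))\<^sup>2 - (max 0 x)\<^sup>2 - 2 * max 0 x * d\<bar> \<le> d\<^sup>2"
proof -
  consider "0 \<le> x" "0 \<le> x + d" | "0 \<le> x" "x + d < 0" | "x < 0" "0 \<le> x + d" | "x < 0" "x + d < 0"
    by linarith
  then show ?thesis
  proof cases
    case 2
    have "0 \<le> - (2 * x * d) - x\<^sup>2"
      using mult_nonneg_nonneg[of x "- (x + d)"] mult_nonneg_nonneg[of x "- d"] 2
      by (simp add: power2_eq_square algebra_simps)
    moreover have "- (2 * x * d) - x\<^sup>2 \<le> d\<^sup>2"
      using zero_le_power2[of "x + d"] unfolding power2_sum by linarith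
    ultimately show ?thesis using 2 by (simp add: max_def)
  next
    case 3
    then have "(x + d)\<^sup>2 \<le> d\<^sup>2" by (intro power_mono) auto
    then show ?thesis using 3 by (simp add: max_def)
  qed (auto simp: max_def power2_eq_square algebra_simps)
qed

text \<open>For \<open>norm h <= e\<close> and \<open>norm z <= 2 * e\<close> the difference e^2 -
  |z|^2 changes by at most \<open>5 * e * norm h\<close>, which gives 25, and its own quadratic part
  adds 2. For \<open>norm h <= e\<close> and larger \<open>z\<close> both points are outside the
  ball; for \<open>norm h > e\<close> crude bounds of size \<open>e^4\<close> and
  \<open>4 * e^3 * norm h\<close> suffice.\<close>

lemma bump_C11:
  assumes e: "0 < e"
  shows "C11_bound (bump e) (bump_grad e) (27 * e\<^sup>2)"
  unfolding C11_bound_def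
proof (intro allI)
  fix z h :: 'a
  define q where "q = max 0 (e\<^sup>2 - (norm z)\<^sup>2)"
  have q: "0 \<le> q" "q \<le> e\<^sup>2" by (auto simp: q_def)
  define d where "d = - (2 * (z \<bullet> h)) - (norm h)\<^sup>2"
  have bz: "bump e z = q\<^sup>2" and gz: "bump_grad e z \<bullet> h = - 4 * q * (z \<bullet> h)"
    by (auto simp: bump_def bump_grad_def q_def)
  have "e\<^sup>2 - (norm (z + h))\<^sup>2 = (e\<^sup>2 - (norm z)\<^sup>2) + d"
    unfolding d_def power2_norm_eq_inner by (simp add: inner_add_left inner_add_right inner_commute)
  then have bzh: "bump e (z + h) = (max 0 ((e\<^sup>2 - (norm z)\<^sup>2) + d))\<^sup>2" by (simp add: bump_def)
  have main: "\<bar>bump e (z + h) - bump e z - bump_grad e z \<bullet> h\<bar> \<le> d\<^sup>2 + 2 * q * (norm h)\<^sup>2"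
  proof -
    have "bump e (z + h) - bump e z - bump_grad e z \<bullet> h
      = ((max 0 ((e\<^sup>2 - (norm z)\<^sup>2) + d))\<^sup>2 - q\<^sup>2 - 2 * q * d) - 2 * q * (norm h)\<^sup>2"
      unfolding bzh bz gz by (simp add: d_def algebra_simps)
    moreover have "0 \<le> 2 * q * (norm h)\<^sup>2" using q by simp
    ultimately show ?thesis using square_pos_part_taylor[of "e\<^sup>2 - (norm z)\<^sup>2" d]
      unfolding q_def[symmetric] by linarith
  qed
  have le_e: "z \<bullet> h \<le> norm z * norm h" "- (z \<bullet> h) \<le> norm z * norm h"
    using Cauchy_Schwarz_ineq2[of z h] by auto
  show "\<bar>bump e (z + h) - bump e z - bump_grad e z \<bullet> h\<bar> \<le> 27 * e\<^sup>2 * (norm h)\<^sup>2"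
  proof (cases "norm h \<le> e")
    case True
    show ?thesis
    proof (cases "norm z \<le> 2 * e")
      case z: True
      have "norm z * norm h \<le> 2 * e * norm h" using z by (intro mult_right_mono) auto
      moreover have "(norm h)\<^sup>2 \<le> e * norm h"
        unfolding power2_eq_square using True by (intro mult_right_mono) auto
      ultimately have "\<bar>d\<bar> \<le> 5 * e * norm h"
        using le_e zero_le_power2[of "norm h"] unfolding d_def by linarith
      then have "d\<^sup>2 \<le> (5 * e * norm h)\<^sup>2" by (metis abs_ge_zero power2_abs power_mono)
      moreover have "2 * q * (norm h)\<^sup>2 \<le> 2 * e\<^sup>2 * (norm h)\<^sup>2" using q by (intro mult_right_mono) auto
      ultimately show ?thesis using main by (simp add: power_mult_distrib)
    next
      case z: False
      then have "e \<le> norm (z + h)" using norm_diff_ineq[of z h] True by linarith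
      then show ?thesis using z e by (simp add: bump_outside)
    qed
  next
    case False
    have bnd: "0 \<le> bump e x" "bump e x \<le> (e\<^sup>2)\<^sup>2" for x :: 'a
      unfolding bump_def by (simp, intro power_mono) auto
    have g: "\<bar>bump_grad e z \<bullet> h\<bar> \<le> 4 * e^3 * norm h"
    proof (cases "norm z < e")
      case True
      have "\<bar>bump_grad e z \<bullet> h\<bar> \<le> norm (bump_grad e z) * norm h" by (rule Cauchy_Schwarz_ineq2)
      also have "norm (bump_grad e z) = 4 * (q * norm z)" using q by (simp add: bump_grad_def q_def[symmetric])
      also have "q * norm z \<le> e\<^sup>2 * e" using q True by (intro mult_mono) auto
      finally show ?thesis by (simp add: mult_right_mono power3_eq_cube power2_eq_square)
    next
      case False
      then show ?thesis using e by (simp add: bump_outside)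
    qed
    have "e^3 * norm h \<le> e\<^sup>2 * (norm h)\<^sup>2"
      using False e mult_right_mono[of e "norm h" "e\<^sup>2 * norm h"]
      by (simp add: power3_eq_cube power2_eq_square algebra_simps)
    moreover have "(e\<^sup>2)\<^sup>2 \<le> e\<^sup>2 * (norm h)\<^sup>2"
      unfolding power2_eq_square[of "e\<^sup>2"] using False e by (intro mult_left_mono power_mono) auto
    moreover have "\<bar>bump e (z + h) - bump e z - bump_grad e z \<bullet> h\<bar> \<le> (e\<^sup>2)\<^sup>2 + 4 * e^3 * norm h"
      using g bnd[of z] bnd[of "z + h"] by linarith
    moreover have "0 \<le> e\<^sup>2 * (norm h)\<^sup>2" by simp
    ultimately show ?thesis by linarith
  qed
qed

lemma bump_integrable: "0 < e \<Longrightarrow> integrable lborel (bump e :: 'a::euclidean_space \<Rightarrow> real)"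
  by (rule integrable_compact_support[where R=e]) (auto simp: bump_continuous bump_outside)

lemma bump_integral_pos:
  assumes e: "0 < e"
  shows "0 < (\<integral>y. bump e (y::'a::euclidean_space) \<partial>lborel)"
proof -
  have "(\<integral>y. bump e (y::'a) \<partial>lborel) \<noteq> 0"
  proof
    assume "(\<integral>y. bump e (y::'a) \<partial>lborel) = 0"
    then have "AE y in lborel. bump e (y::'a) = 0"
      using integral_nonneg_eq_0_iff_AE[OF bump_integrable[OF e, where 'a='a]] by (simp add: bump_nonneg)
    then have "AE y in lborel. (y::'a) \<notin> ball 0 e"
    proof eventually_elim
      case (elim y)
      show ?case
      proof
        assume "y \<in> ball 0 e"
        then have "(norm y)\<^sup>2 < e\<^sup>2" by (intro power_strict_mono) auto
        then show False using elim by (simp add: bump_def max_def split: if_splits)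
      qed
    qed
    then have "emeasure lborel (ball (0::'a) e) = 0"
      by (subst (asm) AE_iff_measurable[where N = "ball 0 e"]) auto
    then show False using e content_ball_pos[of e "0::'a"] by (simp add: measure_def)
  qed
  moreover have "0 \<le> (\<integral>y. bump e (y::'a) \<partial>lborel)" by (intro integral_nonneg_AE) (auto simp: bump_nonneg)
  ultimately show ?thesis by simp
qed

definition mollifier :: "real \<Rightarrow> 'a::euclidean_space \<Rightarrow> real" where
  "mollifier e z = bump e z / (\<integral>y. bump e (y::'a) \<partial>lborel)"

definition mollifier_grad :: "real \<Rightarrow> 'a::euclidean_space \<Rightarrow> 'a" where
  "mollifier_grad e z = bump_grad e z /\<^sub>R (\<integral>y. bump e (y::'a) \<partial>lborel)"

text \<open>This constant explodes as \<open>e\<close> tends to 0. In the transport argument it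
  multiplies only squares of \<open>K\<close>, which subdivision eliminates while \<open>e\<close>
  is still fixed.\<close>

definition mollifier_const :: "'a::euclidean_space itself \<Rightarrow> real \<Rightarrow> real" where
  "mollifier_const _ e = 27 * e\<^sup>2 / (\<integral>y. bump e (y::'a) \<partial>lborel)"

lemma mollifier_continuous: "continuous_on UNIV (mollifier e)" "continuous_on UNIV (mollifier_grad e)"
  unfolding mollifier_def[abs_def] mollifier_grad_def[abs_def] divide_inverse
  by (intro continuous_intros bump_continuous)+

lemma mollifier_measurable [measurable]:
  "mollifier e \<in> borel_measurable borel" "mollifier_grad e \<in> borel_measurable borel"
  by (intro borel_measurable_continuous_onI mollifier_continuous)+

lemma mollifier_outside:
  "0 < e \<Longrightarrow> e \<le> norm z \<Longrightarrow> mollifier e z = 0" "0 < e \<Longrightarrow> e \<le> norm z \<Longrightarrow> mollifier_grad e z = 0"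
  by (auto simp: mollifier_def mollifier_grad_def bump_outside)

lemma mollifier_nonneg: "0 < e \<Longrightarrow> 0 \<le> mollifier e z"
  unfolding mollifier_def using bump_integral_pos by (intro divide_nonneg_pos bump_nonneg) auto

lemma mollifier_integrable: "0 < e \<Longrightarrow> integrable lborel (mollifier e)"
  unfolding mollifier_def[abs_def] by (intro integrable_divide bump_integrable) auto

lemma mollifier_integral: "0 < e \<Longrightarrow> (\<integral>y. mollifier e (y::'a::euclidean_space) \<partial>lborel) = 1"
  unfolding mollifier_def using bump_integral_pos[of e, where 'a='a] by simp

lemma mollifier_grad_integrable:
  assumes e: "0 < e"
  shows "integrable lborel (mollifier_grad e :: 'a::euclidean_space \<Rightarrow> 'a)"
  by (rule integrable_compact_support[where R=e]) (use e in \<open>auto simp: mollifier_continuous mollifier_outside\<close>)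

lemma mollifier_C11:
  assumes e: "0 < e"
  shows "C11_bound (mollifier e :: 'a::euclidean_space \<Rightarrow> real) (mollifier_grad e) (mollifier_const TYPE('a) e)"
  unfolding C11_bound_def
proof (intro allI)
  fix z h :: 'a
  let ?c = "\<integral>y. bump e (y::'a) \<partial>lborel"
  have c: "?c > 0" by (rule bump_integral_pos[OF e])
  have "mollifier e (z + h) - mollifier e z - mollifier_grad e z \<bullet> h
      = (bump e (z + h) - bump e z - bump_grad e z \<bullet> h) / ?c"
    by (simp add: mollifier_def mollifier_grad_def diff_divide_distrib divide_inverse algebra_simps)
  then show "\<bar>mollifier e (z + h) - mollifier e z - mollifier_grad e z \<bullet> h\<bar>
      \<le> mollifier_const TYPE('a) e * (norm h)\<^sup>2"
    using C11_boundD[OF bump_C11[OF e], of z h] c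
    by (simp add: mollifier_const_def abs_divide divide_right_mono)
qed

text \<open>The class is closed, with explicit constants, under mollification and under composition
  with a Lipschitz flow of bounded displacement. Functions of class C^1 need not stay so under the
  latter.\<close>

definition lip_compact :: "real \<Rightarrow> real \<Rightarrow> ('a::euclidean_space \<Rightarrow> real) \<Rightarrow> bool" where
  "lip_compact L R u \<longleftrightarrow> 0 \<le> L \<and> 0 \<le> R \<and> (\<forall>x y. \<bar>u x - u y\<bar> \<le> L * norm (x - y)) \<and>
     (\<forall>x. R < norm x \<longrightarrow> u x = 0)"

lemma lip_compactD:
  assumes "lip_compact L R u"
  shows "0 \<le> L" "0 \<le> R" "\<bar>u x - u y\<bar> \<le> L * norm (x - y)" "R < norm x \<Longrightarrow> u x = 0"
  using assms by (auto simp: lip_compact_def)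

lemma lip_compact_continuous:
  assumes "lip_compact L R u"
  shows "continuous_on UNIV u"
  by (rule lipschitz_on_continuous_on[where L=L], rule lipschitz_onI)
     (use lip_compactD[OF assms] in \<open>auto simp: dist_norm\<close>)

lemma lip_compact_measurable: "lip_compact L R u \<Longrightarrow> u \<in> borel_measurable borel"
  by (intro borel_measurable_continuous_onI lip_compact_continuous)

lemma lip_compact_bound:
  fixes u :: "'a::euclidean_space \<Rightarrow> real"
  assumes u: "lip_compact L R u"
  shows "\<bar>u x\<bar> \<le> L * (2 * R + 1)"
proof (cases "R < norm x")
  case True
  then show ?thesis using lip_compactD(1,2,4)[OF u] by simp
next
  case False
  \<comment> \<open>Vanishing is known only for norms strictly above \<open>R\<close>; a point of
    norm \<open>R + 1\<close> is a zero at distance at most \<open>2 * R + 1\<close> from every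
    point of the ball.\<close>
  obtain y :: 'a where y: "norm y = R + 1" using vector_choose_size[of "R + 1"] lip_compactD(2)[OF u] by auto
  then have "u y = 0" by (intro lip_compactD(4)[OF u]) simp
  then have "\<bar>u x\<bar> \<le> L * norm (x - y)" using lip_compactD(3)[OF u, of x y] by simp
  also have "norm (x - y) \<le> 2 * R + 1" using norm_triangle_ineq4[of x y] False y by linarith
  finally show ?thesis using lip_compactD(1)[OF u] by (simp add: mult_left_mono)
qed

lemma lip_compact_integrable_mult:
  fixes f :: "'a::euclidean_space \<Rightarrow> 'b::euclidean_space"
  assumes u: "lip_compact L R u" and f: "continuous_on UNIV f"
  shows "integrable lborel (\<lambda>y. u y *\<^sub>R f y)"
  by (rule integrable_compact_support[where R=R])
     (auto intro!: continuous_intros lip_compact_continuous[OF u] f simp: lip_compactD(4)[OF u])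

section \<open>Mollified Lipschitz functions and their gradients\<close>

definition mollify :: "real \<Rightarrow> ('a::euclidean_space \<Rightarrow> real) \<Rightarrow> 'a \<Rightarrow> real" where
  "mollify e u z = (\<integral>y. mollifier e y * u (z - y) \<partial>lborel)"

definition mollify_grad :: "real \<Rightarrow> ('a::euclidean_space \<Rightarrow> real) \<Rightarrow> 'a \<Rightarrow> 'a" where
  "mollify_grad e u z = (\<integral>y. u y *\<^sub>R mollifier_grad e (z - y) \<partial>lborel)"

lemma mollifier_mult_integrable:
  fixes u :: "'a::euclidean_space \<Rightarrow> real"
  assumes e: "0 < e" and u: "continuous_on UNIV u"
  shows "integrable lborel (\<lambda>y. mollifier e y * u y)"
  by (rule integrable_compact_support[where R=e])
     (use e in \<open>auto intro!: continuous_intros mollifier_continuous u simp: mollifier_outside\<close>)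

text \<open>An average of differences, at possibly different base points. Closeness to
  \<open>u\<close>, preservation of the Lipschitz constant, the support bound and the comparison
  along the flow are all instances.\<close>

lemma mollify_diff_le:
  fixes u v :: "'a::euclidean_space \<Rightarrow> real"
  assumes e: "0 < e" and u: "continuous_on UNIV u" and v: "continuous_on UNIV v"
    and le: "\<And>y. norm y < e \<Longrightarrow> \<bar>u (z - y) - v (w - y)\<bar> \<le> \<eta>"
  shows "\<bar>mollify e u z - mollify e v w\<bar> \<le> \<eta>"
proof -
  have iu: "integrable lborel (\<lambda>y. mollifier e y * u (z - y))" and iv: "integrable lborel (\<lambda>y. mollifier e y * v (w - y))"
    by (intro mollifier_mult_integrable[OF e] continuous_on_compose2[OF u] continuous_on_compose2[OF v]
        continuous_intros subset_UNIV)+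
  have "\<bar>mollify e u z - mollify e v w\<bar> = \<bar>\<integral>y. mollifier e y * u (z - y) - mollifier e y * v (w - y) \<partial>lborel\<bar>"
    unfolding mollify_def using iu iv by simp
  also have "\<dots> \<le> (\<integral>y. mollifier e (y::'a) * \<eta> \<partial>lborel)"
  proof (rule Bochner_Integration.integral_abs_bound_integral)
    fix y
    show "\<bar>mollifier e y * u (z - y) - mollifier e y * v (w - y)\<bar> \<le> mollifier e y * \<eta>"
    proof (cases "norm y < e")
      case True
      then show ?thesis using le[of y] mollifier_nonneg[OF e, of y]
        by (simp add: right_diff_distrib[symmetric] abs_mult mult_left_mono)
    qed (use mollifier_outside(1)[OF e, of y] in auto)
  qed (use iu iv in \<open>auto intro!: mollifier_integrable e\<close>)
  also have "\<dots> = \<eta>" using mollifier_integral[OF e, where 'a='a] by simp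
  finally show ?thesis .
qed

lemma mollify_const_fun:
  assumes "0 < e"
  shows "mollify e (\<lambda>_. c) (z::'a::euclidean_space) = c"
  unfolding mollify_def using mollifier_integral[OF assms, where 'a='a] by simp

lemma mollify_close:
  assumes e: "0 < e" and u: "lip_compact L R u"
  shows "\<bar>mollify e u z - u z\<bar> \<le> L * e"
proof -
  have "\<bar>mollify e u z - mollify e (\<lambda>_. u z) z\<bar> \<le> L * e"
  proof (rule mollify_diff_le[OF e lip_compact_continuous[OF u]])
    fix y :: 'a assume "norm y < e"
    then have "L * norm y \<le> L * e" using lip_compactD(1)[OF u] by (intro mult_left_mono) auto
    then show "\<bar>u (z - y) - u z\<bar> \<le> L * e" using lip_compactD(3)[OF u, of "z - y" z] by simp
  qed simp
  then show ?thesis by (simp add: mollify_const_fun[OF e])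
qed

lemma mollify_lip_compact:
  assumes e: "0 < e" and u: "lip_compact L R u"
  shows "lip_compact L (R + e) (mollify e u)"
  unfolding lip_compact_def
proof (intro conjI allI impI)
  note ucont = lip_compact_continuous[OF u]
  show "0 \<le> L" "0 \<le> R + e" using e lip_compactD(1,2)[OF u] by auto
  show "\<bar>mollify e u x - mollify e u y\<bar> \<le> L * norm (x - y)" for x y
  proof (rule mollify_diff_le[OF e ucont ucont])
    show "\<bar>u (x - w) - u (y - w)\<bar> \<le> L * norm (x - y)" for w
      using lip_compactD(3)[OF u, of "x - w" "y - w"] by simp
  qed
  fix x :: 'a assume x: "R + e < norm x"
  have "\<bar>mollify e u x - mollify e (\<lambda>_. 0) x\<bar> \<le> 0"
  proof (rule mollify_diff_le[OF e ucont])
    fix y :: 'a assume "norm y < e"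
    then have "R < norm (x - y)" using x norm_triangle_ineq2[of x y] by linarith
    then show "\<bar>u (x - y) - 0\<bar> \<le> 0" using lip_compactD(4)[OF u] by simp
  qed simp
  then show "mollify e u x = 0" by (simp add: mollify_const_fun[OF e])
qed

text \<open>The definition translates \<open>u\<close>, which suits comparisons; moving
  \<open>z\<close> into the mollifier by reflection allows differentiation although \<open>u\<close>
  is only Lipschitz.\<close>

lemma mollify_alt:
  assumes u: "lip_compact L R u"
  shows "mollify e u z = (\<integral>y. u y * mollifier e (z - y) \<partial>lborel)"
proof -
  have [measurable]: "u \<in> borel_measurable borel" by (rule lip_compact_measurable[OF u])
  have "(\<integral>y. (\<lambda>y. mollifier e y * u (z - y)) (z - y) \<partial>lborel) = mollify e u z"
    unfolding mollify_def by (rule lborel_integral_reflect) measurable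
  then show ?thesis by (simp add: mult.commute)
qed

lemma mollifier_shift_integrable:
  assumes u: "lip_compact L R u"
  shows "integrable lborel (\<lambda>y. u y * mollifier e (z - y))"
    "integrable lborel (\<lambda>y. u y *\<^sub>R mollifier_grad e (z - y))"
proof -
  show "integrable lborel (\<lambda>y. u y *\<^sub>R mollifier_grad e (z - y))"
    by (intro lip_compact_integrable_mult[OF u] continuous_on_compose2[OF mollifier_continuous(2)]
        continuous_intros subset_UNIV)
  have "integrable lborel (\<lambda>y. u y *\<^sub>R mollifier e (z - y))"
    by (intro lip_compact_integrable_mult[OF u] continuous_on_compose2[OF mollifier_continuous(1)]
        continuous_intros subset_UNIV)
  then show "integrable lborel (\<lambda>y. u y * mollifier e (z - y))" by simp
qed

lemma mollify_C11:
  fixes u :: "'a::euclidean_space \<Rightarrow> real"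
  assumes e: "0 < e" and u: "lip_compact L R u"
  shows "C11_bound (mollify e u) (mollify_grad e u)
    (mollifier_const TYPE('a) e * (L * (2 * R + 1) * measure lborel (cball (0::'a) R)))"
  unfolding C11_bound_def
proof (intro allI)
  fix z h :: 'a
  define A where "A = mollifier_const TYPE('a) e * (norm h)\<^sup>2"
  have "mollify e u (z + h) - mollify e u z - mollify_grad e u z \<bullet> h
    = (\<integral>y. u y * mollifier e (z + h - y) - u y * mollifier e (z - y) - (u y *\<^sub>R mollifier_grad e (z - y)) \<bullet> h \<partial>lborel)"
    unfolding mollify_alt[OF u] mollify_grad_def
    using mollifier_shift_integrable[OF u] by (simp del: inner_scaleR_left)
  also have "\<bar>\<dots>\<bar> \<le> (\<integral>y. (L * (2 * R + 1) * A) * indicator (cball (0::'a) R) y \<partial>lborel)"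
  proof (rule Bochner_Integration.integral_abs_bound_integral)
    fix y :: 'a
    have "\<bar>u y * mollifier e (z + h - y) - u y * mollifier e (z - y) - (u y *\<^sub>R mollifier_grad e (z - y)) \<bullet> h\<bar>
      = \<bar>u y\<bar> * \<bar>mollifier e (z - y + h) - mollifier e (z - y) - mollifier_grad e (z - y) \<bullet> h\<bar>"
      by (simp add: abs_mult[symmetric] algebra_simps)
    also have "\<dots> \<le> \<bar>u y\<bar> * A"
      unfolding A_def by (intro mult_left_mono C11_boundD[OF mollifier_C11[OF e]]) auto
    also have "\<dots> \<le> (L * (2 * R + 1) * A) * indicator (cball 0 R) y"
    proof (cases "norm y \<le> R")
      case True
      have "0 \<le> A" unfolding A_def using C11_bound_nonneg[OF mollifier_C11[OF e, where 'a='a]] by simp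
      then show ?thesis using True lip_compact_bound[OF u, of y] by (simp add: mult_right_mono)
    qed (use lip_compactD(4)[OF u, of y] in auto)
    finally show "\<bar>u y * mollifier e (z + h - y) - u y * mollifier e (z - y) - (u y *\<^sub>R mollifier_grad e (z - y)) \<bullet> h\<bar>
      \<le> (L * (2 * R + 1) * A) * indicator (cball 0 R) y" .
    show "integrable lborel (\<lambda>y. (L * (2 * R + 1) * A) * indicator (cball (0::'a) R) y)"
      by (intro integrable_mult_right integrable_real_indicator) (use emeasure_lborel_cball_finite[of "0::'a" R] in auto)
  qed (use mollifier_shift_integrable[OF u] in \<open>auto simp del: inner_scaleR_left
         intro!: Bochner_Integration.integrable_diff integrable_inner_left\<close>)
  also have "\<dots> = mollifier_const TYPE('a) e * (L * (2 * R + 1) * measure lborel (cball (0::'a) R)) * (norm h)\<^sup>2"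
    by (simp add: A_def)
  finally show "\<bar>mollify e u (z + h) - mollify e u z - mollify_grad e u z \<bullet> h\<bar>
    \<le> mollifier_const TYPE('a) e * (L * (2 * R + 1) * measure lborel (cball (0::'a) R)) * (norm h)\<^sup>2" .
qed

text \<open>Unlike the C^{1,1} constant, this bound is independent of \<open>e\<close>:
  mollification preserves the Lipschitz constant, and a Lipschitz constant bounds the
  gradient.\<close>

lemma mollify_grad_le:
  assumes e: "0 < e" and u: "lip_compact L R u"
  shows "norm (mollify_grad e u z) \<le> L"
  by (rule C11_bound_inner_le[OF mollify_C11[OF e u], of 1])
     (use lip_compactD(3)[OF mollify_lip_compact[OF e u], of "z + _" z] in auto)

text \<open>The derivative falls on the mollifier, so closeness in the supremum norm suffices. The
  factor depends on \<open>e\<close>, which stays fixed where this is used, namely in the passage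
  from a countable family to all test functions.\<close>

lemma mollify_grad_diff_le:
  fixes u v :: "'a::euclidean_space \<Rightarrow> real"
  assumes e: "0 < e" and u: "lip_compact L R u" and v: "lip_compact L' R' v"
    and le: "\<And>y. \<bar>u y - v y\<bar> \<le> \<eta>"
  shows "norm (mollify_grad e u z - mollify_grad e v z) \<le> \<eta> * (\<integral>y. norm (mollifier_grad e (y::'a)) \<partial>lborel)"
proof -
  note iu = mollifier_shift_integrable(2)[OF u] and iv = mollifier_shift_integrable(2)[OF v]
  have [measurable]: "u \<in> borel_measurable borel" "v \<in> borel_measurable borel"
    using lip_compact_measurable u v by auto
  have gi: "integrable lborel (\<lambda>y::'a. norm (mollifier_grad e (z - y)))"
  proof -
    have "integrable (distr lborel borel (\<lambda>x::'a. z - x)) (\<lambda>y. norm (mollifier_grad e y))"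
      using mollifier_grad_integrable[OF e, where 'a='a] by (simp add: lborel_distr_reflect integrable_norm)
    then show ?thesis by (subst (asm) integrable_distr_eq) auto
  qed
  have "norm (mollify_grad e u z - mollify_grad e v z) =
      norm (\<integral>y. u y *\<^sub>R mollifier_grad e (z - y) - v y *\<^sub>R mollifier_grad e (z - y) \<partial>lborel)"
    unfolding mollify_grad_def using iu iv by simp
  also have "\<dots> \<le> (\<integral>y. \<eta> * norm (mollifier_grad e (z - y)) \<partial>lborel)"
  proof (rule Bochner_Integration.integral_norm_bound_integral)
    fix y
    show "norm (u y *\<^sub>R mollifier_grad e (z - y) - v y *\<^sub>R mollifier_grad e (z - y)) \<le> \<eta> * norm (mollifier_grad e (z - y))"
      using le[of y] by (simp add: scaleR_diff_left[symmetric] mult_right_mono)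
  qed (use iu iv gi in auto)
  also have "\<dots> = \<eta> * (\<integral>y. norm (mollifier_grad e (z - y)) \<partial>lborel)" by simp
  also have "(\<integral>y. norm (mollifier_grad e (z - y)) \<partial>lborel) = (\<integral>y. norm (mollifier_grad e (y::'a)) \<partial>lborel)"
    by (rule lborel_integral_reflect) measurable
  finally show ?thesis .
qed

subsection \<open>Uniqueness for the linear transport equation\<close>

lemma (in prob_space) integral_diff_le:
  fixes f g :: "'a \<Rightarrow> real"
  assumes f: "integrable M f" and g: "integrable M g" and le: "\<And>x. x \<in> space M \<Longrightarrow> \<bar>f x - g x\<bar> \<le> c"
  shows "\<bar>(\<integral>x. f x \<partial>M) - (\<integral>x. g x \<partial>M)\<bar> \<le> c"
proof -
  have "\<bar>(\<integral>x. f x \<partial>M) - (\<integral>x. g x \<partial>M)\<bar> = \<bar>\<integral>x. f x - g x \<partial>M\<bar>" using f g by simp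
  also have "\<dots> \<le> (\<integral>x. \<bar>f x - g x\<bar> \<partial>M)" by (rule integral_abs_bound)
  also have "\<dots> \<le> (\<integral>x. c \<partial>M)" using f g le by (intro integral_mono) auto
  finally show ?thesis by (simp add: prob_space)
qed

lemma prob_integrable_bounded_continuous:
  fixes f :: "'a::topological_space \<Rightarrow> real"
  assumes M: "prob_space M" and sets: "sets M = sets borel"
    and f: "continuous_on UNIV f" "\<And>x. \<bar>f x\<bar> \<le> c"
  shows "integrable M f"
proof -
  interpret prob_space M by fact
  show ?thesis
  proof (rule integrable_const_bound[where B=c])
    show "f \<in> borel_measurable M"
      using borel_measurable_continuous_onI[OF f(1)] measurable_cong_sets[OF sets refl] by blast
  qed (use f(2) in auto)
qed

lemma prob_integrable_lip_compact:
  assumes "prob_space M" "sets M = sets borel" "lip_compact L R f"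
  shows "integrable M f"
  using prob_integrable_bounded_continuous[OF assms(1,2) lip_compact_continuous[OF assms(3)] lip_compact_bound[OF assms(3)]] .

context local_weight
begin

text \<open>Integrands are controlled only at times where the measure is known to be a solution,
  hence almost everywhere. Changing \<open>g\<close> on a null set reduces the claim to
  \<open>norm_integral_le_K\<close>.\<close>

lemma has_integral_norm_le_K_AE:
  fixes g :: "real \<Rightarrow> 'b::euclidean_space"
  assumes g: "(g has_integral I) {s..t}" and AE: "AE r in lborel. r \<in> {s..t} \<longrightarrow> norm (g r) \<le> c * k r"
  shows "norm I \<le> c * K s t"
proof -
  obtain N where N: "N \<in> null_sets lborel" "{r \<in> space lborel. \<not> (r \<in> {s..t} \<longrightarrow> norm (g r) \<le> c * k r)} \<subseteq> N"
    using AE by (auto elim!: AE_E simp: null_sets_def)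
  have neg: "negligible N"
    using N(1) by (simp add: negligible_iff_null_sets null_sets_completionI)
  define g' where "g' r = (if r \<in> N then 0 else g r)" for r
  define c' where "c' = max c 0"
  have "(g' has_integral I) {s..t}"
    by (rule has_integral_spike[OF neg _ g]) (simp add: g'_def)
  moreover have bd: "norm (g' r) \<le> c' * k r" if "r \<in> {s..t}" for r
  proof (cases "r \<in> N")
    case False
    then have "norm (g r) \<le> c * k r" using N(2) that by auto
    also have "\<dots> \<le> c' * k r" using k_nonneg by (intro mult_right_mono) (auto simp: c'_def)
    finally show ?thesis using False by (simp add: g'_def)
  qed (use k_nonneg in \<open>simp add: g'_def c'_def\<close>)
  ultimately have le': "norm I \<le> c' * K s t"
    using norm_integral_le_K[of g' s t c'] by (auto simp: has_integral_iff)
  show ?thesis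
  proof (cases "0 \<le> c")
    case True
    then show ?thesis using le' by (simp add: c'_def)
  next
    case False
    then have c': "c' = 0" by (simp add: c'_def)
    \<comment> \<open>For negative \<open>c\<close> the bound with \<open>max c 0\<close> only gives
      \<open>norm I <= 0\<close>; but then the hypothesis itself forces \<open>k\<close> to vanish
      off \<open>N\<close>, so the right side is 0 as well.\<close>
    have "k r = 0" if "r \<in> {s..t} - N" for r
    proof -
      have "0 \<le> c * k r" using that N(2) by (auto intro: order_trans[OF norm_ge_zero])
      then show ?thesis using False k_nonneg[of r] by (simp add: zero_le_mult_iff)
    qed
    then have "K s t = integral {s..t} (\<lambda>_. 0)"
      by (intro integral_spike[OF neg]) auto
    then show ?thesis using le' c' by simp
  qed
qed

text \<open>Fubini between a finite measure and the gauge integral in time; the majorant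
  \<open>c * k\<close>, independent of \<open>z\<close>, supplies integrability on the
  product.\<close>

lemma integral_swap:
  fixes g :: "'b \<Rightarrow> real \<Rightarrow> real"
  assumes M: "finite_measure M" and g: "(\<lambda>(z, r). g z r) \<in> borel_measurable (M \<Otimes>\<^sub>M borel)"
    and bound: "\<And>z r. \<bar>g z r\<bar> \<le> c * k r"
  shows "(\<lambda>r. \<integral>z. g z r \<partial>M) integrable_on {s..t}"
    and "integrable M (\<lambda>z. integral {s..t} (g z))"
    and "(\<integral>z. integral {s..t} (g z) \<partial>M) = integral {s..t} (\<lambda>r. \<integral>z. g z r \<partial>M)"
proof -
  interpret M: finite_measure M by fact
  interpret P: pair_sigma_finite M lborel ..
  have [measurable]: "(\<lambda>(z, r). g z r) \<in> borel_measurable (M \<Otimes>\<^sub>M lborel)" using g by simp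
  define f where "f z r = indicator {s..t} r *\<^sub>R g z r" for z r
  have meas [measurable]: "(\<lambda>(z, r). f z r) \<in> borel_measurable (M \<Otimes>\<^sub>M lborel)"
    unfolding f_def by measurable
  have fb: "norm (f z r) \<le> c *\<^sub>R (indicator {s..t} r *\<^sub>R k r)" for z r
    using bound[of z r] by (auto simp: f_def indicator_def)
  have ki: "integrable lborel (\<lambda>r. c *\<^sub>R (indicator {s..t} r *\<^sub>R k r))"
    using k_set_integrable[of s t] unfolding set_integrable_def by (intro integrable_scaleR_right) auto
  have fi: "integrable lborel (f z)" if "z \<in> space M" for z
  proof (rule Bochner_Integration.integrable_bound[OF ki])
    have "(\<lambda>r. (\<lambda>(z, r). f z r) (z, r)) \<in> borel_measurable lborel"
      by (rule measurable_Pair2[OF meas that])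
    then show "f z \<in> borel_measurable lborel" by simp
    show "AE r in lborel. norm (f z r) \<le> norm (c *\<^sub>R (indicator {s..t} r *\<^sub>R k r))"
      using order_trans[OF fb abs_ge_self] by (intro AE_I2) simp
  qed
  have int: "integrable (M \<Otimes>\<^sub>M lborel) (\<lambda>(z, r). f z r)"
  proof (rule P.Fubini_integrable[OF meas])
    show "integrable M (\<lambda>z. \<integral>r. norm (case (z, r) of (z, r) \<Rightarrow> f z r) \<partial>lborel)"
    proof (rule M.integrable_const_bound[where B="\<integral>r. c *\<^sub>R (indicator {s..t} r *\<^sub>R k r) \<partial>lborel"])
      show "AE z in M. norm (\<integral>r. norm (case (z, r) of (z, r) \<Rightarrow> f z r) \<partial>lborel) \<le> (\<integral>r. c *\<^sub>R (indicator {s..t} r *\<^sub>R k r) \<partial>lborel)"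
      proof (rule AE_I2)
        fix z assume "z \<in> space M"
        then have "(\<integral>r. norm (f z r) \<partial>lborel) \<le> (\<integral>r. c *\<^sub>R (indicator {s..t} r *\<^sub>R k r) \<partial>lborel)"
          using fb by (intro integral_mono integrable_norm fi ki)
        then show "norm (\<integral>r. norm (case (z, r) of (z, r) \<Rightarrow> f z r) \<partial>lborel) \<le> (\<integral>r. c *\<^sub>R (indicator {s..t} r *\<^sub>R k r) \<partial>lborel)"
          by simp
      qed
    qed measurable
  qed (use fi in auto)
  have geq: "integral {s..t} (g z) = (\<integral>r. f z r \<partial>lborel)" if "z \<in> space M" for z
    using set_borel_integral_eq_integral(2)[of "{s..t}" "g z"] fi[OF that]
    by (simp add: set_integrable_def set_lebesgue_integral_def f_def[abs_def])
  have inner: "(\<integral>z. f z r \<partial>M) = indicator {s..t} r *\<^sub>R (\<integral>z. g z r \<partial>M)" for r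
    by (simp add: f_def)
  have sint: "set_integrable lborel {s..t} (\<lambda>r. \<integral>z. g z r \<partial>M)"
    using P.integrable_snd[OF int] by (simp add: set_integrable_def inner)
  then show "(\<lambda>r. \<integral>z. g z r \<partial>M) integrable_on {s..t}"
    by (rule set_borel_integral_eq_integral)
  show "integrable M (\<lambda>z. integral {s..t} (g z))"
    using P.integrable_fst[OF int] by (simp add: geq cong: Bochner_Integration.integrable_cong)
  have "(\<integral>z. integral {s..t} (g z) \<partial>M) = (\<integral>z. (\<integral>r. f z r \<partial>lborel) \<partial>M)"
    using geq by (intro Bochner_Integration.integral_cong) auto
  also have "\<dots> = (\<integral>r. (\<integral>z. f z r \<partial>M) \<partial>lborel)"
    using P.Fubini_integral[OF int] by simp
  also have "\<dots> = integral {s..t} (\<lambda>r. \<integral>z. g z r \<partial>M)"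
    using set_borel_integral_eq_integral(2)[OF sint] by (simp add: inner set_lebesgue_integral_def)
  finally show "(\<integral>z. integral {s..t} (g z) \<partial>M) = integral {s..t} (\<lambda>r. \<integral>z. g z r \<partial>M)" .
qed

end

context caratheodory_field
begin

text \<open>Product rule for Lipschitz constants: \<open>6 * A\<close> comes from the gradient
  against the bound of \<open>b\<close>, and \<open>L\<close> from the bound of the gradient against
  the Lipschitz constant of \<open>b\<close>. The integrand of the weak identity thereby becomes a
  test function itself.\<close>

lemma lip_compact_inner_b:
  fixes u :: "'a \<Rightarrow> real"
  assumes e: "0 < e" and u: "lip_compact L R u" and A: "C11_bound (mollify e u) (mollify_grad e u) A"
  shows "lip_compact ((6 * A + L) * k r) (R + e) (\<lambda>z. mollify_grad e u z \<bullet> b r z)"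
  unfolding lip_compact_def
proof (intro conjI allI impI)
  let ?D = "mollify_grad e u"
  show "0 \<le> (6 * A + L) * k r" "0 \<le> R + e"
    using C11_bound_nonneg[OF A] lip_compactD[OF u] e k_nonneg[of r] by auto
  show "?D z \<bullet> b r z = 0" if "R + e < norm z" for z
    using C11_bound_grad_zero[OF A lip_compactD(4)[OF mollify_lip_compact[OF e u]] that] by simp
  fix x y
  have "?D x \<bullet> b r x - ?D y \<bullet> b r y = (?D x - ?D y) \<bullet> b r x + ?D y \<bullet> (b r x - b r y)"
    by (simp add: inner_diff_left inner_diff_right)
  also have "\<bar>\<dots>\<bar> \<le> norm (?D x - ?D y) * norm (b r x) + norm (?D y) * norm (b r x - b r y)"
    by (intro order_trans[OF abs_triangle_ineq] add_mono Cauchy_Schwarz_ineq2)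
  also have "\<dots> \<le> (6 * A * norm (x - y)) * k r + L * (k r * norm (x - y))"
    by (intro add_mono mult_mono C11_bound_grad_lipschitz[OF A] b_bound mollify_grad_le[OF e u] b_lipschitz)
       (use C11_bound_nonneg[OF A] lip_compactD(1)[OF u] in auto)
  finally show "\<bar>?D x \<bullet> b r x - ?D y \<bullet> b r y\<bar> \<le> (6 * A + L) * k r * norm (x - y)"
    by (simp add: algebra_simps)
qed

lemma lip_compact_flow:
  assumes \<phi>: "lip_compact L R \<phi>" and t: "S \<le> t" "t \<le> T"
  shows "lip_compact (L * exp (K S T)) (R + K S T) (\<lambda>z. \<phi> (flow t z T))"
  unfolding lip_compact_def
proof (intro conjI allI impI)
  have Kle: "K t T \<le> K S T" using t by (intro K_mono) auto
  show "0 \<le> L * exp (K S T)" "0 \<le> R + K S T"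
    using lip_compactD[OF \<phi>] K_nonneg[of S T] by auto
  fix x y :: 'a
  have "norm (flow t x T - flow t y T) \<le> norm (x - y) * exp (K t T)" by (rule flow_lipschitz[OF t(2)])
  also have "\<dots> \<le> norm (x - y) * exp (K S T)" using Kle by (intro mult_left_mono) auto
  finally have "L * norm (flow t x T - flow t y T) \<le> L * (norm (x - y) * exp (K S T))"
    using lip_compactD(1)[OF \<phi>] by (intro mult_left_mono)
  then show "\<bar>\<phi> (flow t x T) - \<phi> (flow t y T)\<bar> \<le> L * exp (K S T) * norm (x - y)"
    using lip_compactD(3)[OF \<phi>, of "flow t x T" "flow t y T"] by (simp add: ac_simps)
next
  fix x :: 'a assume x: "R + K S T < norm x"
  have "norm (flow t x T - x) \<le> K S T"
    using flow_displacement[OF t(2), of x] K_mono[of S t T T] t by linarith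
  then have "R < norm (flow t x T)" using x norm_triangle_ineq3[of "flow t x T" x] by linarith
  then show "\<phi> (flow t x T) = 0" by (rule lip_compactD(4)[OF \<phi>])
qed

text \<open>Carrying the mollification points \<open>z - y\<close> by the flow and translating them all by the same
  displacement \<open>B z\<close> differ by \<open>K s t * (K s t + e)\<close> only. Hence the transport equation for the Lipschitz
  function \<open>\<phi> \<circ> flow\<close> is used without differentiating it.\<close>

lemma mollify_flow_increment:
  fixes \<phi> :: "'a \<Rightarrow> real"
  assumes e: "0 < e" and \<phi>: "lip_compact L R \<phi>" and st: "s \<le> t" "t \<le> T"
    and ut: "lip_compact L' R' (\<lambda>z. \<phi> (flow t z T))"
    and A: "C11_bound (mollify e (\<lambda>z. \<phi> (flow t z T))) (mollify_grad e (\<lambda>z. \<phi> (flow t z T))) A"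
  shows "\<bar>mollify e (\<lambda>z. \<phi> (flow s z T)) z - mollify e (\<lambda>z. \<phi> (flow t z T)) z
      - mollify_grad e (\<lambda>z. \<phi> (flow t z T)) z \<bullet> integral {s..t} (\<lambda>r. b r z)\<bar>
    \<le> L' * (K s t * (K s t + e)) + A * (K s t)\<^sup>2"
proof -
  define u where "u t z = \<phi> (flow t z T)" for t z
  define B where "B = integral {s..t} (\<lambda>r. b r z)"
  have "continuous_on UNIV (\<lambda>z. flow s z T)" using st by (intro flow_continuous_start) auto
  then have us: "continuous_on UNIV (u s)"
    unfolding u_def by (rule continuous_on_compose2[OF lip_compact_continuous[OF \<phi>]]) auto
  have "\<bar>mollify e (u s) z - mollify e (u t) (z + B)\<bar> \<le> L' * (K s t * (K s t + e))"
  proof (rule mollify_diff_le[OF e us])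
    show "continuous_on UNIV (u t)" unfolding u_def by (rule lip_compact_continuous[OF ut])
    fix y :: 'a assume y: "norm y < e"
    \<comment> \<open>The semigroup law expresses the function at time \<open>s\<close> by the one
      at time \<open>t\<close>, evaluated at moved points; the Lipschitz bound of the latter absorbs
      the Euler error.\<close>
    have "u s (z - y) = u t (flow s (z - y) t)" by (simp add: u_def flow_semigroup st)
    then have "\<bar>u s (z - y) - u t (z + B - y)\<bar> \<le> L' * norm (flow s (z - y) t - (z + B - y))"
      using lip_compactD(3)[OF ut] by (simp add: u_def)
    also have "norm (flow s (z - y) t - (z + B - y)) \<le> K s t * (K s t + norm y)"
      using flow_Euler[OF st(1), of "z - y" z] by (simp add: B_def algebra_simps)
    also have "K s t * (K s t + norm y) \<le> K s t * (K s t + e)"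
      using y K_nonneg by (intro mult_left_mono) auto
    finally show "\<bar>u s (z - y) - u t (z + B - y)\<bar> \<le> L' * (K s t * (K s t + e))"
      using lip_compactD(1)[OF ut] by (simp add: mult_left_mono)
  qed
  moreover have "\<bar>mollify e (u t) (z + B) - mollify e (u t) z - mollify_grad e (u t) z \<bullet> B\<bar> \<le> A * (K s t)\<^sup>2"
  proof -
    have "norm B \<le> 1 * K s t"
      unfolding B_def by (intro norm_integral_le_K b_integrable_on) (auto simp: b_bound)
    then have "A * (norm B)\<^sup>2 \<le> A * (K s t)\<^sup>2"
      using C11_bound_nonneg[OF A] by (intro mult_left_mono power_mono) auto
    then show ?thesis using C11_boundD[OF A, of z B] by (simp add: u_def[abs_def])
  qed
  ultimately show ?thesis unfolding B_def u_def[abs_def] by linarith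
qed

text \<open>The order of limits matters. For fixed \<open>n\<close> the mean \<open>F\<close> of the
  mollified function has increments \<open>L' * e n * K\<close> plus quadratic terms whose constant
  depends on \<open>n\<close>; subdivision with nodes in \<open>G\<close> removes these, and only
  then does \<open>n\<close> tend to infinity.\<close>

theorem transport_unique:
  fixes \<mu> :: "real \<Rightarrow> 'a measure" and \<phi> :: "'a \<Rightarrow> real"
  assumes prob: "\<And>t. t \<in> G \<Longrightarrow> prob_space (\<mu> t)" and sets: "\<And>t. t \<in> G \<Longrightarrow> sets (\<mu> t) = sets borel"
    and full: "AE t in lborel. S \<le> t \<and> t \<le> T \<longrightarrow> t \<in> G"
    and ST: "S \<in> G" "T \<in> G" "S \<le> T"
    and e: "\<And>n::nat. 0 < e n" "e \<longlonglongrightarrow> 0"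
    and weak: "\<And>n L R \<xi> s t. lip_compact L R \<xi> \<Longrightarrow> s \<in> G \<Longrightarrow> t \<in> G \<Longrightarrow> S \<le> s \<Longrightarrow> s \<le> t \<Longrightarrow> t \<le> T \<Longrightarrow>
      ((\<lambda>r. \<integral>z. mollify_grad (e n) \<xi> z \<bullet> b r z \<partial>\<mu> r) has_integral
        ((\<integral>z. mollify (e n) \<xi> z \<partial>\<mu> t) - (\<integral>z. mollify (e n) \<xi> z \<partial>\<mu> s))) {s..t}"
    and \<phi>: "lip_compact L R \<phi>"
  shows "(\<integral>z. \<phi> z \<partial>\<mu> T) = (\<integral>z. \<phi> (flow S z T) \<partial>\<mu> S)"
proof -
  note int_lc = prob_integrable_lip_compact[OF prob sets]
  have fullI: "AE r in lborel. r \<in> {s..t} \<longrightarrow> P r" if "S \<le> s" "t \<le> T" "\<And>r. r \<in> G \<Longrightarrow> r \<in> {s..t} \<Longrightarrow> P r" for s t P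
    using full by eventually_elim (use that in auto)
  \<comment> \<open>Means of Lipschitz functions are Lipschitz in the clock \<open>K\<close>.
    Applied below to the integrand \<open>D z \<bullet> b r z\<close>, this allows
    \<open>\<mu> r\<close> to be replaced by \<open>\<mu> s\<close> at second-order cost.\<close>
  have lip: "\<bar>(\<integral>z. \<xi> z \<partial>\<mu> t) - (\<integral>z. \<xi> z \<partial>\<mu> s)\<bar> \<le> l * K s t"
    if \<xi>: "lip_compact l R \<xi>" and st: "s \<in> G" "t \<in> G" "S \<le> s" "s \<le> t" "t \<le> T" for \<xi> l R s t
  proof -
    have "\<bar>(\<integral>z. \<xi> z \<partial>\<mu> t) - (\<integral>z. \<xi> z \<partial>\<mu> s)\<bar> \<le> l * K s t + 2 * l * e n" for n
    proof -
      note mlc = mollify_lip_compact[OF e(1) \<xi>, of n]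
      have "\<bar>(\<integral>z. mollify (e n) \<xi> z \<partial>\<mu> r) - (\<integral>z. \<xi> z \<partial>\<mu> r)\<bar> \<le> l * e n" if "r \<in> G" for r
        by (intro prob_space.integral_diff_le prob that int_lc[OF that that mlc] int_lc[OF that that \<xi>]
            mollify_close[OF e(1) \<xi>])
      note this[OF st(1)] this[OF st(2)]
      moreover have "norm ((\<integral>z. mollify (e n) \<xi> z \<partial>\<mu> t) - (\<integral>z. mollify (e n) \<xi> z \<partial>\<mu> s)) \<le> l * K s t"
      proof (rule has_integral_norm_le_K_AE[OF weak[OF \<xi> st]], rule fullI[OF st(3,5)])
        fix r assume r: "r \<in> G"
        then interpret P: prob_space "\<mu> r" by (rule prob)
        note A = mollify_C11[OF e(1) \<xi>, of n]
        have i: "integrable (\<mu> r) (\<lambda>z. mollify_grad (e n) \<xi> z \<bullet> b r z)"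
          by (rule int_lc[OF r r lip_compact_inner_b[OF e(1) \<xi> A]])
        have "\<bar>(\<integral>z. mollify_grad (e n) \<xi> z \<bullet> b r z \<partial>\<mu> r) - (\<integral>z. 0 \<partial>\<mu> r)\<bar> \<le> l * k r"
        proof (rule P.integral_diff_le[OF i])
          fix z
          have "\<bar>mollify_grad (e n) \<xi> z \<bullet> b r z\<bar> \<le> norm (mollify_grad (e n) \<xi> z) * norm (b r z)"
            by (rule Cauchy_Schwarz_ineq2)
          also have "\<dots> \<le> l * k r"
            by (intro mult_mono mollify_grad_le[OF e(1) \<xi>] b_bound lip_compactD(1)[OF \<xi>]) auto
          finally show "\<bar>mollify_grad (e n) \<xi> z \<bullet> b r z - 0\<bar> \<le> l * k r" by simp
        qed simp
        then show "norm (\<integral>z. mollify_grad (e n) \<xi> z \<bullet> b r z \<partial>\<mu> r) \<le> l * k r" by simp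
      qed
      ultimately show ?thesis by (simp add: algebra_simps)
    qed
    moreover have "(\<lambda>n. l * K s t + 2 * l * e n) \<longlonglongrightarrow> l * K s t + 2 * l * 0"
      by (intro tendsto_intros e(2))
    ultimately show ?thesis using LIMSEQ_le_const by fastforce
  qed
  define u where "u t z = \<phi> (flow t z T)" for t z
  define L' where "L' = L * exp (K S T)"
  define R' where "R' = R + K S T"
  have u_lc: "lip_compact L' R' (u t)" if "S \<le> t" "t \<le> T" for t
    unfolding u_def L'_def R'_def by (rule lip_compact_flow[OF \<phi> that])
  have L'0: "0 \<le> L'" using u_lc[OF ST(3) order_refl] lip_compactD(1) by blast
  have main: "\<bar>(\<integral>z. \<phi> z \<partial>\<mu> T) - (\<integral>z. \<phi> (flow S z T) \<partial>\<mu> S)\<bar> \<le> L' * e n * (K S T + 2)" for n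
  proof -
    define F where "F t = (\<integral>z. mollify (e n) (u t) z \<partial>\<mu> t)" for t
    define A where "A = mollifier_const TYPE('a) (e n) * (L' * (2 * R' + 1) * measure lborel (cball (0::'a) R'))"
    have C11: "C11_bound (mollify (e n) (u t)) (mollify_grad (e n) (u t)) A" if "S \<le> t" "t \<le> T" for t
      unfolding A_def by (rule mollify_C11[OF e(1) u_lc[OF that]])
    have A0: "0 \<le> A" using C11_bound_nonneg[OF C11[OF ST(3) order_refl]] .
    \<comment> \<open>Bookkeeping: freezing the measure at \<open>s\<close> costs
      \<open>(6 * A + L') * K^2\<close>, freezing the flow costs
      \<open>L' * K * (K + e n) + A * K^2\<close>. Only \<open>L' * e n * K\<close> is linear in
      \<open>K\<close>.\<close>
    have incr: "\<bar>F t - F s\<bar> \<le> (L' * e n) * K s t + (2 * L' + 7 * A) * (K s t)\<^sup>2"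
      if st: "s \<in> G" "t \<in> G" "S \<le> s" "s \<le> t" "t \<le> T" for s t
    proof -
      have St: "S \<le> t" "s \<le> T" using st by auto
      interpret P: prob_space "\<mu> s" by (rule prob[OF st(1)])
      have sets_s [measurable_cong]: "sets (\<mu> s) = sets borel" by (rule sets[OF st(1)])
      define D where "D = mollify_grad (e n) (u t)"
      have [measurable]: "D \<in> borel_measurable borel"
        unfolding D_def by (intro borel_measurable_continuous_onI C11_bound_grad_continuous[OF C11] St st)
      have Db: "norm (D z) \<le> L'" for z
        unfolding D_def by (rule mollify_grad_le[OF e(1) u_lc[OF St(1) st(5)]])
      have g: "(\<lambda>(z, r). D z \<bullet> b r z) \<in> borel_measurable (\<mu> s \<Otimes>\<^sub>M borel)" by measurable
      have gb: "\<bar>D z \<bullet> b r z\<bar> \<le> L' * k r" for z r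
      proof -
        have "\<bar>D z \<bullet> b r z\<bar> \<le> norm (D z) * norm (b r z)" by (rule Cauchy_Schwarz_ineq2)
        also have "\<dots> \<le> L' * k r" by (intro mult_mono Db b_bound L'0) auto
        finally show ?thesis .
      qed
      note swap = integral_swap[OF P.finite_measure_axioms g gb, of s t]
      have Dint: "integral {s..t} (\<lambda>r. D z \<bullet> b r z) = D z \<bullet> integral {s..t} (\<lambda>r. b r z)" for z
        using integral_linear[OF b_integrable_on[OF borel_measurable_const] bounded_linear_inner_right, of s t "D z" z]
        by (simp add: o_def)
      \<comment> \<open>\<open>I0\<close> is the flux integrated against the measure frozen at
        \<open>s\<close>, as produced by the Euler step; \<open>I1\<close> below is the true one,
        given by the weak identity.\<close>
      define I0 where "I0 = (\<integral>z. D z \<bullet> integral {s..t} (\<lambda>r. b r z) \<partial>\<mu> s)"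
      have I0: "((\<lambda>r. \<integral>z. D z \<bullet> b r z \<partial>\<mu> s) has_integral I0) {s..t}"
        using integrable_integral[OF swap(1)] swap(3) by (simp add: I0_def Dint)
      define I1 where "I1 = (\<integral>z. mollify (e n) (u t) z \<partial>\<mu> t) - (\<integral>z. mollify (e n) (u t) z \<partial>\<mu> s)"
      have I1: "((\<lambda>r. \<integral>z. D z \<bullet> b r z \<partial>\<mu> r) has_integral I1) {s..t}"
        unfolding I1_def D_def by (rule weak[OF u_lc[OF St(1) st(5)] st])
      have "norm (I1 - I0) \<le> ((6 * A + L') * K s t) * K s t"
      proof (rule has_integral_norm_le_K_AE[OF has_integral_diff[OF I1 I0]], rule fullI[OF st(3,5)])
        fix r assume r: "r \<in> G" "r \<in> {s..t}"
        have "\<bar>(\<integral>z. D z \<bullet> b r z \<partial>\<mu> r) - (\<integral>z. D z \<bullet> b r z \<partial>\<mu> s)\<bar> \<le> ((6 * A + L') * k r) * K s r"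
          unfolding D_def using r st
          by (intro lip[OF lip_compact_inner_b[OF e(1) u_lc[OF St(1) st(5)] C11[OF St(1) st(5)]]]) auto
        also have "\<dots> \<le> ((6 * A + L') * k r) * K s t"
          using r A0 L'0 k_nonneg[of r] by (intro mult_left_mono K_mono) auto
        finally show "norm ((\<integral>z. D z \<bullet> b r z \<partial>\<mu> r) - (\<integral>z. D z \<bullet> b r z \<partial>\<mu> s)) \<le> (6 * A + L') * K s t * k r"
          by (simp add: ac_simps)
      qed
      moreover have "\<bar>F s - ((\<integral>z. mollify (e n) (u t) z \<partial>\<mu> s) + I0)\<bar> \<le> L' * (K s t * (K s t + e n)) + A * (K s t)\<^sup>2"
      proof -
        have i1: "integrable (\<mu> s) (mollify (e n) (u t))"
          by (rule int_lc[OF st(1,1) mollify_lip_compact[OF e(1) u_lc[OF St(1) st(5)]]])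
        have i2: "integrable (\<mu> s) (mollify (e n) (u s))"
          by (rule int_lc[OF st(1,1) mollify_lip_compact[OF e(1) u_lc[OF st(3) St(2)]]])
        have i3: "integrable (\<mu> s) (\<lambda>z. D z \<bullet> integral {s..t} (\<lambda>r. b r z))"
          using swap(2) by (simp add: Dint)
        have "\<bar>F s - (\<integral>z. mollify (e n) (u t) z + D z \<bullet> integral {s..t} (\<lambda>r. b r z) \<partial>\<mu> s)\<bar>
            \<le> L' * (K s t * (K s t + e n)) + A * (K s t)\<^sup>2"
          unfolding F_def
        proof (rule P.integral_diff_le[OF i2])
          show "integrable (\<mu> s) (\<lambda>z. mollify (e n) (u t) z + D z \<bullet> integral {s..t} (\<lambda>r. b r z))"
            using i1 i3 by simp
          fix z
          show "\<bar>mollify (e n) (u s) z - (mollify (e n) (u t) z + D z \<bullet> integral {s..t} (\<lambda>r. b r z))\<bar>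
            \<le> L' * (K s t * (K s t + e n)) + A * (K s t)\<^sup>2"
            using mollify_flow_increment[OF e(1) \<phi> st(4,5), of L' R' n A z] u_lc[OF St(1) st(5)] C11[OF St(1) st(5)]
            by (simp add: u_def[abs_def] D_def algebra_simps)
        qed
        then show ?thesis using i1 i3 by (simp add: I0_def)
      qed
      moreover have "F t = (\<integral>z. mollify (e n) (u t) z \<partial>\<mu> s) + I1" by (simp add: F_def I1_def)
      ultimately have "\<bar>F t - F s\<bar> \<le> ((6 * A + L') * K s t) * K s t + (L' * (K s t * (K s t + e n)) + A * (K s t)\<^sup>2)"
        by simp
      then show ?thesis by (simp add: algebra_simps power2_eq_square)
    qed
    have dense: "\<exists>r\<in>G. x < r \<and> r < y" if "S \<le> x" "x < y" "y \<le> T" for x y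
    proof (rule ccontr)
      assume no: "\<not> (\<exists>r\<in>G. x < r \<and> r < y)"
      have "AE r in lborel. r \<notin> {x<..<y}"
        using full by eventually_elim (use no that in auto)
      then have "emeasure lborel {x<..<y} = 0"
        by (subst (asm) AE_iff_measurable[where N="{x<..<y}"]) auto
      then show False using that by simp
    qed
    have c: "0 \<le> 2 * L' + 7 * A" using L'0 A0 by simp
    have "F T - F S \<le> (L' * e n) * K S T"
      by (rule increment_bound[OF dense ST zero_less_one c]) (use incr in \<open>auto intro: order_trans[OF abs_ge_self]\<close>)
    moreover have "(- F T) - (- F S) \<le> (L' * e n) * K S T"
      by (rule increment_bound[OF dense ST zero_less_one c])
         (use incr in \<open>auto intro: order_trans[OF abs_ge_self] simp: abs_minus_commute\<close>)
    ultimately have FF: "\<bar>F T - F S\<bar> \<le> (L' * e n) * K S T" by linarith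
    have "\<bar>F t - (\<integral>z. u t z \<partial>\<mu> t)\<bar> \<le> L' * e n" if "t \<in> G" "S \<le> t" "t \<le> T" for t
      unfolding F_def using that
      by (intro prob_space.integral_diff_le[OF prob] int_lc[OF _ _ mollify_lip_compact[OF e(1) u_lc]]
          int_lc[OF _ _ u_lc] mollify_close[OF e(1) u_lc])
    from this[OF ST(1) order_refl ST(3)] this[OF ST(2) ST(3) order_refl] FF
    show ?thesis by (simp add: u_def algebra_simps)
  qed
  have "(\<lambda>n. L' * e n * (K S T + 2)) \<longlonglongrightarrow> L' * 0 * (K S T + 2)"
    by (intro tendsto_intros e(2))
  then have "\<bar>(\<integral>z. \<phi> z \<partial>\<mu> T) - (\<integral>z. \<phi> (flow S z T) \<partial>\<mu> S)\<bar> \<le> 0"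
    using main LIMSEQ_le_const by fastforce
  then show ?thesis by simp
qed

end

subsection \<open>The kernel\<close>

lemma emeasure_plane_cball: "0 \<le> r \<Longrightarrow> emeasure lborel (cball (c::plane) r) = ennreal (pi * r\<^sup>2)"
  by (simp add: emeasure_cball unit_ball_vol_2)

text \<open>Polar coordinates for radial functions, obtained by comparing two measures on the line
  on the half lines \<open>{..a}\<close>: both give the disc area \<open>pi * a^2\<close>.\<close>

lemma distr_norm_plane:
  "distr lborel borel (norm :: plane \<Rightarrow> real) = density lborel (\<lambda>r. ennreal (2 * pi * r) * indicator {0..} r)"
  (is "?M = ?N")
proof (rule measure_eqI_generator_eq[where E="range atMost" and \<Omega>=UNIV and A="\<lambda>n. {..real n}"])
  have eqM: "emeasure ?M {..a} = (if 0 \<le> a then ennreal (pi * a\<^sup>2) else 0)" for a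
  proof -
    have "norm -` {..a} \<inter> space lborel = (cball 0 a :: plane set)" by auto
    then have "emeasure ?M {..a} = emeasure lborel (cball (0::plane) a)" by (simp add: emeasure_distr)
    then show ?thesis by (simp add: emeasure_plane_cball)
  qed
  have eqN: "emeasure ?N {..a} = (if 0 \<le> a then ennreal (pi * a\<^sup>2) else 0)" for a
  proof -
    have "emeasure ?N {..a} = (\<integral>\<^sup>+r. ennreal (2 * pi * r) * indicator {0..} r * indicator {..a} r \<partial>lborel)"
      by (simp add: emeasure_density)
    also have "\<dots> = (\<integral>\<^sup>+r. ennreal (2 * pi * r) * indicator {0..a} r \<partial>lborel)"
      by (intro nn_integral_cong) (auto simp: indicator_def)
    also have "\<dots> = (if 0 \<le> a then ennreal (pi * a\<^sup>2) else 0)"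
    proof (cases "0 \<le> a")
      case True
      have "(\<integral>\<^sup>+r. ennreal (2 * pi * r) * indicator {0..a} r \<partial>lborel) = ennreal (pi * a\<^sup>2 - pi * 0\<^sup>2)"
        using True by (intro nn_integral_FTC_Icc) (auto intro!: derivative_eq_intros)
      then show ?thesis using True by simp
    qed simp
    finally show ?thesis .
  qed
  show "Int_stable (range (atMost :: real \<Rightarrow> _))" by (auto simp: Int_stable_def)
  show "sets ?M = sigma_sets UNIV (range atMost)" "sets ?N = sigma_sets UNIV (range atMost)"
    by (simp_all add: borel_eq_atMost)
  show "emeasure ?M X = emeasure ?N X" if "X \<in> range atMost" for X
    using that eqM eqN by auto
  show "(\<Union>n. {..real n}) = UNIV" using real_arch_simple by auto
  show "emeasure ?M {..real n} \<noteq> \<infinity>" for n by (simp add: eqM)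
qed auto

lemma nn_integral_radial:
  assumes [measurable]: "F \<in> borel_measurable borel"
  shows "(\<integral>\<^sup>+x. F (norm (x::plane)) \<partial>lborel) = (\<integral>\<^sup>+r. ennreal (2 * pi * r) * indicator {0..} r * F r \<partial>lborel)"
proof -
  have "(\<integral>\<^sup>+x. F (norm (x::plane)) \<partial>lborel) = (\<integral>\<^sup>+r. F r \<partial>distr lborel borel (norm :: plane \<Rightarrow> real))"
    by (subst nn_integral_distr) auto
  then show ?thesis unfolding distr_norm_plane by (subst (asm) nn_integral_density) auto
qed

lemma nn_integral_lborel_shift:
  fixes F :: "'a::euclidean_space \<Rightarrow> ennreal"
  assumes [measurable]: "F \<in> borel_measurable borel"
  shows "(\<integral>\<^sup>+x. F (x - a) \<partial>lborel) = (\<integral>\<^sup>+x. F x \<partial>lborel)"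
proof -
  have "(\<integral>\<^sup>+x. F x \<partial>distr lborel borel ((+) (- a))) = (\<integral>\<^sup>+x. F (x - a) \<partial>lborel)"
    by (subst nn_integral_distr) auto
  then show ?thesis by (simp add: lborel_distr_plus)
qed

text \<open>The Jacobian \<open>2 * pi * r\<close> cancels the kernel, so only the width of the
  annulus counts. Inner radius 0 is included, which takes care of the singularity.\<close>

lemma nn_integral_annulus:
  assumes "0 \<le> r" "0 \<le> d"
  shows "(\<integral>\<^sup>+x. ennreal (1 / (2 * pi * norm (x - a))) * indicator {r..r + d} (norm (x - a)) \<partial>(lborel :: plane measure)) \<le> ennreal d"
proof -
  have "(\<integral>\<^sup>+x. ennreal (1 / (2 * pi * norm (x - a))) * indicator {r..r + d} (norm (x - a)) \<partial>(lborel :: plane measure))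
    = (\<integral>\<^sup>+x. ennreal (1 / (2 * pi * norm x)) * indicator {r..r + d} (norm x) \<partial>(lborel :: plane measure))"
    by (rule nn_integral_lborel_shift) measurable
  also have "\<dots> = (\<integral>\<^sup>+\<rho>. ennreal (2 * pi * \<rho>) * indicator {0..} \<rho> * (ennreal (1 / (2 * pi * \<rho>)) * indicator {r..r + d} \<rho>) \<partial>lborel)"
    by (rule nn_integral_radial) measurable
  also have "\<dots> \<le> (\<integral>\<^sup>+\<rho>. indicator {r..r + d} \<rho> \<partial>lborel)"
    using assms by (intro nn_integral_mono) (auto simp: indicator_def ennreal_mult[symmetric])
  also have "\<dots> = ennreal d" using assms by simp
  finally show ?thesis .
qed

definition weight :: "real \<Rightarrow> plane \<Rightarrow> real" where
  "weight \<gamma> x = (1 + norm x) powr (- \<gamma>)"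

lemma weight_nonneg: "0 \<le> weight \<gamma> x"
  by (simp add: weight_def)

lemma weight_le_1: "0 \<le> \<gamma> \<Longrightarrow> weight \<gamma> x \<le> 1"
  unfolding weight_def by (simp add: powr_minus inverse_le_1_iff ge_one_powr_ge_zero)

lemma weight_measurable [measurable]: "weight \<gamma> \<in> borel_measurable borel"
  unfolding weight_def[abs_def] by measurable

text \<open>Polar coordinates leave at most a multiple of
  \<open>(1 + r) powr (1 - \<gamma>)\<close>, integrable at infinity for
  \<open>\<gamma> > 2\<close>. The threshold 2 originates here.\<close>

lemma weight_integral_finite:
  assumes \<gamma>: "2 < \<gamma>"
  shows "(\<integral>\<^sup>+x. ennreal (weight \<gamma> x) \<partial>lborel) < \<infinity>"
proof -
  have "(\<integral>\<^sup>+x. ennreal (weight \<gamma> x) \<partial>lborel) =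
      (\<integral>\<^sup>+r. ennreal (2 * pi * r) * indicator {0..} r * ennreal ((1 + r) powr (- \<gamma>)) \<partial>lborel)"
    unfolding weight_def by (rule nn_integral_radial) measurable
  also have "\<dots> \<le> (\<integral>\<^sup>+r. ennreal (2 * pi * (1 + r) powr (1 - \<gamma>)) * indicator {0..} r \<partial>lborel)"
  proof (intro nn_integral_mono)
    fix r :: real
    have "2 * pi * r * (1 + r) powr (- \<gamma>) \<le> 2 * pi * (1 + r) powr (1 - \<gamma>)" if "0 \<le> r"
    proof -
      have "(1 + r) powr (1 - \<gamma>) = (1 + r) * (1 + r) powr (- \<gamma>)"
        using that by (simp add: powr_diff powr_minus divide_inverse)
      then show ?thesis using that by (simp add: mult_right_mono)
    qed
    then show "ennreal (2 * pi * r) * indicator {0..} r * ennreal ((1 + r) powr (- \<gamma>))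
      \<le> ennreal (2 * pi * (1 + r) powr (1 - \<gamma>)) * indicator {0..} r"
      by (auto simp: indicator_def ennreal_mult[symmetric])
  qed
  also have "\<dots> = ennreal (0 - (- (2 * pi / (\<gamma> - 2)) * (1 + 0) powr (2 - \<gamma>)))"
  proof (rule nn_integral_FTC_atLeast)
    fix r :: real assume "0 \<le> r"
    then have "DERIV (\<lambda>r. (1 + r) powr (2 - \<gamma>)) r :> (2 - \<gamma>) * (1 + r) powr (2 - \<gamma> - of_nat 1) * 1"
      by (intro DERIV_fun_powr) (auto intro!: derivative_eq_intros)
    then have "DERIV (\<lambda>r. - (2 * pi / (\<gamma> - 2)) * (1 + r) powr (2 - \<gamma>)) r :>
        - (2 * pi / (\<gamma> - 2)) * ((2 - \<gamma>) * (1 + r) powr (2 - \<gamma> - of_nat 1) * 1)"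
      by (rule DERIV_cmult)
    moreover have "- (2 * pi / (\<gamma> - 2)) * ((2 - \<gamma>) * (1 + r) powr (2 - \<gamma> - of_nat 1) * 1) = 2 * pi * (1 + r) powr (1 - \<gamma>)"
      using \<gamma> by (simp add: field_simps)
    ultimately show "DERIV (\<lambda>r. - (2 * pi / (\<gamma> - 2)) * (1 + r) powr (2 - \<gamma>)) r :> 2 * pi * (1 + r) powr (1 - \<gamma>)"
      by simp
  next
    have "((\<lambda>r. (1 + r) powr (2 - \<gamma>)) \<longlongrightarrow> 0) at_top"
      using \<gamma> by (intro tendsto_neg_powr filterlim_tendsto_add_at_top[OF tendsto_const] filterlim_ident) auto
    then show "((\<lambda>r. - (2 * pi / (\<gamma> - 2)) * (1 + r) powr (2 - \<gamma>)) \<longlongrightarrow> 0) at_top"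
      using tendsto_mult_right_zero by blast
  qed auto
  also have "\<dots> < \<infinity>" by simp
  finally show ?thesis .
qed

section \<open>Pointwise estimates of the kernel\<close>

lemma linear_perp: "linear perp"
  by (intro linearI) (simp_all add: perp_def vec_eq_iff forall_2 vector_2)

lemma perp_measurable [measurable]: "perp \<in> borel_measurable borel"
  by (intro borel_measurable_continuous_onI linear_continuous_on linear_conv_bounded_linear[THEN iffD1] linear_perp)

lemma norm_perp: "norm (perp x) = norm x"
  by (simp add: perp_def norm_vec_def L2_set_def sum_2 vector_2 add.commute)

lemma J_measurable: "(\<lambda>(x, v). J x v) \<in> borel_measurable (borel \<Otimes>\<^sub>M borel)"
  unfolding J_def by measurable

lemma J_measurable_compose [measurable (raw)]:
  assumes "f \<in> borel_measurable M" "g \<in> borel_measurable M"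
  shows "(\<lambda>x. J (f x) (g x)) \<in> borel_measurable M"
  using measurable_compose[OF measurable_Pair[OF assms] J_measurable] by simp

lemma J_minus: "J (- x) (- v) = - J x v"
  using linear_neg[OF linear_perp, of x] by (simp add: J_def)

text \<open>At the origin both sides are 0, by the convention \<open>1 / 0 = 0\<close>.\<close>

lemma norm_J: "norm (J x v) = (if norm v \<le> norm x then 1 / (2 * pi * norm x) else 0)"
  by (simp add: J_def norm_perp power2_eq_square)

lemma norm_J_le: "norm (J x v) \<le> 1 / (2 * pi * norm x)"
  by (simp add: norm_J)

text \<open>The distance formula of the inversion in the unit circle. Up to a rotation and the
  factor \<open>1 / (2 * pi)\<close>, \<open>J\<close> is this inversion cut off by an
  indicator.\<close>

lemma norm_inversion_diff:
  fixes x y :: plane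
  assumes "x \<noteq> 0" "y \<noteq> 0"
  shows "norm ((1 / (norm x)\<^sup>2) *\<^sub>R x - (1 / (norm y)\<^sup>2) *\<^sub>R y) = norm (x - y) / (norm x * norm y)"
proof -
  define a b where "a = norm x" and "b = norm y"
  have pos: "a > 0" "b > 0" using assms by (auto simp: a_def b_def)
  have xx: "x \<bullet> x = a\<^sup>2" "y \<bullet> y = b\<^sup>2" by (auto simp: a_def b_def power2_norm_eq_inner)
  have "(norm ((1 / a\<^sup>2) *\<^sub>R x - (1 / b\<^sup>2) *\<^sub>R y))\<^sup>2 = (norm (x - y) / (a * b))\<^sup>2"
    unfolding power_divide power2_norm_eq_inner
    using pos by (simp add: inner_diff_left inner_diff_right inner_commute xx field_simps)
  then have "norm ((1 / a\<^sup>2) *\<^sub>R x - (1 / b\<^sup>2) *\<^sub>R y) = norm (x - y) / (a * b)"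
    using pos by (subst (asm) power2_eq_iff_nonneg) auto
  then show ?thesis by (simp add: a_def b_def)
qed

text \<open>Where both indicators are active the difference is that of two inversions; otherwise one of
  the two points lies in the thin annulus \<open>\<bar>v\<bar> \<le> \<bar>x\<bar> \<le> \<bar>v\<bar> + 2 d\<close>, which the weight
  \<open>1/\<bar>x\<bar>\<close> integrates to a quantity linear in \<open>d\<close>.\<close>

definition J_bulk :: "plane \<Rightarrow> plane \<Rightarrow> real" where
  "J_bulk x v = (if norm v \<le> norm x then 1 / (norm x)\<^sup>2 else 0)"

definition J_edge :: "real \<Rightarrow> plane \<Rightarrow> plane \<Rightarrow> real" where
  "J_edge d x v = 1 / (2 * pi * norm x) * indicator {norm v..norm v + d} (norm x)"

lemma J_bulk_measurable [measurable (raw)]: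
  assumes "f \<in> borel_measurable M" "g \<in> borel_measurable M"
  shows "(\<lambda>x. J_bulk (f x) (g x)) \<in> borel_measurable M"
  using assms unfolding J_bulk_def by measurable

lemma J_edge_measurable [measurable (raw)]:
  assumes "f \<in> borel_measurable M" "g \<in> borel_measurable M"
  shows "(\<lambda>x. J_edge d (f x) (g x)) \<in> borel_measurable M"
proof -
  have "J_edge d = (\<lambda>x v. 1 / (2 * pi * norm x) * (if norm v \<le> norm x \<and> norm x \<le> norm v + d then 1 else 0))"
    by (auto simp: J_edge_def fun_eq_iff)
  then show ?thesis using assms by simp
qed

lemma J_bulk_nonneg: "0 \<le> J_bulk x v" and J_edge_nonneg: "0 \<le> J_edge d x v"
  by (auto simp: J_bulk_def J_edge_def)

text \<open>By \<open>norm x <= norm x' + d\<close>, \<open>norm x' < norm v'\<close> and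
  \<open>norm v' <= norm v + d\<close>, the active point lies within \<open>2 * d\<close> of the
  jump, and the other kernel value is 0.\<close>

lemma norm_J_diff_le_aux:
  assumes x: "norm (x - x') \<le> d" and v: "norm (v - v') \<le> d" and "norm v \<le> norm x" "\<not> norm v' \<le> norm x'"
  shows "norm (J x v - J x' v') \<le> J_edge (2 * d) x v"
proof -
  have "norm x \<le> norm v + 2 * d"
    using norm_triangle_ineq2[of x x'] norm_triangle_ineq2[of v' v] assms
    by (simp add: norm_minus_commute)
  then show ?thesis using assms by (simp add: norm_J J_def[of x' v'] J_edge_def)
qed

lemma norm_J_diff_le:
  assumes x: "norm (x - x') \<le> d" and v: "norm (v - v') \<le> d"
  shows "norm (J x v - J x' v') \<le> d * (J_bulk x v + J_bulk x' v') + J_edge (2 * d) x v + J_edge (2 * d) x' v'"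
proof -
  have d: "0 \<le> d" using norm_ge_zero x by (rule order_trans)
  have nn: "0 \<le> d * (J_bulk x v + J_bulk x' v')"
    using d J_bulk_nonneg[of x v] J_bulk_nonneg[of x' v'] by simp
  note enn = J_edge_nonneg[of "2 * d" x v] J_edge_nonneg[of "2 * d" x' v']
  consider "norm v \<le> norm x" "norm v' \<le> norm x'" | "norm v \<le> norm x" "\<not> norm v' \<le> norm x'"
    | "\<not> norm v \<le> norm x" "norm v' \<le> norm x'" | "\<not> norm v \<le> norm x" "\<not> norm v' \<le> norm x'"
    by blast
  then show ?thesis
  proof cases
    case 1
    have half: "y / (2 * pi) \<le> y" if "0 \<le> y" for y
      using mult_right_mono[of 1 "2 * pi" y] that pi_gt3 by (simp add: field_simps)
    \<comment> \<open>The inversion formula needs nonzero points. If one of them is the origin, its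
      kernel vanishes and the other has norm at most \<open>d\<close>, where
      \<open>1 / norm y\<close> is at most \<open>d / (norm y)^2\<close>.\<close>
    have single: "norm (J y w) \<le> d * J_bulk y w" if "norm y \<le> d" "norm w \<le> norm y" for y w
    proof (cases "y = 0")
      case False
      have "1 / (2 * pi * norm y) = (norm y * (1 / (norm y)\<^sup>2)) / (2 * pi)"
        using False by (simp add: power2_eq_square)
      also have "\<dots> \<le> norm y * (1 / (norm y)\<^sup>2)" by (rule half) simp
      also have "\<dots> \<le> d * (1 / (norm y)\<^sup>2)" using that by (intro mult_right_mono) auto
      finally show ?thesis using that by (simp add: norm_J J_bulk_def)
    qed (simp add: norm_J J_bulk_def)
    have "norm (J x v - J x' v') \<le> d * (J_bulk x v + J_bulk x' v')"
    proof (cases "x = 0 \<or> x' = 0")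
      case True
      then show ?thesis
      proof
        assume "x = 0"
        then show ?thesis using single[of x' v'] 1 x by (simp add: J_def[of 0] linear_0[OF linear_perp] J_bulk_def[of 0])
      next
        assume "x' = 0"
        then show ?thesis using single[of x v] 1 x by (simp add: J_def[of 0] linear_0[OF linear_perp] J_bulk_def[of 0])
      qed
    next
      case False
      have "J x v - J x' v' = (1 / (2 * pi)) *\<^sub>R perp ((1 / (norm x)\<^sup>2) *\<^sub>R x - (1 / (norm x')\<^sup>2) *\<^sub>R x')"
        using 1 by (simp add: J_def linear_diff[OF linear_perp] linear_scale[OF linear_perp] scaleR_diff_right)
      then have "norm (J x v - J x' v') = (norm (x - x') / (norm x * norm x')) / (2 * pi)"
        using norm_inversion_diff[of x x'] False by (simp add: norm_perp)
      also have "\<dots> \<le> norm (x - x') / (norm x * norm x')" by (rule half) simp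
      also have "\<dots> \<le> d * (1 / (norm x * norm x'))"
        using x by (simp add: divide_right_mono)
      \<comment> \<open>Splits the mixed product into terms depending on one point each, so that the
        weighted integrals can be taken with separate centres.\<close>
      also have "\<dots> \<le> d * (1 / (norm x)\<^sup>2 + 1 / (norm x')\<^sup>2)"
      proof (intro mult_left_mono d)
        have "0 \<le> (1 / norm x - 1 / norm x')\<^sup>2 + (1 / norm x)\<^sup>2 + (1 / norm x')\<^sup>2" by simp
        then show "1 / (norm x * norm x') \<le> 1 / (norm x)\<^sup>2 + 1 / (norm x')\<^sup>2"
          unfolding power2_diff by (simp add: power_divide)
      qed
      finally show ?thesis using 1 by (simp add: J_bulk_def)
    qed
    then show ?thesis using enn by linarith
  next
    case 2
    then show ?thesis using norm_J_diff_le_aux[OF x v] nn enn by linarith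
  next
    case 3
    have "norm (J x v - J x' v') \<le> J_edge (2 * d) x' v'"
      using norm_J_diff_le_aux[of x' x d v' v] 3 x v by (simp add: norm_minus_commute)
    then show ?thesis using nn enn by linarith
  next
    case 4
    then show ?thesis using nn enn by (simp add: J_def)
  qed
qed

text \<open>The estimates below depend on the order of integration: the singular bulk is integrated
  over \<open>v\<close> first, the annuli over \<open>x\<close> first.\<close>

lemma nn_integral_phase:
  fixes F :: "plane \<Rightarrow> plane \<Rightarrow> ennreal"
  assumes [measurable]: "(\<lambda>(x, v). F x v) \<in> borel_measurable (borel \<Otimes>\<^sub>M borel)"
  shows "(\<integral>\<^sup>+(x, v). F x v \<partial>(lborel :: phase measure)) = (\<integral>\<^sup>+x. \<integral>\<^sup>+v. F x v \<partial>lborel \<partial>lborel)"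
    and "(\<integral>\<^sup>+(x, v). F x v \<partial>(lborel :: phase measure)) = (\<integral>\<^sup>+v. \<integral>\<^sup>+x. F x v \<partial>lborel \<partial>lborel)"
proof -
  have [measurable]: "(\<lambda>(x, v). F x v) \<in> borel_measurable (lborel \<Otimes>\<^sub>M lborel)" by simp
  show "(\<integral>\<^sup>+(x, v). F x v \<partial>(lborel :: phase measure)) = (\<integral>\<^sup>+x. \<integral>\<^sup>+v. F x v \<partial>lborel \<partial>lborel)"
    unfolding lborel_prod[symmetric] by (subst lborel.nn_integral_fst[symmetric]) auto
  show "(\<integral>\<^sup>+(x, v). F x v \<partial>(lborel :: phase measure)) = (\<integral>\<^sup>+v. \<integral>\<^sup>+x. F x v \<partial>lborel \<partial>lborel)"
    unfolding lborel_prod[symmetric] by (subst lborel_pair.nn_integral_snd[symmetric]) auto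
qed

lemma nn_integral_phase_swap:
  fixes F :: "plane \<Rightarrow> plane \<Rightarrow> ennreal"
  assumes [measurable]: "(\<lambda>(x, v). F x v) \<in> borel_measurable (borel \<Otimes>\<^sub>M borel)"
  shows "(\<integral>\<^sup>+(x, v). F v x \<partial>(lborel :: phase measure)) = (\<integral>\<^sup>+(x, v). F x v \<partial>(lborel :: phase measure))"
  by (subst nn_integral_phase(1)[of "\<lambda>x v. F v x"]) (auto simp: nn_integral_phase(2)[OF assms])

section \<open>Weighted integrals of the kernel\<close>

context
  fixes \<gamma> :: real
  assumes \<gamma>: "2 < \<gamma>"
begin

definition W :: real where "W = enn2real (\<integral>\<^sup>+x. ennreal (weight \<gamma> x) \<partial>lborel)"

lemma W: "(\<integral>\<^sup>+x. ennreal (weight \<gamma> x) \<partial>lborel) = ennreal W" "0 \<le> W"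
  using weight_integral_finite[OF \<gamma>] by (simp_all add: W_def)

lemma weight_le_1': "weight \<gamma> x \<le> 1"
  using weight_le_1[of \<gamma> x] \<gamma> by simp

text \<open>Within distance 1 of \<open>a\<close> the annulus bound with radius 0 and width 1
  contributes 1; beyond, the kernel is at most 1 and the weight in \<open>x\<close> contributes
  \<open>W\<close>. The weight in \<open>v\<close> gives the outer factor.\<close>

lemma J_weight_bound:
  "(\<integral>\<^sup>+(x, v). ennreal (norm (J (x - a) (v - c)) * (weight \<gamma> x * weight \<gamma> v)) \<partial>(lborel :: phase measure)) \<le> ennreal (W * (1 + W))"
proof -
  let ?N = "\<lambda>x. 1 / (2 * pi * norm (x - a))"
  have "(\<integral>\<^sup>+(x, v). ennreal (norm (J (x - a) (v - c)) * (weight \<gamma> x * weight \<gamma> v)) \<partial>(lborel :: phase measure))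
    = (\<integral>\<^sup>+v. \<integral>\<^sup>+x. ennreal (norm (J (x - a) (v - c)) * (weight \<gamma> x * weight \<gamma> v)) \<partial>lborel \<partial>lborel)"
    by (rule nn_integral_phase(2)) measurable
  also have "\<dots> \<le> (\<integral>\<^sup>+v. \<integral>\<^sup>+x. ennreal (weight \<gamma> v) *
      (ennreal (?N x) * indicator {0..0+1} (norm (x - a)) + ennreal (weight \<gamma> x)) \<partial>lborel \<partial>lborel)"
  proof (intro nn_integral_mono)
    fix v x :: plane
    have "norm (J (x - a) (v - c)) * weight \<gamma> x \<le> ?N x * indicator {0..0+1} (norm (x - a)) + weight \<gamma> x"
    proof (cases "norm (x - a) \<le> 1")
      case True
      have "norm (J (x - a) (v - c)) * weight \<gamma> x \<le> ?N x * 1"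
        by (intro mult_mono norm_J_le weight_le_1' weight_nonneg) auto
      then show ?thesis using True weight_nonneg[of \<gamma> x] by simp
    next
      case False
      have "1 \<le> 2 * pi * norm (x - a)" using False pi_gt3 mult_mono[of 1 "2 * pi" 1 "norm (x - a)"] by simp
      then have "norm (J (x - a) (v - c)) \<le> 1" by (intro order_trans[OF norm_J_le]) (simp add: field_simps)
      then show ?thesis using False mult_right_mono[OF _ weight_nonneg, of "norm (J (x - a) (v - c))" 1 \<gamma> x] by simp
    qed
    from mult_left_mono[OF this weight_nonneg[of \<gamma> v]]
    show "ennreal (norm (J (x - a) (v - c)) * (weight \<gamma> x * weight \<gamma> v)) \<le> ennreal (weight \<gamma> v) *
      (ennreal (?N x) * indicator {0..0+1} (norm (x - a)) + ennreal (weight \<gamma> x))"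
      by (auto simp: ac_simps weight_nonneg ennreal_mult[symmetric] ennreal_plus[symmetric] indicator_def
          simp del: ennreal_plus intro!: ennreal_leI)
  qed
  also have "\<dots> = (\<integral>\<^sup>+v. ennreal (weight \<gamma> v) * ((\<integral>\<^sup>+x. ennreal (?N x) * indicator {0..0+1} (norm (x - a)) \<partial>lborel) + ennreal W) \<partial>lborel)"
    by (simp add: nn_integral_cmult nn_integral_add W)
  also have "\<dots> \<le> (\<integral>\<^sup>+v. ennreal (weight \<gamma> v) * (ennreal 1 + ennreal W) \<partial>lborel)"
    by (intro nn_integral_mono mult_left_mono add_right_mono nn_integral_annulus) auto
  also have "\<dots> = ennreal (W * (1 + W))"
    by (simp add: nn_integral_multc W ennreal_mult ennreal_plus)
  finally show ?thesis .
qed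

text \<open>Near \<open>a\<close> the \<open>v\<close>-integral runs over a disc of area pi |x -
  a|^2, which leaves \<open>pi\<close>, and the \<open>x\<close>-integral over the unit disc turns
  this into \<open>pi^2\<close>. Beyond distance 1 the bulk factor is at most 1 and the weights give
  \<open>W^2\<close>.\<close>

lemma J_bulk_weight_bound:
  "(\<integral>\<^sup>+(x, v). ennreal (J_bulk (x - a) (v - c) * (weight \<gamma> x * weight \<gamma> v)) \<partial>(lborel :: phase measure)) \<le> ennreal (pi\<^sup>2 + W\<^sup>2)"
proof -
  let ?I = "\<lambda>x v. indicator (cball a 1) x * (ennreal (1 / (norm (x - a))\<^sup>2) * indicator (cball c (norm (x - a))) v) :: ennreal"
  have "(\<integral>\<^sup>+(x, v). ennreal (J_bulk (x - a) (v - c) * (weight \<gamma> x * weight \<gamma> v)) \<partial>(lborel :: phase measure))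
    = (\<integral>\<^sup>+x. \<integral>\<^sup>+v. ennreal (J_bulk (x - a) (v - c) * (weight \<gamma> x * weight \<gamma> v)) \<partial>lborel \<partial>lborel)"
    by (rule nn_integral_phase(1)) measurable
  also have "\<dots> \<le> (\<integral>\<^sup>+x. (\<integral>\<^sup>+v. ?I x v + ennreal (weight \<gamma> x) * ennreal (weight \<gamma> v) \<partial>lborel) \<partial>lborel)"
  proof (intro nn_integral_mono)
    fix x v :: plane
    have w: "0 \<le> weight \<gamma> x * weight \<gamma> v" "weight \<gamma> x * weight \<gamma> v \<le> 1"
      by (simp_all add: weight_nonneg weight_le_1' mult_le_one)
    show "ennreal (J_bulk (x - a) (v - c) * (weight \<gamma> x * weight \<gamma> v)) \<le> ?I x v + ennreal (weight \<gamma> x) * ennreal (weight \<gamma> v)"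
    proof (cases "norm (x - a) \<le> 1")
      case True
      have "ennreal (J_bulk (x - a) (v - c) * (weight \<gamma> x * weight \<gamma> v)) \<le> ennreal (J_bulk (x - a) (v - c) * 1)"
        using w by (intro ennreal_leI mult_left_mono J_bulk_nonneg) auto
      also have "\<dots> = ?I x v" using True by (auto simp: J_bulk_def indicator_def dist_norm norm_minus_commute)
      finally show ?thesis by (simp add: add_increasing2)
    next
      case False
      then have "1 \<le> (norm (x - a))\<^sup>2" by (intro one_le_power) auto
      then have "J_bulk (x - a) (v - c) \<le> 1" by (auto simp: J_bulk_def divide_le_eq_1)
      from mult_right_mono[OF this w(1)] show ?thesis
        by (intro add_increasing) (auto simp: ennreal_mult[symmetric] weight_nonneg intro!: ennreal_leI)
    qed
  qed
  also have "\<dots> = (\<integral>\<^sup>+x. indicator (cball a 1) x * (ennreal (1 / (norm (x - a))\<^sup>2) * emeasure lborel (cball c (norm (x - a)))) + ennreal (weight \<gamma> x) * ennreal W \<partial>lborel)"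
  proof (rule nn_integral_cong)
    fix x :: plane
    have [measurable]: "indicator (cball c (norm (x - a))) \<in> borel_measurable (borel :: plane measure)"
      by (intro borel_measurable_indicator borel_closed closed_cball)
    show "(\<integral>\<^sup>+v. ?I x v + ennreal (weight \<gamma> x) * ennreal (weight \<gamma> v) \<partial>lborel) =
      indicator (cball a 1) x * (ennreal (1 / (norm (x - a))\<^sup>2) * emeasure lborel (cball c (norm (x - a)))) + ennreal (weight \<gamma> x) * ennreal W"
      by (subst nn_integral_add) (simp_all add: nn_integral_cmult W)
  qed
  also have "\<dots> \<le> (\<integral>\<^sup>+x. indicator (cball a 1) x * ennreal pi + ennreal (weight \<gamma> x) * ennreal W \<partial>lborel)"
  proof (intro nn_integral_mono add_right_mono mult_left_mono)
    fix x
    show "ennreal (1 / (norm (x - a))\<^sup>2) * emeasure lborel (cball c (norm (x - a))) \<le> ennreal pi"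
      by (cases "x = a") (simp_all add: emeasure_plane_cball ennreal_mult[symmetric])
  qed auto
  also have "\<dots> = ennreal (pi\<^sup>2 + W\<^sup>2)"
  proof -
    have [measurable]: "indicator (cball a 1) \<in> borel_measurable (borel :: plane measure)"
      by (intro borel_measurable_indicator borel_closed closed_cball)
    show ?thesis
      by (subst nn_integral_add)
         (simp_all add: nn_integral_multc W emeasure_plane_cball ennreal_mult ennreal_plus power2_eq_square)
  qed
  finally show ?thesis .
qed

text \<open>For fixed \<open>v\<close> the edge is an annulus in \<open>x\<close> of width
  \<open>d\<close>; its radius depends on \<open>v\<close> but not its integral, so the weight in
  \<open>v\<close> contributes just the factor \<open>W\<close>.\<close>

lemma J_edge_weight_bound:
  assumes "0 \<le> d"
  shows "(\<integral>\<^sup>+(x, v). ennreal (J_edge d (x - a) (v - c) * (weight \<gamma> x * weight \<gamma> v)) \<partial>(lborel :: phase measure)) \<le> ennreal (W * d)"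
proof -
  let ?N = "\<lambda>x. 1 / (2 * pi * norm (x - a))"
  have "(\<integral>\<^sup>+(x, v). ennreal (J_edge d (x - a) (v - c) * (weight \<gamma> x * weight \<gamma> v)) \<partial>(lborel :: phase measure))
    = (\<integral>\<^sup>+v. \<integral>\<^sup>+x. ennreal (J_edge d (x - a) (v - c) * (weight \<gamma> x * weight \<gamma> v)) \<partial>lborel \<partial>lborel)"
    by (rule nn_integral_phase(2)) measurable
  also have "\<dots> \<le> (\<integral>\<^sup>+v. \<integral>\<^sup>+x. ennreal (weight \<gamma> v) *
      (ennreal (?N x) * indicator {norm (v - c)..norm (v - c) + d} (norm (x - a))) \<partial>lborel \<partial>lborel)"
  proof (intro nn_integral_mono)
    fix v x :: plane
    have "J_edge d (x - a) (v - c) * (weight \<gamma> x * weight \<gamma> v) \<le> J_edge d (x - a) (v - c) * (1 * weight \<gamma> v)"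
      by (intro mult_left_mono mult_right_mono J_edge_nonneg weight_le_1' weight_nonneg)
    then show "ennreal (J_edge d (x - a) (v - c) * (weight \<gamma> x * weight \<gamma> v)) \<le> ennreal (weight \<gamma> v) *
      (ennreal (?N x) * indicator {norm (v - c)..norm (v - c) + d} (norm (x - a)))"
      by (auto simp: J_edge_def indicator_def ennreal_mult[symmetric] weight_nonneg ac_simps intro!: ennreal_leI)
  qed
  also have "\<dots> = (\<integral>\<^sup>+v. ennreal (weight \<gamma> v) * (\<integral>\<^sup>+x. ennreal (?N x) * indicator {norm (v - c)..norm (v - c) + d} (norm (x - a)) \<partial>lborel) \<partial>lborel)"
    by (simp add: nn_integral_cmult)
  also have "\<dots> \<le> (\<integral>\<^sup>+v. ennreal (weight \<gamma> v) * ennreal d \<partial>lborel)"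
    using assms by (intro nn_integral_mono mult_left_mono nn_integral_annulus) auto
  also have "\<dots> = ennreal (W * d)" using assms by (simp add: nn_integral_multc W ennreal_mult)
  finally show ?thesis .
qed

lemma J_diff_weight_bound:
  assumes d: "norm (a - a') \<le> d" "norm (c - c') \<le> d"
  shows "(\<integral>\<^sup>+(x, v). ennreal (norm (J (x - a) (v - c) - J (x - a') (v - c')) * (weight \<gamma> x * weight \<gamma> v)) \<partial>(lborel :: phase measure))
    \<le> ennreal ((2 * (pi\<^sup>2 + W\<^sup>2) + 4 * W) * d)"
proof -
  have d0: "0 \<le> d" using norm_ge_zero d(1) by (rule order_trans)
  let ?w = "\<lambda>x v. weight \<gamma> x * weight \<gamma> v"
  have "(\<integral>\<^sup>+(x, v). ennreal (norm (J (x - a) (v - c) - J (x - a') (v - c')) * ?w x v) \<partial>(lborel :: phase measure))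
    \<le> (\<integral>\<^sup>+z. (ennreal d * ((case z of (x, v) \<Rightarrow> ennreal (J_bulk (x - a) (v - c) * ?w x v)) +
              (case z of (x, v) \<Rightarrow> ennreal (J_bulk (x - a') (v - c') * ?w x v))) +
        (case z of (x, v) \<Rightarrow> ennreal (J_edge (2 * d) (x - a) (v - c) * ?w x v))) +
        (case z of (x, v) \<Rightarrow> ennreal (J_edge (2 * d) (x - a') (v - c') * ?w x v)) \<partial>(lborel :: phase measure))"
  proof (intro nn_integral_mono, clarify)
    fix x v :: plane
    have w: "0 \<le> ?w x v" by (simp add: weight_nonneg)
    have "norm (J (x - a) (v - c) - J (x - a') (v - c')) \<le> d * (J_bulk (x - a) (v - c) + J_bulk (x - a') (v - c'))
        + J_edge (2 * d) (x - a) (v - c) + J_edge (2 * d) (x - a') (v - c')"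
      using d by (intro norm_J_diff_le) (auto simp: norm_minus_commute)
    from mult_right_mono[OF this w]
    have "norm (J (x - a) (v - c) - J (x - a') (v - c')) * ?w x v \<le>
       d * (J_bulk (x - a) (v - c) * ?w x v + J_bulk (x - a') (v - c') * ?w x v)
        + J_edge (2 * d) (x - a) (v - c) * ?w x v + J_edge (2 * d) (x - a') (v - c') * ?w x v"
      by (simp only: distrib_left distrib_right mult.assoc)
    from ennreal_leI[OF this]
    show "ennreal (norm (J (x - a) (v - c) - J (x - a') (v - c')) * ?w x v)
      \<le> ennreal d * (ennreal (J_bulk (x - a) (v - c) * ?w x v) + ennreal (J_bulk (x - a') (v - c') * ?w x v)) +
        ennreal (J_edge (2 * d) (x - a) (v - c) * ?w x v) + ennreal (J_edge (2 * d) (x - a') (v - c') * ?w x v)"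
      using d0 w by (simp add: ennreal_mult J_bulk_nonneg J_edge_nonneg)
  qed
  also have "\<dots> = (ennreal d * ((\<integral>\<^sup>+(x, v). ennreal (J_bulk (x - a) (v - c) * ?w x v) \<partial>(lborel :: phase measure)) +
              (\<integral>\<^sup>+(x, v). ennreal (J_bulk (x - a') (v - c') * ?w x v) \<partial>(lborel :: phase measure))) +
        (\<integral>\<^sup>+(x, v). ennreal (J_edge (2 * d) (x - a) (v - c) * ?w x v) \<partial>(lborel :: phase measure))) +
        (\<integral>\<^sup>+(x, v). ennreal (J_edge (2 * d) (x - a') (v - c') * ?w x v) \<partial>(lborel :: phase measure))"
  proof -
    have [measurable]: "(\<lambda>(x, v). ennreal (J_bulk (x - p) (v - q) * ?w x v)) \<in> borel_measurable (lborel :: phase measure)"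
      "(\<lambda>(x, v). ennreal (J_edge (2 * d) (x - p) (v - q) * ?w x v)) \<in> borel_measurable (lborel :: phase measure)" for p q
      unfolding lborel_prod[symmetric] by measurable
    show ?thesis by (simp add: nn_integral_add nn_integral_cmult)
  qed
  also have "\<dots> \<le> (ennreal d * (ennreal (pi\<^sup>2 + W\<^sup>2) + ennreal (pi\<^sup>2 + W\<^sup>2)) + ennreal (W * (2 * d))) + ennreal (W * (2 * d))"
    using d0 by (intro add_mono mult_left_mono J_bulk_weight_bound J_edge_weight_bound) auto
  also have "\<dots> = ennreal ((2 * (pi\<^sup>2 + W\<^sup>2) + 4 * W) * d)"
    using d0 W(2) by (simp add: ennreal_plus[symmetric] ennreal_mult[symmetric] algebra_simps del: ennreal_plus)
  finally show ?thesis .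
qed

end

text \<open>Joining both fields into one convolution with values in phase space, the arguments being
  exchanged in the second component, allows a single estimate for the two.\<close>

definition pair_kernel :: "phase \<Rightarrow> phase" where
  "pair_kernel z = (J (fst z) (snd z), J (snd z) (fst z))"

definition phase_weight :: "real \<Rightarrow> phase \<Rightarrow> real" where
  "phase_weight \<gamma> z = weight \<gamma> (fst z) * weight \<gamma> (snd z)"

definition velocity :: "(phase \<Rightarrow> real) \<Rightarrow> phase \<Rightarrow> phase" where
  "velocity h z = (V_field h z, A_field h z)"

text \<open>This is the constant of the final estimate. The first summand bounds the field, the
  second its Lipschitz constant; adding them lets one rate play both roles. The leading factors 2
  count the two components.\<close>

definition kernel_const :: "real \<Rightarrow> real" where
  "kernel_const \<gamma> = 2 * (W \<gamma> * (1 + W \<gamma>)) + 2 * (2 * (pi\<^sup>2 + (W \<gamma>)\<^sup>2) + 4 * W \<gamma>)"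

lemma fst_snd_phase_measurable [measurable]:
  "fst \<in> borel_measurable (borel :: phase measure)" "snd \<in> borel_measurable (borel :: phase measure)"
  by (intro borel_measurable_continuous_onI continuous_intros)+

lemma pair_kernel_measurable [measurable]: "pair_kernel \<in> borel_measurable borel"
  unfolding pair_kernel_def[abs_def] by measurable

lemma phase_weight_measurable [measurable]: "phase_weight \<gamma> \<in> borel_measurable borel"
  unfolding phase_weight_def[abs_def] by measurable

lemma pair_kernel_minus: "pair_kernel (- z) = - pair_kernel z"
  by (simp add: pair_kernel_def J_minus)

text \<open>The weighted bounds have the integration variable first, the convolutions have it
  second; oddness of the kernel reconciles them.\<close>

lemma pair_kernel_commute: "pair_kernel (z - a) = - pair_kernel (a - z)"
  using pair_kernel_minus[of "a - z"] by simp

lemma phase_weight_pos: "0 < phase_weight \<gamma> z"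
proof -
  have "1 + norm (fst z) \<noteq> 0" "1 + norm (snd z) \<noteq> 0"
    using norm_ge_zero[of "fst z"] norm_ge_zero[of "snd z"] by linarith+
  then show ?thesis by (simp add: phase_weight_def weight_def)
qed

lemma kernel_const_nonneg: "0 \<le> kernel_const \<gamma>" if "2 < \<gamma>"
  using W(2)[OF that] by (simp add: kernel_const_def)

text \<open>The second component sees the two planes exchanged. The product weight is symmetric, so
  exchanging the integration variables reduces it to the same form as the first.\<close>

lemma nn_integral_pair_le:
  fixes P Q :: "plane \<Rightarrow> plane \<Rightarrow> plane"
  assumes P: "(\<lambda>(x, v). P x v) \<in> borel_measurable (borel \<Otimes>\<^sub>M borel)"
    and Q: "(\<lambda>(x, v). Q x v) \<in> borel_measurable (borel \<Otimes>\<^sub>M borel)"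
    and P_le: "(\<integral>\<^sup>+(x, v). ennreal (norm (P x v) * (weight \<gamma> x * weight \<gamma> v)) \<partial>(lborel :: phase measure)) \<le> ennreal B"
    and Q_le: "(\<integral>\<^sup>+(x, v). ennreal (norm (Q x v) * (weight \<gamma> x * weight \<gamma> v)) \<partial>(lborel :: phase measure)) \<le> ennreal B"
    and B: "0 \<le> B"
  shows "(\<integral>\<^sup>+z. ennreal (norm (P (fst z) (snd z), Q (snd z) (fst z)) * phase_weight \<gamma> z) \<partial>lborel) \<le> ennreal (2 * B)"
proof -
  let ?F = "\<lambda>R x v. ennreal (norm (R x v :: plane) * (weight \<gamma> x * weight \<gamma> v))"
  have F_measurable: "(\<lambda>(x, v). ?F R x v) \<in> borel_measurable (borel \<Otimes>\<^sub>M borel)"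
      "(\<lambda>(x, v). ?F R v x) \<in> borel_measurable (borel \<Otimes>\<^sub>M borel)"
    if R: "(\<lambda>(x, v). R x v) \<in> borel_measurable (borel \<Otimes>\<^sub>M borel)" for R
  proof -
    have [measurable]: "(\<lambda>p. R (fst p) (snd p)) \<in> borel_measurable (borel \<Otimes>\<^sub>M borel)"
      using R by (simp add: case_prod_beta')
    have [measurable]: "(\<lambda>p. R (snd p) (fst p)) \<in> borel_measurable (borel \<Otimes>\<^sub>M borel)"
      using measurable_compose[OF measurable_Pair[OF measurable_snd measurable_fst] R] by simp
    show "(\<lambda>(x, v). ?F R x v) \<in> borel_measurable (borel \<Otimes>\<^sub>M borel)"
      "(\<lambda>(x, v). ?F R v x) \<in> borel_measurable (borel \<Otimes>\<^sub>M borel)"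
      unfolding case_prod_beta' by measurable
  qed
  have "(\<integral>\<^sup>+z. ennreal (norm (P (fst z) (snd z), Q (snd z) (fst z)) * phase_weight \<gamma> z) \<partial>lborel)
    \<le> (\<integral>\<^sup>+z. (case z of (x, v) \<Rightarrow> ?F P x v) + (case z of (x, v) \<Rightarrow> ?F Q v x) \<partial>lborel)"
  proof (intro nn_integral_mono, clarify)
    fix x v :: plane
    have "norm (P x v, Q v x) \<le> norm (P x v) + norm (Q v x)" by (rule norm_Pair_le)
    from mult_right_mono[OF this, of "weight \<gamma> x * weight \<gamma> v"]
    show "ennreal (norm (P (fst (x, v)) (snd (x, v)), Q (snd (x, v)) (fst (x, v))) * phase_weight \<gamma> (x, v)) \<le> ?F P x v + ?F Q v x"
      by (simp add: phase_weight_def weight_nonneg ennreal_plus[symmetric] algebra_simps del: ennreal_plus)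
  qed
  also have "\<dots> = (\<integral>\<^sup>+(x, v). ?F P x v \<partial>lborel) + (\<integral>\<^sup>+(x, v). ?F Q v x \<partial>lborel)"
    by (rule nn_integral_add) (simp_all only: measurable_lborel1 measurable_lborel2
        F_measurable(1)[OF P, unfolded borel_prod] F_measurable(2)[OF Q, unfolded borel_prod])
  also have "(\<integral>\<^sup>+(x, v). ?F Q v x \<partial>lborel) = (\<integral>\<^sup>+(x, v). ?F Q x v \<partial>lborel)"
    by (rule nn_integral_phase_swap[OF F_measurable(1)[OF Q]])
  also have "(\<integral>\<^sup>+(x, v). ?F P x v \<partial>lborel) + (\<integral>\<^sup>+(x, v). ?F Q x v \<partial>lborel) \<le> ennreal B + ennreal B"
    by (intro add_mono P_le Q_le)
  also have "\<dots> = ennreal (2 * B)" using B by (simp add: ennreal_plus[symmetric] del: ennreal_plus)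
  finally show ?thesis .
qed

lemma pair_kernel_weight_bound:
  assumes \<gamma>: "2 < \<gamma>"
  shows "(\<integral>\<^sup>+z. ennreal (norm (pair_kernel (z - a)) * phase_weight \<gamma> z) \<partial>lborel) \<le> ennreal (kernel_const \<gamma>)"
proof -
  have "(\<integral>\<^sup>+z. ennreal (norm (pair_kernel (z - a)) * phase_weight \<gamma> z) \<partial>lborel) \<le> ennreal (2 * (W \<gamma> * (1 + W \<gamma>)))"
    unfolding pair_kernel_def fst_diff snd_diff
    by (rule nn_integral_pair_le[OF _ _ J_weight_bound[OF \<gamma>] J_weight_bound[OF \<gamma>]])
       (use W(2)[OF \<gamma>] in \<open>measurable, simp\<close>)
  also have "\<dots> \<le> ennreal (kernel_const \<gamma>)"
    using W(2)[OF \<gamma>] by (intro ennreal_leI) (simp add: kernel_const_def)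
  finally show ?thesis .
qed

lemma pair_kernel_diff_weight_bound:
  assumes \<gamma>: "2 < \<gamma>"
  shows "(\<integral>\<^sup>+z. ennreal (norm (pair_kernel (z - a) - pair_kernel (z - a')) * phase_weight \<gamma> z) \<partial>lborel)
    \<le> ennreal (kernel_const \<gamma> * norm (a - a'))"
proof -
  have nf: "norm (fst a - fst a') \<le> norm (a - a')" "norm (snd a - snd a') \<le> norm (a - a')"
    by (metis fst_diff norm_fst_le prod.collapse, metis snd_diff norm_snd_le prod.collapse)
  have "(\<integral>\<^sup>+z. ennreal (norm (pair_kernel (z - a) - pair_kernel (z - a')) * phase_weight \<gamma> z) \<partial>lborel)
    \<le> ennreal (2 * ((2 * (pi\<^sup>2 + (W \<gamma>)\<^sup>2) + 4 * W \<gamma>) * norm (a - a')))"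
    unfolding pair_kernel_def fst_diff snd_diff diff_Pair
    by (rule nn_integral_pair_le[OF _ _ J_diff_weight_bound[OF \<gamma> nf] J_diff_weight_bound[OF \<gamma> nf(2,1)]])
       (use W(2)[OF \<gamma>] in \<open>measurable, simp\<close>)
  also have "\<dots> \<le> ennreal (kernel_const \<gamma> * norm (a - a'))"
    unfolding mult.assoc[symmetric] using W(2)[OF \<gamma>]
    by (intro ennreal_leI mult_right_mono) (auto simp: kernel_const_def)
  finally show ?thesis .
qed

section \<open>Fields of densities dominated by the weight\<close>

definition weight_dominated :: "real \<Rightarrow> real \<Rightarrow> (phase \<Rightarrow> real) \<Rightarrow> bool" where
  "weight_dominated \<gamma> m h \<longleftrightarrow> 0 \<le> m \<and> h \<in> borel_measurable borel \<and> (AE z in lborel. \<bar>h z\<bar> \<le> m * phase_weight \<gamma> z)"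

lemma weight_dominated_weighted_norm:
  assumes [measurable]: "h \<in> borel_measurable borel" and fin: "weighted_norm \<gamma> h < \<infinity>"
  shows "weight_dominated \<gamma> (enn2real (weighted_norm \<gamma> h)) h"
  unfolding weight_dominated_def
proof (intro conjI)
  have "AE z in lborel. (\<lambda>(x, v). ennreal ((1 + norm x) powr \<gamma> * (1 + norm v) powr \<gamma> * \<bar>h (x, v)\<bar>)) z \<le> weighted_norm \<gamma> h"
    unfolding weighted_norm_def by (rule esssup_AE)
  then show "AE z in lborel. \<bar>h z\<bar> \<le> enn2real (weighted_norm \<gamma> h) * phase_weight \<gamma> z"
  proof eventually_elim
    case (elim z)
    define q where "q = (1 + norm (fst z)) powr \<gamma> * (1 + norm (snd z)) powr \<gamma>"
    have "1 + norm (fst z) \<noteq> 0" "1 + norm (snd z) \<noteq> 0"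
      using norm_ge_zero[of "fst z"] norm_ge_zero[of "snd z"] by linarith+
    then have q: "q > 0" by (simp add: q_def)
    have w: "phase_weight \<gamma> z = 1 / q" by (simp add: phase_weight_def weight_def q_def powr_minus field_simps)
    have "ennreal (q * \<bar>h z\<bar>) \<le> ennreal (enn2real (weighted_norm \<gamma> h))"
      using elim fin by (simp add: q_def case_prod_beta)
    then have "q * \<bar>h z\<bar> \<le> enn2real (weighted_norm \<gamma> h)" by (simp add: ennreal_le_iff)
    then show ?case using q by (simp add: w field_simps)
  qed
qed auto

lemma dominated_nn_integral_le:
  assumes h: "weight_dominated \<gamma> m h" and [measurable]: "F \<in> borel_measurable borel"
    and F: "\<And>z. 0 \<le> F z" and le: "(\<integral>\<^sup>+z. ennreal (F z * phase_weight \<gamma> z) \<partial>lborel) \<le> ennreal B"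
  shows "(\<integral>\<^sup>+z. ennreal (\<bar>h z\<bar> * F z) \<partial>lborel) \<le> ennreal (m * B)"
proof -
  have m: "0 \<le> m" and AE: "AE z in lborel. \<bar>h z\<bar> \<le> m * phase_weight \<gamma> z"
    using h by (auto simp: weight_dominated_def)
  have "(\<integral>\<^sup>+z. ennreal (\<bar>h z\<bar> * F z) \<partial>lborel) \<le> (\<integral>\<^sup>+z. ennreal m * ennreal (F z * phase_weight \<gamma> z) \<partial>lborel)"
  proof (rule nn_integral_mono_AE)
    show "AE z in lborel. ennreal (\<bar>h z\<bar> * F z) \<le> ennreal m * ennreal (F z * phase_weight \<gamma> z)"
      using AE
    proof eventually_elim
      case (elim z)
      then show ?case using mult_right_mono[OF elim F[of z]] m F[of z] phase_weight_pos[of \<gamma> z]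
        by (simp add: ennreal_mult[symmetric] ac_simps)
    qed
  qed
  also have "\<dots> \<le> ennreal m * ennreal B"
    using le by (simp add: nn_integral_cmult mult_left_mono)
  also have "\<dots> = ennreal (m * B)" using m by (metis ennreal_mult' mult.commute ennreal_mult'')
  finally show ?thesis .
qed

lemma dominated_integral_le:
  fixes G :: "phase \<Rightarrow> 'b::euclidean_space"
  assumes h: "weight_dominated \<gamma> m h" and [measurable]: "G \<in> borel_measurable borel"
    and le: "(\<integral>\<^sup>+z. ennreal (norm (G z) * phase_weight \<gamma> z) \<partial>lborel) \<le> ennreal B" and B: "0 \<le> B"
  shows "integrable lborel (\<lambda>z. h z *\<^sub>R G z)" "norm (\<integral>z. h z *\<^sub>R G z \<partial>lborel) \<le> m * B"
proof -
  have [measurable]: "h \<in> borel_measurable borel" and m: "0 \<le> m" using h by (auto simp: weight_dominated_def)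
  have fin: "(\<integral>\<^sup>+z. ennreal (norm (h z *\<^sub>R G z)) \<partial>lborel) \<le> ennreal (m * B)"
    using dominated_nn_integral_le[OF h _ _ le] by simp
  then show int: "integrable lborel (\<lambda>z. h z *\<^sub>R G z)"
    by (intro integrableI_bounded) (auto intro: le_less_trans)
  have "ennreal (norm (\<integral>z. h z *\<^sub>R G z \<partial>lborel)) \<le> ennreal (m * B)"
    using integral_norm_bound_ennreal[OF int] fin by simp
  then show "norm (\<integral>z. h z *\<^sub>R G z \<partial>lborel) \<le> m * B" using m B by (simp add: ennreal_le_iff)
qed

lemma velocity_eq:
  assumes \<gamma>: "2 < \<gamma>" and h: "weight_dominated \<gamma> m h"
  shows "integrable lborel (\<lambda>\<zeta>. h \<zeta> *\<^sub>R pair_kernel (z - \<zeta>))"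
    "velocity h z = (\<integral>\<zeta>. h \<zeta> *\<^sub>R pair_kernel (z - \<zeta>) \<partial>lborel)"
proof -
  have le: "(\<integral>\<^sup>+\<zeta>. ennreal (norm (pair_kernel (z - \<zeta>)) * phase_weight \<gamma> \<zeta>) \<partial>lborel) \<le> ennreal (kernel_const \<gamma>)"
    using pair_kernel_weight_bound[OF \<gamma>, of z] by (simp add: pair_kernel_commute[of z])
  show int: "integrable lborel (\<lambda>\<zeta>. h \<zeta> *\<^sub>R pair_kernel (z - \<zeta>))"
    by (rule dominated_integral_le[OF h _ le kernel_const_nonneg[OF \<gamma>]]) measurable
  obtain x v where z: "z = (x, v)" by (meson surj_pair)
  have "fst (\<integral>\<zeta>. h \<zeta> *\<^sub>R pair_kernel (z - \<zeta>) \<partial>lborel) = V_field h z"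
    unfolding integral_bounded_linear[OF bounded_linear_fst int, symmetric]
    by (simp add: V_field_def z pair_kernel_def case_prod_beta')
  moreover have "snd (\<integral>\<zeta>. h \<zeta> *\<^sub>R pair_kernel (z - \<zeta>) \<partial>lborel) = A_field h z"
    unfolding integral_bounded_linear[OF bounded_linear_snd int, symmetric]
    by (simp add: A_field_def z pair_kernel_def case_prod_beta')
  ultimately show "velocity h z = (\<integral>\<zeta>. h \<zeta> *\<^sub>R pair_kernel (z - \<zeta>) \<partial>lborel)"
    by (simp add: velocity_def prod_eq_iff)
qed

lemma velocity_bound:
  assumes \<gamma>: "2 < \<gamma>" and h: "weight_dominated \<gamma> m h"
  shows "norm (velocity h z) \<le> m * kernel_const \<gamma>"
proof -
  have le: "(\<integral>\<^sup>+\<zeta>. ennreal (norm (pair_kernel (z - \<zeta>)) * phase_weight \<gamma> \<zeta>) \<partial>lborel) \<le> ennreal (kernel_const \<gamma>)"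
    using pair_kernel_weight_bound[OF \<gamma>, of z] by (simp add: pair_kernel_commute[of z])
  show ?thesis unfolding velocity_eq(2)[OF \<gamma> h]
    by (rule dominated_integral_le[OF h _ le kernel_const_nonneg[OF \<gamma>]]) measurable
qed

lemma velocity_lipschitz:
  assumes \<gamma>: "2 < \<gamma>" and h: "weight_dominated \<gamma> m h"
  shows "norm (velocity h z - velocity h z') \<le> m * kernel_const \<gamma> * norm (z - z')"
proof -
  have le: "(\<integral>\<^sup>+\<zeta>. ennreal (norm (pair_kernel (z - \<zeta>) - pair_kernel (z' - \<zeta>)) * phase_weight \<gamma> \<zeta>) \<partial>lborel)
    \<le> ennreal (kernel_const \<gamma> * norm (z - z'))"
    using pair_kernel_diff_weight_bound[OF \<gamma>, of z z']
    by (simp add: pair_kernel_commute[of z] pair_kernel_commute[of z'] norm_minus_commute)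
  have "velocity h z - velocity h z' = (\<integral>\<zeta>. h \<zeta> *\<^sub>R (pair_kernel (z - \<zeta>) - pair_kernel (z' - \<zeta>)) \<partial>lborel)"
    unfolding velocity_eq(2)[OF \<gamma> h] scaleR_diff_right
    by (rule Bochner_Integration.integral_diff[symmetric]) (rule velocity_eq(1)[OF \<gamma> h])+
  also have "norm \<dots> \<le> m * (kernel_const \<gamma> * norm (z - z'))"
    using kernel_const_nonneg[OF \<gamma>] by (intro dominated_integral_le[OF h _ le]) auto
  finally show ?thesis by (simp add: mult.assoc)
qed

text \<open>Written as an expectation under the measure, the field can be pulled back to a coupling
  and compared there with a second field under one probability.\<close>

lemma velocity_density:
  assumes \<gamma>: "2 < \<gamma>" and h: "weight_dominated \<gamma> m h" and pos: "AE z in lborel. 0 \<le> h z"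
  shows "integrable (measure_of_density h) (\<lambda>\<zeta>. pair_kernel (z - \<zeta>))"
    "velocity h z = (\<integral>\<zeta>. pair_kernel (z - \<zeta>) \<partial>measure_of_density h)"
proof -
  have [measurable]: "h \<in> borel_measurable borel" using h by (auto simp: weight_dominated_def)
  show "integrable (measure_of_density h) (\<lambda>\<zeta>. pair_kernel (z - \<zeta>))"
    unfolding measure_of_density_def using velocity_eq(1)[OF \<gamma> h] pos by (subst integrable_density) auto
  show "velocity h z = (\<integral>\<zeta>. pair_kernel (z - \<zeta>) \<partial>measure_of_density h)"
    unfolding measure_of_density_def velocity_eq(2)[OF \<gamma> h] using pos by (subst integral_density) auto
qed

lemma velocity_measurable:
  fixes f :: "real \<Rightarrow> phase \<Rightarrow> real"
  assumes f: "(\<lambda>(t, z). f t z) \<in> borel_measurable (borel \<Otimes>\<^sub>M borel)"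
  shows "(\<lambda>(t, z). velocity (f t) z) \<in> borel_measurable borel"
proof -
  have [measurable]: "(\<lambda>x. f (a x) (c x)) \<in> borel_measurable M"
    if "a \<in> borel_measurable M" "c \<in> borel_measurable M" for a c and M :: "'x measure"
    using measurable_compose[OF measurable_Pair[OF that] f] by simp
  show ?thesis
    unfolding velocity_def V_field_def A_field_def borel_prod[symmetric] case_prod_beta' by measurable
qed

text \<open>A sublevel set of the essential supremum consists of the times at which the excess set
  is null, that is, at which an integral vanishes; Tonelli makes this integral measurable in
  time.\<close>

lemma esssup_measurable:
  fixes F :: "real \<Rightarrow> 'a::euclidean_space \<Rightarrow> ennreal"
  assumes [measurable]: "(\<lambda>(t, z). F t z) \<in> borel_measurable (borel \<Otimes>\<^sub>M borel)"
  shows "(\<lambda>t. esssup lborel (F t)) \<in> borel_measurable borel"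
proof (rule borel_measurableI_le)
  fix a :: ennreal
  have [measurable]: "F t \<in> borel_measurable borel" for t
    using measurable_Pair2[OF assms, of t] by simp
  have "esssup lborel (F t) \<le> a \<longleftrightarrow> (\<integral>\<^sup>+z. (if a < F t z then 1 else 0) \<partial>lborel) = (0::ennreal)" for t
  proof -
    have "esssup lborel (F t) \<le> a \<longleftrightarrow> (AE z in lborel. F t z \<le> a)"
    proof
      assume le: "esssup lborel (F t) \<le> a"
      show "AE z in lborel. F t z \<le> a"
        using esssup_AE[of "F t" lborel] by eventually_elim (use le in auto)
    qed (intro esssup_I, auto)
    also have "\<dots> \<longleftrightarrow> (\<integral>\<^sup>+z. (if a < F t z then 1 else 0) \<partial>lborel) = (0::ennreal)"
      by (subst nn_integral_0_iff_AE) (auto intro!: AE_cong simp: not_less)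
    finally show ?thesis .
  qed
  then have "{t \<in> space borel. esssup lborel (F t) \<le> a} =
      {t \<in> space borel. (\<integral>\<^sup>+z. (if a < F t z then 1 else 0) \<partial>lborel) = (0::ennreal)}" by simp
  also have "\<dots> \<in> sets borel" by measurable
  finally show "{t \<in> space borel. esssup lborel (F t) \<le> a} \<in> sets borel" .
qed

lemma weighted_norm_measurable:
  fixes f :: "real \<Rightarrow> phase \<Rightarrow> real"
  assumes [measurable]: "(\<lambda>(t, z). f t z) \<in> borel_measurable (borel \<Otimes>\<^sub>M borel)"
  shows "(\<lambda>t. weighted_norm \<gamma> (f t)) \<in> borel_measurable borel"
proof -
  have [measurable]: "(\<lambda>x. f (fst x) (snd x)) \<in> borel_measurable (borel \<Otimes>\<^sub>M borel)"
    using assms by (simp add: case_prod_beta')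
  show ?thesis unfolding weighted_norm_def case_prod_beta'
    by (rule esssup_measurable) (simp add: case_prod_beta')
qed

subsection \<open>A countable uniformly dense family of test functions\<close>

text \<open>The maximum of 0 and finitely many cones of slope \<open>L\<close> with tips
  \<open>(q, r)\<close>: a McShane lower envelope of finitely many prescribed values. Data from
  countable sets give a countable family.\<close>

definition hat :: "real \<Rightarrow> ('a::euclidean_space \<times> real) list \<Rightarrow> 'a \<Rightarrow> real" where
  "hat L l z = foldr (\<lambda>(q, r) acc. max acc (r - L * norm (z - q))) l 0"

lemma hat_Nil [simp]: "hat L [] z = 0"
  and hat_Cons [simp]: "hat L ((q, r) # l) z = max (hat L l z) (r - L * norm (z - q))"
  by (simp_all add: hat_def)

lemma hat_nonneg: "0 \<le> hat L l z"
  by (induction l) (auto simp: le_max_iff_disj)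

lemma hat_ge: "(q, r) \<in> set l \<Longrightarrow> r - L * norm (z - q) \<le> hat L l z"
  by (induction l) (auto simp: le_max_iff_disj)

lemma hat_le:
  assumes "0 \<le> c" "\<And>q r. (q, r) \<in> set l \<Longrightarrow> r - L * norm (z - q) \<le> c"
  shows "hat L l z \<le> c"
  using assms by (induction l) auto

lemma hat_lipschitz:
  assumes "0 \<le> L"
  shows "\<bar>hat L l x - hat L l y\<bar> \<le> L * norm (x - y)"
proof (induction l)
  case (Cons p l)
  obtain q r where p: "p = (q, r)" by (meson surj_pair)
  have "\<bar>norm (y - q) - norm (x - q)\<bar> \<le> norm (x - y)"
    using norm_triangle_ineq3[of "y - q" "x - q"] by (simp add: norm_minus_commute)
  then have "L * \<bar>norm (y - q) - norm (x - q)\<bar> \<le> L * norm (x - y)" using assms by (intro mult_left_mono)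
  then have "\<bar>(r - L * norm (x - q)) - (r - L * norm (y - q))\<bar> \<le> L * norm (x - y)"
    using assms by (simp add: right_diff_distrib[symmetric] abs_mult)
  then show ?case using Cons.IH unfolding p hat_Cons by linarith
qed (use assms in simp)

lemma hat_lip_compact:
  assumes L: "0 < L"
  shows "\<exists>R. lip_compact L R (hat L l)"
proof -
  have "bdd_above ((\<lambda>p. norm (fst p) + \<bar>snd p\<bar> / L) ` set l)" by simp
  then obtain R' where R': "\<And>p. p \<in> set l \<Longrightarrow> norm (fst p) + \<bar>snd p\<bar> / L \<le> R'"
    unfolding bdd_above_def by blast
  define R where "R = max 0 R'"
  have R: "norm q + \<bar>r\<bar> / L \<le> R" if "(q, r) \<in> set l" for q r
    using R'[OF that] by (simp add: R_def)
  have R0: "0 \<le> R" by (simp add: R_def)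
  have "hat L l z = 0" if z: "R < norm z" for z
  proof (rule antisym[OF hat_le hat_nonneg])
    fix q r assume "(q, r) \<in> set l"
    then have "norm q + \<bar>r\<bar> / L < norm z" using R z by fastforce
    then have "\<bar>r\<bar> / L \<le> norm (z - q)" using norm_triangle_ineq2[of z q] by linarith
    then have "\<bar>r\<bar> \<le> L * norm (z - q)" using L by (simp add: field_simps)
    then show "r - L * norm (z - q) \<le> 0" by linarith
  qed simp
  then have "lip_compact L R (hat L l)"
    using L R0 hat_lipschitz[of L l] by (auto simp: lip_compact_def)
  then show ?thesis ..
qed

text \<open>Heights are chosen below \<open>\<xi> q\<close>, so by the Lipschitz bound no cone
  exceeds \<open>\<xi>\<close>. On the ball, a cone centred within \<open>\<eta> / (4 * L)\<close>
  loses at most \<open>\<eta> / 4\<close> by its height, by its slope and by the variation of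
  \<open>\<xi>\<close>; outside, \<open>\<xi>\<close> is 0 and hats are nonnegative.\<close>

lemma hat_dense:
  fixes \<xi> :: "'a::euclidean_space \<Rightarrow> real"
  assumes \<xi>: "lip_compact l R \<xi>" and pos: "\<And>z. 0 \<le> \<xi> z" and lL: "l \<le> L" and L: "0 < L" and \<eta>: "0 < \<eta>"
    and Q: "\<And>X. open X \<Longrightarrow> X \<noteq> {} \<Longrightarrow> \<exists>q\<in>Q. q \<in> X"
  shows "\<exists>ps\<in>lists (Q \<times> \<rat>). \<forall>z. \<bar>\<xi> z - hat L ps z\<bar> \<le> \<eta>"
proof -
  define \<epsilon> where "\<epsilon> = \<eta> / (4 * L)"
  have \<epsilon>: "\<epsilon> > 0" using L \<eta> by (simp add: \<epsilon>_def)
  have "cball 0 R \<subseteq> (\<Union>q\<in>Q. ball q \<epsilon>)"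
  proof
    fix z :: 'a
    obtain q where "q \<in> Q" "q \<in> ball z \<epsilon>" using Q[of "ball z \<epsilon>"] \<epsilon> by auto
    then show "z \<in> (\<Union>q\<in>Q. ball q \<epsilon>)" by (auto simp: dist_commute)
  qed
  then obtain C where C: "C \<subseteq> Q" "finite C" "cball 0 R \<subseteq> (\<Union>q\<in>C. ball q \<epsilon>)"
    using compactE_image[of "cball (0::'a) R" Q "\<lambda>q. ball q \<epsilon>"] by auto
  obtain qs where qs: "set qs = C" using finite_list[OF C(2)] by auto
  have "\<exists>r\<in>\<rat>. \<xi> q - \<eta> / 4 < r \<and> r < \<xi> q" for q
    using Rats_dense_in_real[of "\<xi> q - \<eta> / 4" "\<xi> q"] \<eta> by auto
  then obtain \<rho> where \<rho>: "\<And>q. \<rho> q \<in> \<rat>" "\<And>q. \<xi> q - \<eta> / 4 < \<rho> q" "\<And>q. \<rho> q < \<xi> q" by metis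
  define ps where "ps = map (\<lambda>q. (q, \<rho> q)) qs"
  have "ps \<in> lists (Q \<times> \<rat>)" using C(1) qs \<rho>(1) by (auto simp: ps_def)
  moreover have lipL: "\<bar>\<xi> x - \<xi> y\<bar> \<le> L * norm (x - y)" for x y
    using lip_compactD(3)[OF \<xi>, of x y] mult_right_mono[OF lL norm_ge_zero, of "x - y"] by linarith
  have upper: "hat L ps z \<le> \<xi> z" for z
  proof (rule hat_le[OF pos])
    fix q r assume "(q, r) \<in> set ps"
    then have "r < \<xi> q" using \<rho>(3) by (auto simp: ps_def)
    then show "r - L * norm (z - q) \<le> \<xi> z" using lipL[of z q] by linarith
  qed
  moreover have lower: "\<xi> z - \<eta> \<le> hat L ps z" for z
  proof (cases "norm z \<le> R")
    case True
    then obtain q where q: "q \<in> C" "norm (z - q) < \<epsilon>"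
      using C(3) by (force simp: dist_norm norm_minus_commute)
    have "L * norm (z - q) \<le> L * \<epsilon>" using q L by (intro mult_left_mono) auto
    also have "\<dots> = \<eta> / 4" using L by (simp add: \<epsilon>_def)
    finally have "\<xi> z - \<eta> \<le> \<rho> q - L * norm (z - q)"
      using lipL[of z q] \<rho>(2)[of q] \<eta> by linarith
    also have "\<dots> \<le> hat L ps z" using q qs by (intro hat_ge) (auto simp: ps_def)
    finally show ?thesis .
  next
    case False
    then show ?thesis using lip_compactD(4)[OF \<xi>, of z] hat_nonneg[of L ps z] \<eta> by simp
  qed
  moreover have "\<bar>\<xi> z - hat L ps z\<bar> \<le> \<eta>" for z using upper[of z] lower[of z] \<eta> by linarith
  ultimately show ?thesis by blast
qed

lemma lip_compact_diff:
  assumes "lip_compact L R u" "lip_compact L' R' v"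
  shows "lip_compact (L + L') (max R R') (\<lambda>z. u z - v z)"
  unfolding lip_compact_def
proof (intro conjI allI impI)
  show "0 \<le> L + L'" "0 \<le> max R R'" using lip_compactD[OF assms(1)] lip_compactD[OF assms(2)] by auto
  show "\<bar>u x - v x - (u y - v y)\<bar> \<le> (L + L') * norm (x - y)" for x y
    using lip_compactD(3)[OF assms(1), of x y] lip_compactD(3)[OF assms(2), of x y]
    by (simp add: distrib_right)
  show "u x - v x = 0" if "max R R' < norm x" for x
    using lip_compactD(4)[OF assms(1), of x] lip_compactD(4)[OF assms(2), of x] that by simp
qed

lemma lip_compact_parts:
  assumes "lip_compact L R u"
  shows "lip_compact L R (\<lambda>z. max 0 (u z))" "lip_compact L R (\<lambda>z. max 0 (- u z))"
proof -
  have parts: "\<bar>max 0 (u x) - max 0 (u y)\<bar> \<le> L * norm (x - y)" "\<bar>max 0 (- u x) - max 0 (- u y)\<bar> \<le> L * norm (x - y)" for x y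
    using lip_compactD(3)[OF assms, of x y] by linarith+
  show "lip_compact L R (\<lambda>z. max 0 (u z))" "lip_compact L R (\<lambda>z. max 0 (- u z))"
    using lip_compactD[OF assms] parts unfolding lip_compact_def by auto
qed

text \<open>Countability makes the null set of exceptional times independent of the test function.\<close>

lemma countable_test_functions:
  "\<exists>\<D> :: ('a::euclidean_space \<Rightarrow> real) set. countable \<D> \<and> (\<forall>d\<in>\<D>. \<exists>L R. lip_compact L R d) \<and>
    (\<forall>\<xi> l R \<eta>. lip_compact l R \<xi> \<longrightarrow> 0 < \<eta> \<longrightarrow> (\<exists>d\<in>\<D>. \<forall>z. \<bar>\<xi> z - d z\<bar> \<le> \<eta>))"
proof -
  obtain Q :: "'a set" where Q: "countable Q" "\<And>X. open X \<Longrightarrow> X \<noteq> {} \<Longrightarrow> \<exists>q\<in>Q. q \<in> X"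
    using countable_dense_setE by blast
  define P where "P = lists (Q \<times> (\<rat> :: real set))"
  \<comment> \<open>Hats are nonnegative, so positive and negative parts are approximated
    separately; the slope \<open>Suc n\<close> can be made to exceed any Lipschitz constant.\<close>
  define F :: "nat \<times> ('a \<times> real) list \<times> ('a \<times> real) list \<Rightarrow> 'a \<Rightarrow> real"
    where "F = (\<lambda>(n, ps, ps') z. hat (real (Suc n)) ps z - hat (real (Suc n)) ps' z)"
  define \<D> where "\<D> = F ` (UNIV \<times> P \<times> P)"
  have cnt: "countable \<D>"
    unfolding \<D>_def P_def using Q(1) countable_rat by (intro countable_image countable_SIGMA countable_lists) auto
  have lc: "\<exists>L R. lip_compact L R d" if dD: "d \<in> \<D>" for d
  proof -
    obtain x where x: "d = F x" using dD unfolding \<D>_def by (rule imageE)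
    obtain n ps ps' where "x = (n, ps, ps')" by (rule prod_cases3)
    then have d: "d = (\<lambda>z. hat (real (Suc n)) ps z - hat (real (Suc n)) ps' z)"
      unfolding x by (simp only: F_def split_conv)
    obtain R R' where "lip_compact (real (Suc n)) R (hat (real (Suc n)) ps)" "lip_compact (real (Suc n)) R' (hat (real (Suc n)) ps')"
      using hat_lip_compact[of "real (Suc n)" ps] hat_lip_compact[of "real (Suc n)" ps'] by auto
    then show ?thesis unfolding d using lip_compact_diff by blast
  qed
  have dns: "\<exists>d\<in>\<D>. \<forall>z. \<bar>\<xi> z - d z\<bar> \<le> \<eta>" if \<xi>: "lip_compact l R \<xi>" and \<eta>: "0 < \<eta>" for \<xi> l R \<eta>
  proof -
    obtain n where n: "l < real n" using reals_Archimedean2 by blast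
    have L: "l \<le> real (Suc n)" "0 < real (Suc n)" using n by auto
    obtain ps where ps: "ps \<in> P" "\<And>z. \<bar>max 0 (\<xi> z) - hat (real (Suc n)) ps z\<bar> \<le> \<eta> / 2"
      using hat_dense[OF lip_compact_parts(1)[OF \<xi>] _ L _ Q(2), of "\<eta> / 2"] \<eta> unfolding P_def by auto
    obtain ps' where ps': "ps' \<in> P" "\<And>z. \<bar>max 0 (- \<xi> z) - hat (real (Suc n)) ps' z\<bar> \<le> \<eta> / 2"
      using hat_dense[OF lip_compact_parts(2)[OF \<xi>] _ L _ Q(2), of "\<eta> / 2"] \<eta> unfolding P_def by auto
    have "\<bar>\<xi> z - F (n, ps, ps') z\<bar> \<le> \<eta>" for z
    proof -
      have "\<xi> z = max 0 (\<xi> z) - max 0 (- \<xi> z)" by auto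
      moreover have "F (n, ps, ps') z = hat (real (Suc n)) ps z - hat (real (Suc n)) ps' z"
        by (simp only: F_def split_conv)
      moreover have "x = A - B \<Longrightarrow> y = h - h' \<Longrightarrow> x - y = (A - h) - (B - h')" for x y A B h h' :: real
        by simp
      ultimately have "\<xi> z - F (n, ps, ps') z =
          (max 0 (\<xi> z) - hat (real (Suc n)) ps z) - (max 0 (- \<xi> z) - hat (real (Suc n)) ps' z)"
        by blast
      also have "\<bar>\<dots>\<bar> \<le> \<eta> / 2 + \<eta> / 2"
        by (rule order_trans[OF abs_triangle_ineq4 add_mono[OF ps(2) ps'(2)]])
      finally show ?thesis by simp
    qed
    moreover have "F (n, ps, ps') \<in> \<D>" using ps(1) ps'(1) by (auto simp: \<D>_def)
    ultimately show ?thesis by blast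
  qed
  show ?thesis
    by (intro exI[of _ \<D>] conjI ballI allI impI cnt lc dns)
qed

text \<open>Compact sets generate the Borel sets, and their indicators are limits of compactly
  supported Lipschitz cutoffs, the class for which the transport identity is available.\<close>

lemma measure_eqI_lip_compact:
  fixes M N :: "'a::euclidean_space measure"
  assumes M: "prob_space M" "sets M = sets borel" and N: "prob_space N" "sets N = sets borel"
    and eq: "\<And>\<phi> L R. lip_compact L R \<phi> \<Longrightarrow> (\<integral>z. \<phi> z \<partial>M) = (\<integral>z. \<phi> z \<partial>N)"
  shows "M = N"
proof -
  interpret M: prob_space M by fact
  interpret N: prob_space N by fact
  have [measurable_cong, simp]: "sets M = sets borel" "sets N = sets borel" by fact+
  have cpt_eq: "emeasure M C = emeasure N C" if C: "compact C" for C
  proof (cases "C = {}")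
    case False
    \<comment> \<open>\<open>Suc n\<close> keeps the slope at least 1, so every cutoff vanishes from
      distance 1 on and one radius \<open>R + 1\<close> serves for all \<open>n\<close>.\<close>
    define \<phi> where "\<phi> n z = max 0 (1 - real (Suc n) * infdist z C)" for n z
    obtain R where R: "R > 0" "\<And>x. x \<in> C \<Longrightarrow> norm x \<le> R"
      using compact_imp_bounded[OF C] unfolding bounded_pos by blast
    have lc: "lip_compact (real (Suc n)) (R + 1) (\<phi> n)" for n
      unfolding lip_compact_def
    proof (intro conjI allI impI)
      fix x y :: 'a
      have "\<bar>infdist x C - infdist y C\<bar> \<le> norm (x - y)"
        using infdist_triangle_abs[of x C y] by (simp add: dist_norm)
      then have "real (Suc n) * \<bar>infdist x C - infdist y C\<bar> \<le> real (Suc n) * norm (x - y)"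
        by (intro mult_left_mono) auto
      moreover have "\<bar>\<phi> n x - \<phi> n y\<bar> \<le> \<bar>real (Suc n) * infdist x C - real (Suc n) * infdist y C\<bar>"
        unfolding \<phi>_def by linarith
      ultimately show "\<bar>\<phi> n x - \<phi> n y\<bar> \<le> real (Suc n) * norm (x - y)"
        by (simp only: right_diff_distrib[symmetric] abs_mult abs_of_nat)
    next
      fix x :: 'a assume x: "R + 1 < norm x"
      obtain c where c: "c \<in> C" "infdist x C = dist x c"
        using infdist_attains_inf[OF compact_imp_closed[OF C] False] by blast
      have "1 \<le> infdist x C" using R(2)[OF c(1)] x norm_triangle_ineq2[of x c] unfolding c(2) dist_norm by linarith
      then have "1 * 1 \<le> real (Suc n) * infdist x C" by (intro mult_mono) auto
      then show "\<phi> n x = 0" by (simp add: \<phi>_def)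
    qed (use R in auto)
    have [measurable]: "\<phi> n \<in> borel_measurable borel" for n by (rule lip_compact_measurable[OF lc])
    have [measurable]: "C \<in> sets borel" using C by (simp add: borel_compact)
    have bd: "\<bar>\<phi> n z\<bar> \<le> 1" for n z
      unfolding \<phi>_def using infdist_nonneg[of z C] by (auto simp: max_def)
    have lim: "(\<lambda>n. \<phi> n z) \<longlonglongrightarrow> indicator C z" for z
    proof (cases "z \<in> C")
      case zC: False
      have pos: "infdist z C > 0"
        using infdist_pos_not_in_closed[OF compact_imp_closed[OF C] False zC] .
      obtain m :: nat where m: "real m * infdist z C > 1" using reals_Archimedean3[OF pos] by blast
      have "\<phi> n z = 0" if "n \<ge> m" for n
      proof -
        have "real m * infdist z C \<le> real (Suc n) * infdist z C" using that pos by (intro mult_right_mono) auto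
        then show ?thesis using m by (simp add: \<phi>_def)
      qed
      then have "eventually (\<lambda>n. \<phi> n z = 0) sequentially" by (auto simp: eventually_sequentially)
      then show ?thesis using zC by (simp add: tendsto_eventually)
    qed (simp add: \<phi>_def)
    have "(\<lambda>n. \<integral>z. \<phi> n z \<partial>M) \<longlonglongrightarrow> (\<integral>z. indicator C z \<partial>M)"
      by (rule integral_dominated_convergence[where w = "\<lambda>_. 1"]) (use lim bd in auto)
    moreover have "(\<lambda>n. \<integral>z. \<phi> n z \<partial>N) \<longlonglongrightarrow> (\<integral>z. indicator C z \<partial>N)"
      by (rule integral_dominated_convergence[where w = "\<lambda>_. 1"]) (use lim bd in auto)
    ultimately have "(\<integral>z. indicator C z \<partial>M) = (\<integral>z. indicator C z \<partial>N :: real)"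
      using eq[OF lc] LIMSEQ_unique by simp
    then show ?thesis by (simp add: M.emeasure_eq_measure N.emeasure_eq_measure)
  qed simp
  show ?thesis
  proof (rule measure_eqI_generator_eq[where E="Collect compact" and \<Omega>=UNIV and A="\<lambda>n. cball 0 (real n)"])
    show "Int_stable (Collect (compact :: 'a set \<Rightarrow> bool))"
      by (auto simp: Int_stable_def compact_Int)
    have "sigma_sets UNIV (Collect compact) = sets (borel :: 'a measure)"
    proof (rule antisym)
      show "sigma_sets UNIV (Collect compact) \<subseteq> sets (borel :: 'a measure)"
      proof -
        have "Collect compact \<subseteq> sets (borel :: 'a measure)" by (auto simp: borel_compact)
        from sets.sigma_sets_subset[OF this] show ?thesis by simp
      qed
      have "C \<in> sigma_sets UNIV (Collect compact)" if C: "closed C" for C :: "'a set"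
      proof -
        have "C = (\<Union>n. C \<inter> cball 0 (real n))" using real_arch_simple by auto
        also have "\<dots> \<in> sigma_sets UNIV (Collect compact)"
          using C by (intro sigma_sets.Union sigma_sets.Basic) (auto intro: closed_Int_compact)
        finally show ?thesis .
      qed
      then have "sigma_sets UNIV (Collect closed) \<subseteq> sigma_sets UNIV (Collect (compact :: 'a set \<Rightarrow> bool))"
        by (intro sigma_sets_mono) auto
      moreover have "sets (borel :: 'a measure) = sigma_sets UNIV (Collect closed)" by (simp add: borel_eq_closed)
      ultimately show "sets (borel :: 'a measure) \<subseteq> sigma_sets UNIV (Collect compact)" by simp
    qed
    then show "sets M = sigma_sets UNIV (Collect compact)" "sets N = sigma_sets UNIV (Collect compact)" by auto
    show "(\<Union>n. cball 0 (real n)) = (UNIV :: 'a set)" using real_arch_simple by auto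
  qed (use cpt_eq in auto)
qed

text \<open>On each \<open>{0<..a}\<close> the positive and the negative part of \<open>q\<close>
  are densities of two finite measures that agree on all half lines \<open>{x<..}\<close>, hence
  coincide; densities are unique almost everywhere.\<close>

lemma AE_zero_of_integrals_zero:
  fixes q :: "real \<Rightarrow> real"
  assumes int: "\<And>a. 0 \<le> a \<Longrightarrow> set_integrable lborel {0..a} q"
    and zero: "\<And>a. 0 \<le> a \<Longrightarrow> (LINT t:{0..a}|lborel. q t) = 0"
    and [measurable]: "q \<in> borel_measurable borel"
  shows "AE t in lborel. 0 \<le> t \<longrightarrow> q t = 0"
proof -
  have fin: "AE t in lborel. t \<in> {0<..a} \<longrightarrow> q t = 0" if a: "0 \<le> a" for a
  proof -
    define p where "p t = ennreal (q t * indicator {0<..a} t)" for t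
    define n where "n t = ennreal (- q t * indicator {0<..a} t)" for t
    have [measurable]: "p \<in> borel_measurable borel" "n \<in> borel_measurable borel"
      unfolding p_def[abs_def] n_def[abs_def] by measurable
    have ix: "integrable lborel (\<lambda>t. q t * indicator {x<..a} t)" if "0 \<le> x" for x
    proof -
      have "set_integrable lborel {x<..a} q" by (rule set_integrable_subset[OF int[OF a]]) (use that in auto)
      then show ?thesis by (simp add: set_integrable_def mult.commute)
    qed
    have zx: "(\<integral>t. q t * indicator {x<..a} t \<partial>lborel) = 0" if x: "0 \<le> x" for x
    proof (cases "x \<le> a")
      case True
      have "(LINT t:{0..x} \<union> {x<..a}|lborel. q t) = (LINT t:{0..x}|lborel. q t) + (LINT t:{x<..a}|lborel. q t)"
        by (intro set_integral_Un int[OF x] set_integrable_subset[OF int[OF a]]) (use x in auto)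
      moreover have "{0..x} \<union> {x<..a} = {0..a}" using x True by auto
      ultimately show ?thesis using zero[OF x] zero[OF a] by (simp add: set_lebesgue_integral_def mult.commute)
    qed simp
    have "density lborel p = density lborel n"
    proof (rule measure_eqI_lessThan)
      fix x :: real
      define y where "y = max 0 x"
      have pe: "emeasure (density lborel p) {x<..} = (\<integral>\<^sup>+t. ennreal (q t * indicator {y<..a} t) \<partial>lborel)"
        unfolding y_def by (subst emeasure_density) (auto intro!: nn_integral_cong simp: p_def indicator_def)
      have ne: "emeasure (density lborel n) {x<..} = (\<integral>\<^sup>+t. ennreal (- (q t * indicator {y<..a} t)) \<partial>lborel)"
        unfolding y_def by (subst emeasure_density) (auto intro!: nn_integral_cong simp: n_def indicator_def)
      note i = ix[of y] zx[of y]
      have y: "0 \<le> y" by (simp add: y_def)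
      have finp: "(\<integral>\<^sup>+t. ennreal (q t * indicator {y<..a} t) \<partial>lborel) < \<infinity>"
        and finn: "(\<integral>\<^sup>+t. ennreal (- (q t * indicator {y<..a} t)) \<partial>lborel) < \<infinity>"
        using i(1)[OF y] by (auto simp: real_integrable_def less_top)
      have "enn2real (\<integral>\<^sup>+t. ennreal (q t * indicator {y<..a} t) \<partial>lborel) =
          enn2real (\<integral>\<^sup>+t. ennreal (- (q t * indicator {y<..a} t)) \<partial>lborel)"
        using real_lebesgue_integral_def[OF i(1)[OF y]] i(2)[OF y] by simp
      then show "emeasure (density lborel p) {x<..} = emeasure (density lborel n) {x<..}"
        unfolding pe ne using finp finn by (metis ennreal_enn2real infinity_ennreal_def)
      show "emeasure (density lborel p) {x<..} < \<infinity>" unfolding pe by (rule finp)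
    qed auto
    then have "AE t in lborel. p t = n t"
      by (intro sigma_finite_measure.density_unique[OF sigma_finite_lborel]) auto
    then show ?thesis
    proof eventually_elim
      case (elim t)
      then show ?case by (cases "0 \<le> q t") (auto simp: p_def n_def ennreal_neg)
    qed
  qed
  have "AE t in lborel. \<forall>m::nat. t \<in> {0<..real m} \<longrightarrow> q t = 0"
    using fin by (subst AE_all_countable) auto
  moreover have "AE t in lborel. t \<noteq> (0::real)" by (rule AE_lborel_singleton)
  ultimately show ?thesis
  proof eventually_elim
    case (elim t)
    obtain m :: nat where "t \<le> real m" using real_arch_simple by blast
    then show ?case using elim by auto
  qed
qed

subsection \<open>Weak solutions are transported by their flow\<close>

lemma velocity_cong_AE:
  assumes [measurable]: "h \<in> borel_measurable borel" "h' \<in> borel_measurable borel"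
    and eq: "AE z in lborel. h z = h' z"
  shows "velocity h = velocity h'"
proof -
  have [measurable]: "(\<lambda>z. h (fst z, snd z)) \<in> borel_measurable (borel :: phase measure)"
    "(\<lambda>z. h' (fst z, snd z)) \<in> borel_measurable (borel :: phase measure)" by simp_all
  have "V_field h z = V_field h' z" "A_field h z = A_field h' z" for z
    unfolding V_field_def A_field_def case_prod_beta'
    by (intro integral_cong_AE; use eq in auto)+
  then show ?thesis by (simp add: velocity_def fun_eq_iff)
qed

lemma pos_part_square_derivative: "((\<lambda>x::real. (max 0 x)\<^sup>2) has_real_derivative 2 * max 0 x) (at x)"
proof -
  have "C11_bound (\<lambda>x::real. (max 0 x)\<^sup>2) (\<lambda>x. 2 * max 0 x) 1"
    using square_pos_part_taylor by (simp add: C11_bound_def)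
  from C11_bound_has_derivative[OF this, of x] show ?thesis
    by (simp add: has_field_derivative_def)
qed

text \<open>The admissible time factors \<open>cutoff a n\<close> tend to \<open>max 0 (a - t)\<close>, and their derivatives
  \<open>cutoff' a n\<close> to minus the indicator of \<open>{..<a}\<close>.\<close>

definition cutoff :: "real \<Rightarrow> nat \<Rightarrow> real \<Rightarrow> real" where
  "cutoff a n t = real (Suc n) / 2 * ((max 0 (a - t))\<^sup>2 - (max 0 (a - 1 / real (Suc n) - t))\<^sup>2)"

definition cutoff' :: "real \<Rightarrow> nat \<Rightarrow> real \<Rightarrow> real" where
  "cutoff' a n t = - real (Suc n) * (max 0 (a - t) - max 0 (a - 1 / real (Suc n) - t))"

lemma cutoff_derivative: "(cutoff a n has_real_derivative cutoff' a n t) (at t)"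
proof -
  have *: "((\<lambda>t. (max 0 (c - t))\<^sup>2) has_real_derivative - (2 * max 0 (c - t))) (at t)" for c
  proof -
    have "((\<lambda>t. c - t) has_real_derivative - 1) (at t)" by (auto intro!: derivative_eq_intros)
    from DERIV_chain2[OF pos_part_square_derivative this] show ?thesis by simp
  qed
  show ?thesis
    using DERIV_cmult[OF DERIV_diff[OF *[of a] *[of "a - 1 / real (Suc n)"]], of "real (Suc n) / 2"]
    unfolding cutoff_def[abs_def] cutoff'_def by (simp add: algebra_simps del: of_nat_Suc)
qed

lemma cutoff_continuous: "continuous_on UNIV (cutoff a n)" "continuous_on UNIV (cutoff' a n)"
  unfolding cutoff_def[abs_def] cutoff'_def[abs_def] by (intro continuous_intros)+

lemma cutoff_zero:
  assumes "a \<le> t"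
  shows "cutoff a n t = 0" "cutoff' a n t = 0"
proof -
  have "a - 1 / real (Suc n) - t \<le> 0" using assms by (smt (verit) divide_nonneg_nonneg of_nat_0_le_iff)
  then show "cutoff a n t = 0" "cutoff' a n t = 0" using assms by (simp_all add: cutoff_def cutoff'_def)
qed

text \<open>Up to sign, \<open>cutoff\<close> is a difference quotient of half the square of
  \<open>max 0 (a - t)\<close> with step \<open>1 / Suc n\<close>; the Taylor remainder leaves an
  error of at most half a step.\<close>

lemma cutoff_close: "\<bar>cutoff a n t - max 0 (a - t)\<bar> \<le> 1 / real (Suc n)"
proof -
  define h where "h = 1 / real (Suc n)"
  have h: "h > 0" "real (Suc n) = 1 / h" by (auto simp: h_def)
  have "\<bar>(max 0 ((a - t) - h))\<^sup>2 - (max 0 (a - t))\<^sup>2 - 2 * max 0 (a - t) * (- h)\<bar> \<le> h\<^sup>2"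
    using square_pos_part_taylor[of "a - t" "- h"] by simp
  then have le: "\<bar>(max 0 (a - t))\<^sup>2 - (max 0 (a - t - h))\<^sup>2 - 2 * h * max 0 (a - t)\<bar> \<le> h\<^sup>2"
    by (simp add: abs_le_iff mult.commute mult.left_commute)
  have "cutoff a n t - max 0 (a - t) = ((max 0 (a - t))\<^sup>2 - (max 0 (a - t - h))\<^sup>2 - 2 * h * max 0 (a - t)) / (2 * h)"
    unfolding cutoff_def h(2) using h(1) by (simp add: field_simps diff_diff_eq)
  then have "\<bar>cutoff a n t - max 0 (a - t)\<bar> \<le> h\<^sup>2 / (2 * h)"
    using le h(1) by (simp add: abs_divide divide_right_mono)
  also have "\<dots> \<le> h" using h by (simp add: power2_eq_square)
  finally show ?thesis by (simp add: h_def)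
qed

lemma cutoff_tendsto: "(\<lambda>n. cutoff a n t) \<longlonglongrightarrow> max 0 (a - t)"
proof -
  have "(\<lambda>n. cutoff a n t - max 0 (a - t)) \<longlonglongrightarrow> 0"
    by (rule Lim_null_comparison[OF _ LIMSEQ_inverse_real_of_nat])
       (auto intro!: always_eventually simp: cutoff_close inverse_eq_divide simp del: of_nat_Suc)
  then show ?thesis by (simp add: LIM_zero_iff)
qed

lemma cutoff'_bound: "\<bar>cutoff' a n t\<bar> \<le> 1"
proof -
  have "\<bar>max 0 (a - t) - max 0 (a - 1 / real (Suc n) - t)\<bar> \<le> 1 / real (Suc n)"
  proof -
    have "0 < 1 / real (Suc n)" by simp
    then show ?thesis by linarith
  qed
  from mult_left_mono[OF this, of "real (Suc n)"] show ?thesis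
    by (simp add: cutoff'_def abs_mult del: of_nat_Suc)
qed

lemma cutoff'_tendsto:
  assumes "t < a"
  shows "(\<lambda>n. cutoff' a n t) \<longlonglongrightarrow> -1"
proof (rule tendsto_eventually)
  have "(\<lambda>n. inverse (real (Suc n))) \<longlonglongrightarrow> 0" by (rule LIMSEQ_inverse_real_of_nat)
  then have "eventually (\<lambda>n. inverse (real (Suc n)) < a - t) sequentially"
    using assms by (intro order_tendstoD(2)[of _ 0]) auto
  then show "eventually (\<lambda>n. cutoff' a n t = -1) sequentially"
  proof eventually_elim
    case (elim n)
    then show ?case using assms by (simp add: cutoff'_def max_def inverse_eq_divide del: of_nat_Suc)
  qed
qed

section \<open>One solution: good times, corrected density and its field\<close>

locale kinetic_solution =
  fixes \<gamma> :: real and f :: "real \<Rightarrow> phase \<Rightarrow> real" and f0 :: "phase measure"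
  assumes \<gamma>: "2 < \<gamma>"
    and weak: "weak_solution f f0"
    and reg: "f \<in> L1_loc (Prob1_densities \<inter> Linf_weighted \<gamma>) (weighted_norm \<gamma>)"
begin

lemma f0_prob: "prob_space f0" and f0_sets [measurable_cong]: "sets f0 = sets borel"
  using weak by (auto simp: weak_solution_def Prob_def)

text \<open>Regularity of \<open>f t\<close> is given almost everywhere, on a set that need not be
  Borel. A Borel choice keeps the density corrected on it jointly measurable.\<close>

definition good_times :: "real set" where
  "good_times = (SOME S. S \<in> sets borel \<and> S \<subseteq> {0..} \<and> (AE t in lborel. 0 \<le> t \<longrightarrow> t \<in> S) \<and>
     (\<forall>t\<in>S. f t \<in> Prob1_densities \<inter> Linf_weighted \<gamma>))"

lemma good_times:
  shows good_times_measurable [measurable]: "good_times \<in> sets borel"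
    and good_times_subset: "good_times \<subseteq> {0..}"
    and good_times_AE: "AE t in lborel. 0 \<le> t \<longrightarrow> t \<in> good_times"
    and good_times_f: "t \<in> good_times \<Longrightarrow> f t \<in> Prob1_densities \<inter> Linf_weighted \<gamma>"
proof -
  have "AE t in lborel. 0 \<le> t \<longrightarrow> f t \<in> Prob1_densities \<inter> Linf_weighted \<gamma>"
    using reg by (auto simp: L1_loc_def)
  then obtain N where N: "N \<in> null_sets lborel"
      "{t \<in> space lborel. \<not> (0 \<le> t \<longrightarrow> f t \<in> Prob1_densities \<inter> Linf_weighted \<gamma>)} \<subseteq> N"
    by (auto elim!: AE_E simp: null_sets_def)
  have "AE t in lborel. t \<notin> N" using N(1) by (rule AE_not_in)
  then have "AE t in lborel. 0 \<le> t \<longrightarrow> t \<in> {0..} - N" by eventually_elim auto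
  moreover have "{0..} - N \<in> sets borel" using N(1) by (auto simp: null_sets_def)
  ultimately have "\<exists>S. S \<in> sets borel \<and> S \<subseteq> {0..} \<and> (AE t in lborel. 0 \<le> t \<longrightarrow> t \<in> S) \<and>
     (\<forall>t\<in>S. f t \<in> Prob1_densities \<inter> Linf_weighted \<gamma>)"
    using N(2) by (intro exI[of _ "{0..} - N"]) auto
  from someI_ex[OF this]
  show "good_times \<in> sets borel" "good_times \<subseteq> {0..}" "AE t in lborel. 0 \<le> t \<longrightarrow> t \<in> good_times"
    "t \<in> good_times \<Longrightarrow> f t \<in> Prob1_densities \<inter> Linf_weighted \<gamma>"
    unfolding good_times_def by blast+
qed

text \<open>Setting the density to zero at the exceptional times makes the estimates on its field hold
  at every time.\<close>

definition dens :: "real \<Rightarrow> phase \<Rightarrow> real" where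
  "dens t z = (if t \<in> good_times then max 0 (f t z) else 0)"

text \<open>Measurability of \<open>f\<close> is known only over \<open>{0..}\<close>; freezing
  negative times at 0 gives a function on the whole line.\<close>

lemma f_extend_measurable: "(\<lambda>(t, z). f (max 0 t) z) \<in> borel_measurable (borel \<Otimes>\<^sub>M borel)"
proof -
  have f: "(\<lambda>(t, z). f t z) \<in> borel_measurable (restrict_space borel {0..} \<Otimes>\<^sub>M borel)"
    using reg by (simp add: L1_loc_def)
  have "(\<lambda>p. (max 0 (fst p), snd p)) \<in> borel \<Otimes>\<^sub>M borel \<rightarrow>\<^sub>M restrict_space borel {0::real..} \<Otimes>\<^sub>M (borel :: phase measure)"
    by (intro measurable_Pair measurable_restrict_space2) auto
  from measurable_compose[OF this f] show ?thesis by (simp add: case_prod_beta')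
qed

lemma dens_measurable: "(\<lambda>(t, z). dens t z) \<in> borel_measurable (borel \<Otimes>\<^sub>M borel)"
proof -
  have [measurable]: "(\<lambda>p. f (max 0 (fst p)) (snd p)) \<in> borel_measurable (borel \<Otimes>\<^sub>M borel)"
    using f_extend_measurable by (simp add: case_prod_beta')
  have "dens t z = (if t \<in> good_times then max 0 (f (max 0 t) z) else 0)" for t z
    using good_times_subset by (auto simp: dens_def max_def)
  then show ?thesis by (simp add: case_prod_beta')
qed

lemma dens_measurable_compose [measurable (raw)]:
  assumes "a \<in> borel_measurable M" "c \<in> borel_measurable M"
  shows "(\<lambda>x. dens (a x) (c x)) \<in> borel_measurable M"
  using measurable_compose[OF measurable_Pair[OF assms] dens_measurable] by simp

lemma f_good:
  assumes "t \<in> good_times"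
  shows "0 \<le> t" "f t \<in> borel_measurable borel" "AE z in lborel. 0 \<le> f t z"
    "measure_of_density (f t) \<in> Prob1" "weighted_norm \<gamma> (f t) < \<infinity>"
  using good_times_f[OF assms] good_times_subset assms
  by (auto simp: Prob1_densities_def Linf_weighted_def)

lemma dens_nonneg: "0 \<le> dens t z"
  by (simp add: dens_def)

lemma dens_eq_AE:
  assumes "t \<in> good_times"
  shows "AE z in lborel. f t z = dens t z"
  using f_good(3)[OF assms] by eventually_elim (simp add: dens_def assms)

lemma measure_of_density_dens: "t \<in> good_times \<Longrightarrow> measure_of_density (dens t) = measure_of_density (f t)"
  unfolding measure_of_density_def by (intro arg_cong2[where f=density] refl ext) (auto simp: dens_def max_def ennreal_neg)

lemma sets_measure_of_density [simp]: "sets (measure_of_density h) = sets borel"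
  by (simp add: measure_of_density_def)

lemma dens_prob: "t \<in> good_times \<Longrightarrow> prob_space (measure_of_density (dens t))"
  using f_good(4)[of t] by (simp add: measure_of_density_dens Prob1_def Prob_def)

lemma weighted_norm_dens:
  shows "t \<in> good_times \<Longrightarrow> weighted_norm \<gamma> (dens t) \<le> weighted_norm \<gamma> (f t)"
    and "t \<notin> good_times \<Longrightarrow> weighted_norm \<gamma> (dens t) = 0"
    and "weighted_norm \<gamma> (dens t) < \<infinity>"
proof -
  have [measurable]: "(\<lambda>z. dens t (fst z, snd z)) \<in> borel_measurable borel" by measurable
  have m: "(\<lambda>(x, v). ennreal ((1 + norm x) powr \<gamma> * (1 + norm v) powr \<gamma> * \<bar>dens t (x, v)\<bar>)) \<in> borel_measurable lborel"
    unfolding case_prod_beta' by measurable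
  show 1: "weighted_norm \<gamma> (dens t) \<le> weighted_norm \<gamma> (f t)" if "t \<in> good_times"
    unfolding weighted_norm_def
    by (rule esssup_mono[OF m]) (auto simp: dens_def intro!: ennreal_leI mult_left_mono)
  show 2: "weighted_norm \<gamma> (dens t) = 0" if "t \<notin> good_times"
  proof -
    have "weighted_norm \<gamma> (dens t) \<le> 0"
      unfolding weighted_norm_def by (rule esssup_I[OF m]) (use that in \<open>auto simp: dens_def\<close>)
    then show ?thesis by simp
  qed
  show "weighted_norm \<gamma> (dens t) < \<infinity>"
    using 1 2 f_good(5)[of t] by (cases "t \<in> good_times") (auto intro: le_less_trans)
qed

definition amp :: "real \<Rightarrow> real" where
  "amp t = enn2real (weighted_norm \<gamma> (dens t))"

lemma amp_eq: "ennreal (amp t) = weighted_norm \<gamma> (dens t)"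
  using weighted_norm_dens(3)[of t] by (simp add: amp_def)

lemma amp_nonneg: "0 \<le> amp t"
  by (simp add: amp_def)

lemma amp_measurable [measurable]: "amp \<in> borel_measurable borel"
  using weighted_norm_measurable[OF dens_measurable] unfolding amp_def[abs_def] by measurable

lemma amp_le_AE: "AE t in lborel. 0 \<le> t \<longrightarrow> ennreal (amp t) \<le> weighted_norm \<gamma> (f t)"
  using good_times_AE by eventually_elim (auto simp: amp_eq weighted_norm_dens(1))

lemma amp_set_integrable: "set_integrable lborel {s..t} amp"
  unfolding set_integrable_def
proof (rule integrableI_bounded)
  have "(\<integral>\<^sup>+r. ennreal (norm (indicator {s..t} r *\<^sub>R amp r)) \<partial>lborel) \<le> (\<integral>\<^sup>+r\<in>{0..max 0 t}. weighted_norm \<gamma> (f r) \<partial>lborel)"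
  proof (rule nn_integral_mono_AE)
    show "AE r in lborel. ennreal (norm (indicator {s..t} r *\<^sub>R amp r)) \<le> weighted_norm \<gamma> (f r) * indicator {0..max 0 t} r"
      using amp_le_AE
    proof eventually_elim
      case (elim r)
      have "amp r = 0" if "r < 0"
        using that good_times_subset weighted_norm_dens(2)[of r] by (force simp: amp_def)
      then show ?case using elim amp_nonneg[of r] by (cases "r < 0") (auto simp: indicator_def)
    qed
  qed
  also have "\<dots> < \<infinity>" using reg by (auto simp: L1_loc_def)
  finally show "(\<integral>\<^sup>+r. ennreal (norm (indicator {s..t} r *\<^sub>R amp r)) \<partial>lborel) < \<infinity>" .
qed measurable

lemma dens_dominated: "weight_dominated \<gamma> (amp t) (dens t)"
  unfolding amp_def by (rule weight_dominated_weighted_norm[OF _ weighted_norm_dens(3)]) measurable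

definition rate :: "real \<Rightarrow> real" where
  "rate t = amp t * kernel_const \<gamma>"

definition vel :: "real \<Rightarrow> phase \<Rightarrow> phase" where
  "vel t = velocity (dens t)"

lemma caratheodory: "caratheodory_field rate vel"
proof
  show "rate \<in> borel_measurable borel" unfolding rate_def[abs_def] by measurable
  show "0 \<le> rate t" for t by (simp add: rate_def amp_nonneg kernel_const_nonneg[OF \<gamma>])
  show "set_integrable lborel {s..t} rate" for s t
    using amp_set_integrable[of s t] unfolding rate_def[abs_def] by (intro set_integrable_mult_left) auto
  show "(\<lambda>(t, z). vel t z) \<in> borel_measurable borel"
    unfolding vel_def by (rule velocity_measurable[OF dens_measurable])
  show "norm (vel t z) \<le> rate t" for t z
    unfolding vel_def rate_def by (rule velocity_bound[OF \<gamma> dens_dominated])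
  show "norm (vel t z - vel t w) \<le> rate t * norm (z - w)" for t z w
    unfolding vel_def rate_def by (rule velocity_lipschitz[OF \<gamma> dens_dominated])
qed

sublocale caratheodory_field rate vel by (rule caratheodory)

lemma integral_dens:
  fixes g :: "phase \<Rightarrow> real"
  assumes [measurable]: "g \<in> borel_measurable borel"
  shows "(\<integral>z. g z \<partial>measure_of_density (dens t)) = (\<integral>z. dens t z * g z \<partial>lborel)"
  unfolding measure_of_density_def by (subst integral_density) (auto simp: dens_nonneg)

text \<open>The mass of \<open>dens t\<close> is 1 at good times and 0 otherwise, so averages of
  bounded functions are bounded at every time without exception.\<close>

lemma dens_mult_bound:
  fixes g :: "phase \<Rightarrow> real"
  assumes [measurable]: "g \<in> borel_measurable borel" and c: "\<And>z. \<bar>g z\<bar> \<le> c" "0 \<le> c"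
  shows "integrable lborel (\<lambda>z. dens t z * g z)" "(\<integral>z. \<bar>dens t z * g z\<bar> \<partial>lborel) \<le> c"
    "\<bar>\<integral>z. dens t z * g z \<partial>lborel\<bar> \<le> c"
proof -
  have nn: "(\<integral>\<^sup>+z. ennreal (dens t z) \<partial>lborel) \<le> 1"
  proof (cases "t \<in> good_times")
    case True
    then have "emeasure (measure_of_density (dens t)) (space (measure_of_density (dens t))) = 1"
      by (intro prob_space.emeasure_space_1 dens_prob)
    then show ?thesis by (simp add: measure_of_density_def emeasure_density)
  qed (simp add: dens_def)
  have di: "integrable lborel (dens t)"
    by (rule integrableI_bounded) (use nn in \<open>auto simp: dens_nonneg intro: le_less_trans\<close>)
  have d1: "(\<integral>z. dens t z \<partial>lborel) \<le> 1"
    using nn nn_integral_eq_integral[OF di] by (simp add: dens_nonneg)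
  have le: "\<bar>dens t z * g z\<bar> \<le> dens t z * c" for z
    using c(1)[of z] dens_nonneg[of t z] by (simp add: abs_mult mult_left_mono)
  show int: "integrable lborel (\<lambda>z. dens t z * g z)"
    by (rule Bochner_Integration.integrable_bound[OF integrable_mult_left[OF di, of c]])
       (use le in \<open>auto intro!: AE_I2 order_trans[OF _ abs_ge_self]\<close>)
  have "(\<integral>z. \<bar>dens t z * g z\<bar> \<partial>lborel) \<le> (\<integral>z. dens t z * c \<partial>lborel)"
    using int di le by (intro integral_mono) auto
  also have "\<dots> \<le> c" using mult_right_mono[OF d1 c(2)] by simp
  finally show *: "(\<integral>z. \<bar>dens t z * g z\<bar> \<partial>lborel) \<le> c" .
  show "\<bar>\<integral>z. dens t z * g z \<partial>lborel\<bar> \<le> c"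
    using * integral_abs_bound[of lborel "\<lambda>z. dens t z * g z"] by linarith
qed

text \<open>Formally the time derivative of \<open>mean \<phi>\<close> is \<open>flux\<close> of the
  gradient of \<open>\<phi>\<close>; the weak formulation is unfolded into an integrated version of
  this law.\<close>

definition mean :: "(phase \<Rightarrow> real) \<Rightarrow> real \<Rightarrow> real" where
  "mean \<phi> t = (\<integral>z. dens t z * \<phi> z \<partial>lborel)"

definition flux :: "(phase \<Rightarrow> phase) \<Rightarrow> real \<Rightarrow> real" where
  "flux D t = (\<integral>z. dens t z * (D z \<bullet> vel t z) \<partial>lborel)"

lemma mean_measurable:
  assumes [measurable]: "\<phi> \<in> borel_measurable borel"
  shows "mean \<phi> \<in> borel_measurable borel"
  unfolding mean_def[abs_def] by measurable

lemma flux_measurable: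
  assumes [measurable]: "D \<in> borel_measurable borel"
  shows "flux D \<in> borel_measurable borel"
proof -
  have [measurable]: "(\<lambda>x. vel (fst x) (snd x)) \<in> borel_measurable (borel \<Otimes>\<^sub>M lborel)"
    by (rule b_measurable_compose) measurable
  show ?thesis unfolding flux_def[abs_def] by measurable
qed

lemma inner_vel_le: "norm (D z) \<le> L \<Longrightarrow> \<bar>D z \<bullet> vel t z\<bar> \<le> L * rate t"
  using mult_mono[OF _ b_bound[of t z], of "norm (D z)" L] order_trans[OF norm_ge_zero, of "D z" L]
  by (intro order_trans[OF Cauchy_Schwarz_ineq2]) auto

lemma flux_bound:
  assumes [measurable]: "D \<in> borel_measurable borel" and D: "\<And>z. norm (D z) \<le> L"
  shows "\<bar>flux D t\<bar> \<le> L * rate t" "flux D integrable_on {r..s}" "set_integrable lborel {r..s} (flux D)"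
proof -
  have L: "0 \<le> L" using order_trans[OF norm_ge_zero D] .
  show bd: "\<bar>flux D t\<bar> \<le> L * rate t" for t
    unfolding flux_def by (rule dens_mult_bound(3)) (use inner_vel_le[of D _ L, OF D] L k_nonneg in auto)
  show "flux D integrable_on {r..s}" "set_integrable lborel {r..s} (flux D)"
    using integrable_on_bounded_by[of "flux D" r s L] flux_measurable[of D] bd by auto
qed

end

lemma set_integrable_const_Icc: "set_integrable lborel {a..b::real} (\<lambda>_. c :: real)"
  unfolding set_integrable_def by (rule borel_integrable_compact) auto

section \<open>From the weak formulation to an integrated balance\<close>

context kinetic_solution
begin

text \<open>Test functions \<open>\<theta> t * \<phi> z\<close> separate time from phase space;
  Fubini then leaves an identity between functions of time only.\<close>

lemma weak_formulation_tensor: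
  assumes \<phi>: "C11_bound \<phi> D A" "\<And>z. R < norm z \<Longrightarrow> \<phi> z = 0" "\<And>z. \<bar>\<phi> z\<bar> \<le> M" "\<And>z. norm (D z) \<le> L"
    and \<theta>: "\<And>t. (\<theta> has_real_derivative \<theta>' t) (at t)" "continuous_on UNIV \<theta>'"
      "\<And>t. a \<le> t \<Longrightarrow> \<theta> t = 0" "\<And>t. a \<le> t \<Longrightarrow> \<theta>' t = 0"
      "\<And>t. t \<in> {0..a} \<Longrightarrow> \<bar>\<theta> t\<bar> \<le> c" "\<And>t. t \<in> {0..a} \<Longrightarrow> \<bar>\<theta>' t\<bar> \<le> c"
  shows "(\<integral>t. indicator {0..} t * (\<theta>' t * mean \<phi> t + \<theta> t * flux D t) \<partial>lborel) = - \<theta> 0 * (\<integral>z. \<phi> z \<partial>f0)"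
proof -
  have D_cont: "continuous_on UNIV D" by (rule C11_bound_grad_continuous[OF \<phi>(1)])
  have \<theta>_cont: "continuous_on UNIV \<theta>"
    using \<theta>(1) by (meson DERIV_isCont continuous_at_imp_continuous_on)
  have \<phi>_cont: "continuous_on UNIV \<phi>"
    using C11_bound_has_derivative[OF \<phi>(1)] by (meson continuous_at_imp_continuous_on has_derivative_continuous)
  have [measurable]: "\<phi> \<in> borel_measurable borel" "D \<in> borel_measurable borel"
      "\<theta> \<in> borel_measurable borel" "\<theta>' \<in> borel_measurable borel"
    by (intro borel_measurable_continuous_onI D_cont \<theta>_cont \<theta>(2) \<phi>_cont)+
  have M: "0 \<le> M" and L: "0 \<le> L" using order_trans[OF abs_ge_zero \<phi>(3)] order_trans[OF norm_ge_zero \<phi>(4)] by auto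
  define \<psi> where "\<psi> p = \<theta> (fst p) * \<phi> (snd p)" for p :: "real \<times> phase"
  define D' where "D' p = (\<theta>' (fst p) * \<phi> (snd p), \<theta> (fst p) *\<^sub>R D (snd p))" for p :: "real \<times> phase"
  have "test_function \<psi> D'"
    unfolding test_function_def
  proof (intro conjI ballI exI[of _ "{0..a} \<times> cball 0 R"])
    show "(\<psi> has_derivative (\<bullet>) (D' p)) (at p within half_space)" for p
    proof -
      have "(\<theta> has_derivative (\<lambda>h. \<theta>' (fst p) * h)) (at (fst p))"
        using \<theta>(1)[of "fst p"] by (simp add: has_field_derivative_def)
      from has_derivative_compose[OF has_derivative_fst[OF has_derivative_ident] this]
      have 1: "((\<lambda>q. \<theta> (fst q)) has_derivative (\<lambda>h. \<theta>' (fst p) * fst h)) (at p within half_space)" .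
      from has_derivative_compose[OF has_derivative_snd[OF has_derivative_ident] C11_bound_has_derivative[OF \<phi>(1), of "snd p"]]
      have 2: "((\<lambda>q. \<phi> (snd q)) has_derivative (\<lambda>h. D (snd p) \<bullet> snd h)) (at p within half_space)" .
      show ?thesis
        unfolding \<psi>_def[abs_def]
        by (rule has_derivative_eq_rhs[OF has_derivative_mult[OF 1 2]])
           (auto simp: D'_def inner_prod_def fun_eq_iff distrib_left)
    qed
    show "continuous_on half_space D'"
      unfolding D'_def[abs_def]
      by (intro continuous_intros continuous_on_compose2[OF \<theta>(2)] continuous_on_compose2[OF \<theta>_cont]
          continuous_on_compose2[OF \<phi>_cont] continuous_on_compose2[OF D_cont]) auto
    show "compact ({0..a} \<times> cball (0::phase) R)" by (intro compact_Times) auto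
    fix p :: "real \<times> phase" assume p: "p \<in> half_space - {0..a} \<times> cball 0 R"
    then consider "a \<le> fst p" | "R < norm (snd p)" by (cases p) force
    then show "\<psi> p = 0" using \<theta>(3) \<phi>(2) by cases (auto simp: \<psi>_def)
  qed
  then have weq: "(LINT (t, z):half_space|lborel. f t z * (D' (t, z) \<bullet> (1, V_field (f t) z, A_field (f t) z))) = - (\<integral>z. \<psi> (0, z) \<partial>f0)"
    using weak unfolding weak_solution_def by blast
  define E where "E t z = indicator {0..} t * (f (max 0 t) z * (\<theta>' t * \<phi> z + \<theta> t * (D z \<bullet> velocity (f (max 0 t)) z)))" for t z
  have [measurable]: "(\<lambda>p. f (max 0 (fst p)) (snd p)) \<in> borel_measurable (borel \<Otimes>\<^sub>M borel)"
    using f_extend_measurable by (simp add: case_prod_beta')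
  have [measurable]: "(\<lambda>p. velocity (f (max 0 (fst p))) (snd p)) \<in> borel_measurable (borel \<Otimes>\<^sub>M borel)"
    using velocity_measurable[OF f_extend_measurable] by (simp add: case_prod_beta' borel_prod)
  have E_meas [measurable]: "(\<lambda>(t, z). E t z) \<in> borel_measurable (lborel \<Otimes>\<^sub>M lborel)"
    unfolding E_def case_prod_beta' by measurable
  have "(LINT (t, z):half_space|lborel. f t z * (D' (t, z) \<bullet> (1, V_field (f t) z, A_field (f t) z))) = (\<integral>(t, z). E t z \<partial>(lborel \<Otimes>\<^sub>M lborel))"
    unfolding set_lebesgue_integral_def lborel_prod
  proof (rule Bochner_Integration.integral_cong[OF refl])
    fix p :: "real \<times> phase"
    obtain t z where p: "p = (t, z)" by (meson surj_pair)
    show "indicator half_space p *\<^sub>R (case p of (t, z) \<Rightarrow> f t z * (D' (t, z) \<bullet> (1, V_field (f t) z, A_field (f t) z)))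
      = (case p of (t, z) \<Rightarrow> E t z)"
      by (cases "0 \<le> t") (auto simp: p E_def D'_def velocity_def inner_prod_def algebra_simps)
  qed
  also have "\<dots> = (\<integral>t. (\<integral>z. E t z \<partial>lborel) \<partial>lborel)"
  proof -
    \<comment> \<open>At almost every nonnegative time \<open>f t\<close> agrees with
      \<open>dens t\<close>, of mass at most 1, so the phase integral is controlled by the supremum
      of the integrand. At negative times the indicator vanishes, after \<open>a\<close> both time
      factors do.\<close>
    have inner_AE: "AE t in lborel. integrable lborel (E t) \<and> (\<integral>z. \<bar>E t z\<bar> \<partial>lborel) \<le> indicator {0..a} t * (c * M + c * L * rate t)"
      using good_times_AE
    proof eventually_elim
      case (elim t)
      show ?case
      proof (cases "t \<in> {0..a}")
        case True
        then have t: "t \<in> good_times" "0 \<le> t" using elim by auto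
        define g where "g z = \<theta>' t * \<phi> z + \<theta> t * (D z \<bullet> vel t z)" for z
        have c0: "0 \<le> c" using order_trans[OF abs_ge_zero \<theta>(5)[OF True]] .
        have [measurable]: "vel t \<in> borel_measurable borel"
          by (rule borel_measurable_continuous_onI[OF continuous_on_b])
        have [measurable]: "g \<in> borel_measurable borel" unfolding g_def[abs_def] by measurable
        have gb: "\<bar>g z\<bar> \<le> c * M + c * L * rate t" for z
        proof -
          have "\<bar>\<theta>' t * \<phi> z\<bar> \<le> c * M"
            unfolding abs_mult by (intro mult_mono \<theta>(6)[OF True] \<phi>(3) c0) auto
          moreover have "\<bar>\<theta> t * (D z \<bullet> vel t z)\<bar> \<le> c * (L * rate t)"
            unfolding abs_mult by (intro mult_mono \<theta>(5)[OF True] inner_vel_le[of D _ L, OF \<phi>(4)] c0) auto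
          ultimately show ?thesis unfolding g_def by (simp add: mult.assoc)
        qed
        have g0: "0 \<le> c * M + c * L * rate t" using c0 M L k_nonneg[of t] by simp
        have Eeq: "AE z in lborel. dens t z * g z = E t z"
        proof -
          have v: "velocity (f t) = vel t"
            unfolding vel_def using f_good(2)[OF t(1)] dens_eq_AE[OF t(1)] by (intro velocity_cong_AE) auto
          show ?thesis
            using dens_eq_AE[OF t(1)] by eventually_elim (use t v in \<open>simp add: E_def g_def\<close>)
        qed
        have Em: "E t \<in> borel_measurable lborel" using measurable_Pair2[OF E_meas, of t] by simp
        note b = dens_mult_bound[where t=t and g=g, OF _ gb g0]
        have "integrable lborel (E t)"
          by (rule integrable_cong_AE_imp[OF b(1) Em]) (use Eeq in \<open>auto intro: AE_mp\<close>)
        moreover have "(\<integral>z. \<bar>E t z\<bar> \<partial>lborel) = (\<integral>z. \<bar>dens t z * g z\<bar> \<partial>lborel)"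
          by (intro integral_cong_AE) (use Em Eeq in auto)
        ultimately show ?thesis using b(2) True by simp
      next
        case False
        then have "E t = (\<lambda>z. 0)" using \<theta>(3,4)[of t] by (auto simp: E_def fun_eq_iff indicator_def)
        then show ?thesis using False by simp
      qed
    qed
    have int: "integrable (lborel \<Otimes>\<^sub>M lborel) (\<lambda>(t, z). E t z)"
    proof (rule lborel_pair.Fubini_integrable[OF E_meas])
      have "integrable lborel (\<lambda>t. indicator {0..a} t *\<^sub>R (c * M + c * L * rate t))"
        using k_set_integrable[of 0 a] unfolding set_integrable_def[symmetric]
        by (intro set_integral_add set_integrable_mult_right set_integrable_const_Icc)
      then show "integrable lborel (\<lambda>t. \<integral>z. norm (case (t, z) of (t, z) \<Rightarrow> E t z) \<partial>lborel)"
      proof (rule Bochner_Integration.integrable_bound)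
        show "AE t in lborel. norm (\<integral>z. norm (case (t, z) of (t, z) \<Rightarrow> E t z) \<partial>lborel)
          \<le> norm (indicator {0..a} t *\<^sub>R (c * M + c * L * rate t))"
          using inner_AE
        proof eventually_elim
          case (elim t)
          then have "(\<integral>z. \<bar>E t z\<bar> \<partial>lborel) \<le> \<bar>indicator {0..a} t * (c * M + c * L * rate t)\<bar>" by linarith
          then show ?case by simp
        qed
      qed measurable
    qed (use inner_AE in auto)
    show ?thesis using lborel_pair.integral_fst'[OF int] by simp
  qed
  also have "\<dots> = (\<integral>t. indicator {0..} t * (\<theta>' t * mean \<phi> t + \<theta> t * flux D t) \<partial>lborel)"
  proof (rule integral_cong_AE)
    have [measurable]: "mean \<phi> \<in> borel_measurable borel" "flux D \<in> borel_measurable borel"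
      by (intro mean_measurable flux_measurable; measurable)+
    show "(\<lambda>t. indicator {0..} t * (\<theta>' t * mean \<phi> t + \<theta> t * flux D t)) \<in> borel_measurable lborel" by measurable
    show "AE t in lborel. (\<integral>z. E t z \<partial>lborel) = indicator {0..} t * (\<theta>' t * mean \<phi> t + \<theta> t * flux D t)"
      using good_times_AE
    proof eventually_elim
      case (elim t)
      show ?case
      proof (cases "0 \<le> t")
        case True
        then have t: "t \<in> good_times" using elim by auto
        have vt: "velocity (f t) = vel t"
          unfolding vel_def using f_good(2)[OF t(1)] dens_eq_AE[OF t(1)] by (intro velocity_cong_AE) auto
        have [measurable]: "vel t \<in> borel_measurable borel"
          by (rule borel_measurable_continuous_onI[OF continuous_on_b])
        have Em: "E t \<in> borel_measurable lborel" using measurable_Pair2[OF E_meas, of t] by simp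
        have "(\<integral>z. E t z \<partial>lborel) = (\<integral>z. \<theta>' t * (dens t z * \<phi> z) + \<theta> t * (dens t z * (D z \<bullet> vel t z)) \<partial>lborel)"
        proof (rule integral_cong_AE[OF Em])
          show "AE z in lborel. E t z = \<theta>' t * (dens t z * \<phi> z) + \<theta> t * (dens t z * (D z \<bullet> vel t z))"
            using dens_eq_AE[OF t] by eventually_elim (use True vt in \<open>simp add: E_def algebra_simps\<close>)
        qed measurable
        also have "\<dots> = \<theta>' t * mean \<phi> t + \<theta> t * flux D t"
        proof -
          have "integrable lborel (\<lambda>z. dens t z * \<phi> z)" by (rule dens_mult_bound(1)[OF _ \<phi>(3) M]) measurable
          moreover have "integrable lborel (\<lambda>z. dens t z * (D z \<bullet> vel t z))"
            by (rule dens_mult_bound(1)[OF _ inner_vel_le[of D _ L, OF \<phi>(4)]]) (use L k_nonneg in auto)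
          ultimately show ?thesis by (simp add: mean_def flux_def)
        qed
        finally show ?thesis using True by simp
      qed (simp add: E_def)
    qed
  qed measurable
  finally show ?thesis using weq by (simp add: \<psi>_def)
qed

text \<open>The time factor \<open>max 0 (a - t)\<close> determines the integral of
  \<open>mean \<phi>\<close> over \<open>{0..a}\<close> for every \<open>a\<close>. After an
  exchange of integrals this is the integral of the claimed value over the same interval, and
  functions with equal integrals over all \<open>{0..a}\<close> agree almost everywhere.\<close>

lemma mean_AE:
  assumes \<phi>: "C11_bound \<phi> D A" "\<And>z. R < norm z \<Longrightarrow> \<phi> z = 0" "\<And>z. \<bar>\<phi> z\<bar> \<le> M" "\<And>z. norm (D z) \<le> L"
  shows "AE t in lborel. 0 \<le> t \<longrightarrow> mean \<phi> t = (\<integral>z. \<phi> z \<partial>f0) + integral {0..t} (flux D)"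
proof -
  define c where "c = (\<integral>z. \<phi> z \<partial>f0)"
  have \<phi>_cont: "continuous_on UNIV \<phi>"
    using C11_bound_has_derivative[OF \<phi>(1)] by (meson continuous_at_imp_continuous_on has_derivative_continuous)
  have [measurable]: "\<phi> \<in> borel_measurable borel" "D \<in> borel_measurable borel"
    by (intro borel_measurable_continuous_onI C11_bound_grad_continuous[OF \<phi>(1)] \<phi>_cont)+
  have [measurable]: "mean \<phi> \<in> borel_measurable borel" "flux D \<in> borel_measurable borel"
    by (intro mean_measurable flux_measurable; measurable)+
  have M: "0 \<le> M" and L: "0 \<le> L" using order_trans[OF abs_ge_zero \<phi>(3)] order_trans[OF norm_ge_zero \<phi>(4)] by auto
  have mean_le: "\<bar>mean \<phi> t\<bar> \<le> M" for t
    unfolding mean_def by (rule dens_mult_bound(3)[OF _ \<phi>(3) M]) measurable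
  have flux_le: "\<bar>flux D t\<bar> \<le> L * rate t" and flux_int: "flux D integrable_on {r..s}"
    and flux_sint: "set_integrable lborel {r..s} (flux D)" for t r s
    by (rule flux_bound[of D L]; use \<phi>(4) in simp)+
  have prim_cont: "continuous_on UNIV (\<lambda>t. integral {0..t} (flux D))"
    by (rule continuous_on_primitive[OF flux_int])
  have [measurable]: "(\<lambda>t. integral {0..t} (flux D)) \<in> borel_measurable borel"
    by (rule borel_measurable_continuous_onI[OF prim_cont])
  have mean_sint: "set_integrable lborel {0..a} (mean \<phi>)" for a
    unfolding set_integrable_def
  proof (rule Bochner_Integration.integrable_bound)
    show "integrable lborel (\<lambda>t. M * indicator {0..a} t)"
      by (intro integrable_mult_right integrable_real_indicator) (auto simp: emeasure_lborel_Icc_eq)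
    show "AE t in lborel. norm (indicator {0..a} t *\<^sub>R mean \<phi> t) \<le> norm (M * indicator {0..a} t)"
      using order_trans[OF mean_le abs_ge_self] by (auto simp: indicator_def)
  qed measurable
  have prim_sint: "set_integrable lborel {0..a} (\<lambda>t. integral {0..t} (flux D))" for a
    unfolding set_integrable_def
    by (rule borel_integrable_compact) (auto intro: continuous_on_subset[OF prim_cont])
  define q where "q t = (c + integral {0..t} (flux D)) - mean \<phi> t" for t
  have q_sint: "set_integrable lborel {0..a} q" for a
  proof -
    have "set_integrable lborel {0..a} (\<lambda>_. c)" by (rule set_integrable_const_Icc)
    then show ?thesis unfolding q_def[abs_def]
      by (intro set_integral_diff set_integral_add prim_sint mean_sint)
  qed
  have sint: "set_integrable lborel {0..a} (\<lambda>t. (a - t) * flux D t)" for a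
  proof (rule integrable_on_bounded_by(2)[where c="a * L"])
    fix r assume "r \<in> {0..a}"
    then have "\<bar>a - r\<bar> * \<bar>flux D r\<bar> \<le> a * (L * rate r)" by (intro mult_mono flux_le) auto
    then show "norm ((a - r) * flux D r) \<le> a * L * rate r" by (simp add: abs_mult mult.assoc)
  qed measurable
  have key: "(\<integral>t. indicator {0..a} t * (- mean \<phi> t + (a - t) * flux D t) \<partial>lborel) = - a * c" if a: "0 \<le> a" for a
  proof -
    have lim: "(\<lambda>n. \<integral>t. indicator {0..} t * (cutoff' a n t * mean \<phi> t + cutoff a n t * flux D t) \<partial>lborel)
      \<longlonglongrightarrow> (\<integral>t. indicator {0..a} t * (- mean \<phi> t + (a - t) * flux D t) \<partial>lborel)"
    proof (rule integral_dominated_convergence[where w="\<lambda>t. indicator {0..a} t *\<^sub>R (M + (a + 1) * L * rate t)"])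
      have [measurable]: "cutoff a n \<in> borel_measurable borel" "cutoff' a n \<in> borel_measurable borel" for n
        by (intro borel_measurable_continuous_onI cutoff_continuous)+
      show "(\<lambda>t. indicator {0..} t * (cutoff' a n t * mean \<phi> t + cutoff a n t * flux D t)) \<in> borel_measurable lborel" for n
        by measurable
      show "integrable lborel (\<lambda>t. indicator {0..a} t *\<^sub>R (M + (a + 1) * L * rate t))"
        using k_set_integrable[of 0 a] unfolding set_integrable_def[symmetric]
        by (intro set_integral_add set_integrable_mult_right set_integrable_const_Icc)
      \<comment> \<open>At \<open>t = a\<close> the derivative \<open>cutoff'\<close> is 0 for every
        \<open>n\<close> and does not tend to -1, so this point is removed.\<close>
      show "AE t in lborel. (\<lambda>n. indicator {0..} t * (cutoff' a n t * mean \<phi> t + cutoff a n t * flux D t))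
        \<longlonglongrightarrow> indicator {0..a} t * (- mean \<phi> t + (a - t) * flux D t)"
        using AE_lborel_singleton[of a]
      proof eventually_elim
        case (elim t)
        consider "t < 0" | "0 \<le> t" "t < a" | "0 \<le> t" "a < t" using elim by linarith
        then show ?case
        proof cases
          case 2
          have "(\<lambda>n. cutoff' a n t * mean \<phi> t + cutoff a n t * flux D t) \<longlonglongrightarrow> -1 * mean \<phi> t + max 0 (a - t) * flux D t"
            by (intro tendsto_intros cutoff'_tendsto cutoff_tendsto 2)
          then show ?thesis using 2 by simp
        next
          case 3
          then show ?thesis using cutoff_zero[of a t] by simp
        qed simp
      qed
      show "AE t in lborel. norm (indicator {0..} t * (cutoff' a n t * mean \<phi> t + cutoff a n t * flux D t))
        \<le> indicator {0..a} t *\<^sub>R (M + (a + 1) * L * rate t)" for n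
      proof (rule AE_I2)
        fix t :: real
        consider "t < 0" | "0 \<le> t" "t \<le> a" | "0 \<le> t" "a < t" by linarith
        then show "norm (indicator {0..} t * (cutoff' a n t * mean \<phi> t + cutoff a n t * flux D t))
          \<le> indicator {0..a} t *\<^sub>R (M + (a + 1) * L * rate t)"
        proof cases
          case 2
          have "1 / real (Suc n) \<le> 1" by simp
          then have "\<bar>cutoff a n t\<bar> \<le> a + 1" using cutoff_close[of a n t] 2 by linarith
          then have "\<bar>cutoff a n t * flux D t\<bar> \<le> (a + 1) * (L * rate t)"
            unfolding abs_mult using a by (intro mult_mono flux_le) auto
          moreover have "\<bar>cutoff' a n t * mean \<phi> t\<bar> \<le> 1 * M"
            unfolding abs_mult by (intro mult_mono cutoff'_bound mean_le) auto
          ultimately show ?thesis using 2 by (simp add: mult.assoc)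
        next
          case 3
          then show ?thesis using cutoff_zero[of a t n] by simp
        qed simp
      qed
    qed measurable
    have "(\<integral>t. indicator {0..} t * (cutoff' a n t * mean \<phi> t + cutoff a n t * flux D t) \<partial>lborel) = - cutoff a n 0 * c" for n
      unfolding c_def
    proof (rule weak_formulation_tensor[OF \<phi> cutoff_derivative cutoff_continuous(2)])
      show "a \<le> t \<Longrightarrow> cutoff a n t = 0" "a \<le> t \<Longrightarrow> cutoff' a n t = 0" for t by (auto simp: cutoff_zero)
      fix t assume t: "t \<in> {0..a}"
      have "1 / real (Suc n) \<le> 1" "0 \<le> t" "t \<le> a" using t by auto
      then show "\<bar>cutoff a n t\<bar> \<le> a + 1" using cutoff_close[of a n t] by linarith
      show "\<bar>cutoff' a n t\<bar> \<le> a + 1" using cutoff'_bound[of a n t] a by linarith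
    qed
    moreover have "(\<lambda>n. - cutoff a n 0 * c) \<longlonglongrightarrow> - max 0 (a - 0) * c"
      by (intro tendsto_intros cutoff_tendsto)
    ultimately show ?thesis using lim a LIMSEQ_unique by fastforce
  qed
  \<comment> \<open>Cauchy's formula for a repeated integral: \<open>flux D r\<close> is counted
    once for each \<open>t\<close> from \<open>r\<close> to \<open>a\<close>. Lebesgue measure on
    \<open>{0..a}\<close>, called \<open>N\<close>, acts as the finite measure of
    \<open>integral_swap\<close>.\<close>
  have swap: "(LINT t:{0..a}|lborel. integral {0..t} (flux D)) = (LINT t:{0..a}|lborel. (a - t) * flux D t)" if a: "0 \<le> a" for a
  proof -
    define N where "N = density lborel (indicator {0..a} :: real \<Rightarrow> ennreal)"
    have N: "finite_measure N"
      by (rule finite_measureI) (simp add: N_def emeasure_density emeasure_lborel_Icc_eq)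
    have sets_N [measurable_cong]: "sets N = sets borel" by (simp add: N_def)
    have intN: "(\<integral>z. h z \<partial>N) = (LINT z:{0..a}|lborel. h z)" if [measurable]: "h \<in> borel_measurable borel" for h :: "real \<Rightarrow> real"
    proof -
      have "N = density lborel (\<lambda>z. ennreal (indicator {0..a} z))"
        unfolding N_def by (intro arg_cong2[where f=density] refl ext) (auto simp: indicator_def)
      then show ?thesis by (simp add: integral_density set_lebesgue_integral_def)
    qed
    define g where "g z r = (if r \<in> {0..z} then flux D r else 0)" for z r :: real
    have gm: "(\<lambda>(z, r). g z r) \<in> borel_measurable (N \<Otimes>\<^sub>M borel)"
    proof -
      have "(\<lambda>(z, r). g z r) = (\<lambda>p. if 0 \<le> snd p \<and> snd p \<le> fst p then flux D (snd p) else 0)"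
        by (auto simp: g_def fun_eq_iff)
      then show ?thesis by simp
    qed
    have gb: "\<bar>g z r\<bar> \<le> L * rate r" for z r
      using flux_le[of r] L k_nonneg[of r] by (auto simp: g_def)
    note sw = integral_swap(3)[OF N gm gb, of 0 a]
    have gz: "integral {0..a} (g z) = integral {0..z} (flux D)" if "z \<in> {0..a}" for z
    proof -
      have "{0..z} \<subseteq> {0..a}" using that by auto
      from has_integral_restrict[OF this] show ?thesis
        unfolding g_def using integrable_integral[OF flux_int] by (intro integral_unique) blast
    qed
    have gr: "(\<integral>z. g z r \<partial>N) = (a - r) * flux D r" if r: "r \<in> {0..a}" for r
    proof -
      have "(\<integral>z. g z r \<partial>N) = (LINT z:{0..a}|lborel. g z r)"
        by (rule intN) (auto simp: g_def)
      also have "\<dots> = (\<integral>z. flux D r * indicator {r..a} z \<partial>lborel)"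
        unfolding set_lebesgue_integral_def
        by (intro Bochner_Integration.integral_cong refl) (use r in \<open>auto simp: g_def indicator_def\<close>)
      also have "\<dots> = (a - r) * flux D r" using r by simp
      finally show ?thesis .
    qed
    have "(LINT t:{0..a}|lborel. integral {0..t} (flux D)) = (\<integral>z. integral {0..z} (flux D) \<partial>N)"
      by (rule intN[symmetric]) measurable
    also have "\<dots> = (\<integral>z. integral {0..a} (g z) \<partial>N)"
    proof (rule integral_cong_AE)
      show "(\<lambda>z. integral {0..a} (g z)) \<in> borel_measurable N"
        using integral_swap(2)[OF N gm gb, of 0 a] by (rule borel_measurable_integrable)
      show "AE z in N. integral {0..z} (flux D) = integral {0..a} (g z)"
        unfolding N_def by (subst AE_density) (use gz in \<open>auto intro!: AE_I2 simp: indicator_def\<close>)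
    qed measurable
    also have "\<dots> = integral {0..a} (\<lambda>r. (a - r) * flux D r)"
      unfolding sw by (intro Henstock_Kurzweil_Integration.integral_cong gr)
    also have "\<dots> = (LINT t:{0..a}|lborel. (a - t) * flux D t)"
      by (rule set_borel_integral_eq_integral(2)[OF sint, symmetric])
    finally show ?thesis .
  qed
  have "AE t in lborel. 0 \<le> t \<longrightarrow> q t = 0"
  proof (rule AE_zero_of_integrals_zero[OF q_sint])
    fix a :: real assume a: "0 \<le> a"
    have "(\<integral>t. indicator {0..a} t * (- mean \<phi> t + (a - t) * flux D t) \<partial>lborel)
      = (LINT t:{0..a}|lborel. (a - t) * flux D t - mean \<phi> t)"
      unfolding set_lebesgue_integral_def by (intro Bochner_Integration.integral_cong) auto
    also have "\<dots> = (LINT t:{0..a}|lborel. (a - t) * flux D t) - (LINT t:{0..a}|lborel. mean \<phi> t)"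
      by (rule set_integral_diff(2)[OF sint mean_sint])
    finally have 1: "(LINT t:{0..a}|lborel. (a - t) * flux D t) - (LINT t:{0..a}|lborel. mean \<phi> t) = - a * c"
      using key[OF a] by simp
    have ci: "set_integrable lborel {0..a} (\<lambda>_. c)" by (rule set_integrable_const_Icc)
    have "(LINT t:{0..a}|lborel. q t) = ((LINT t:{0..a}|lborel. c) + (LINT t:{0..a}|lborel. integral {0..t} (flux D)))
        - (LINT t:{0..a}|lborel. mean \<phi> t)"
      unfolding q_def
      by (subst set_integral_diff(2)[OF set_integral_add(1)[OF ci prim_sint] mean_sint], subst set_integral_add(2)[OF ci prim_sint]) simp
    also have "(LINT t:{0..a}|lborel. c) = a * c" using a by (simp add: set_lebesgue_integral_def)
    finally show "(LINT t:{0..a}|lborel. q t) = 0" using 1 swap[OF a] by simp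
  next
    show "q \<in> borel_measurable borel" unfolding q_def[abs_def] by measurable
  qed
  then show ?thesis by eventually_elim (auto simp: q_def c_def)
qed

end

section \<open>Common exceptional times and the law of the solution\<close>

context kinetic_solution
begin

abbreviation eps :: "nat \<Rightarrow> real" where "eps n \<equiv> inverse (real (Suc n))"

text \<open>The time-integrated equation for one mollified test function. As a predicate in
  \<open>T\<close> it can be intersected over countably many \<open>\<xi>\<close> and all
  \<open>n\<close>.\<close>

definition balance_at :: "(phase \<Rightarrow> real) \<Rightarrow> nat \<Rightarrow> real \<Rightarrow> bool" where
  "balance_at \<xi> n T \<longleftrightarrow>
    mean (mollify (eps n) \<xi>) T = (\<integral>z. mollify (eps n) \<xi> z \<partial>f0) + integral {0..T} (flux (mollify_grad (eps n) \<xi>))"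

lemma balance_at_AE:
  assumes \<xi>: "lip_compact L R \<xi>"
  shows "AE t in lborel. 0 \<le> t \<longrightarrow> balance_at \<xi> n t"
proof -
  have e: "0 < eps n" by simp
  note m = mollify_lip_compact[OF e \<xi>]
  show ?thesis
    unfolding balance_at_def
    by (rule mean_AE[OF mollify_C11[OF e \<xi>] lip_compactD(4)[OF m] lip_compact_bound[OF m] mollify_grad_le[OF e \<xi>]])
qed

lemma mollify_borel:
  assumes "lip_compact L R \<xi>"
  shows "mollify (eps n) \<xi> \<in> borel_measurable borel" "mollify_grad (eps n) \<xi> \<in> borel_measurable borel"
proof -
  have e: "0 < eps n" by simp
  show "mollify (eps n) \<xi> \<in> borel_measurable borel"
    by (rule lip_compact_measurable[OF mollify_lip_compact[OF e assms]])
  show "mollify_grad (eps n) \<xi> \<in> borel_measurable borel"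
    by (intro borel_measurable_continuous_onI C11_bound_grad_continuous[OF mollify_C11[OF e assms]])
qed

lemma flux_diff:
  assumes [measurable]: "D \<in> borel_measurable borel" "D' \<in> borel_measurable borel"
    and "\<And>z. norm (D z) \<le> L" "\<And>z. norm (D' z) \<le> L'"
  shows "flux D t - flux D' t = flux (\<lambda>z. D z - D' z) t"
proof -
  have [measurable]: "vel t \<in> borel_measurable borel"
    by (rule borel_measurable_continuous_onI[OF continuous_on_b])
  have int: "integrable lborel (\<lambda>z. dens t z * (X z \<bullet> vel t z))"
    if [measurable]: "X \<in> borel_measurable borel" and X: "\<And>z. norm (X z) \<le> l" for X l
  proof (rule dens_mult_bound(1))
    show "\<bar>X z \<bullet> vel t z\<bar> \<le> l * rate t" for z by (rule inner_vel_le[of X _ l, OF X])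
    show "0 \<le> l * rate t" using order_trans[OF norm_ge_zero X] k_nonneg by simp
  qed measurable
  show ?thesis unfolding flux_def
    using int[OF assms(1,3)] int[OF assms(2,4)] by (simp add: inner_diff_left right_diff_distrib)
qed

text \<open>At fixed \<open>n\<close> both sides are continuous in \<open>\<xi>\<close> for uniform
  convergence: the means because the masses are 1, the flux through the L^1 norm \<open>G\<close> of
  the mollifier gradient.\<close>

lemma balance_at_dense:
  assumes \<D>: "\<And>d. d \<in> \<D> \<Longrightarrow> \<exists>L R. lip_compact L R d"
      "\<And>\<xi> l R \<eta>. lip_compact l R \<xi> \<Longrightarrow> 0 < \<eta> \<Longrightarrow> \<exists>d\<in>\<D>. \<forall>z. \<bar>\<xi> z - d z\<bar> \<le> \<eta>"
    and T: "T \<in> good_times" "\<And>d. d \<in> \<D> \<Longrightarrow> balance_at d n T"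
    and \<xi>: "lip_compact L R \<xi>"
  shows "balance_at \<xi> n T"
proof -
  have e: "0 < eps n" by simp
  interpret F0: prob_space f0 by (rule f0_prob)
  interpret FT: prob_space "measure_of_density (dens T)" by (rule dens_prob[OF T(1)])
  define G where "G = (\<integral>y. norm (mollifier_grad (eps n) (y::phase)) \<partial>lborel)"
  define err where "err = \<bar>mean (mollify (eps n) \<xi>) T - ((\<integral>z. mollify (eps n) \<xi> z \<partial>f0) + integral {0..T} (flux (mollify_grad (eps n) \<xi>)))\<bar>"
  have "err \<le> \<eta> * (2 + G * K 0 T)" if \<eta>: "0 < \<eta>" for \<eta>
  proof -
    obtain d where d: "d \<in> \<D>" "\<And>z. \<bar>\<xi> z - d z\<bar> \<le> \<eta>" using \<D>(2)[OF \<xi> \<eta>] by blast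
    obtain l r where dlc: "lip_compact l r d" using \<D>(1)[OF d(1)] by blast
    note m = mollify_lip_compact[OF e \<xi>] and md = mollify_lip_compact[OF e dlc]
    note gle = mollify_grad_le[OF e \<xi>] and gled = mollify_grad_le[OF e dlc]
    note bm = mollify_borel[OF \<xi>, of n] mollify_borel[OF dlc, of n]
    have close: "\<bar>mollify (eps n) \<xi> z - mollify (eps n) d z\<bar> \<le> \<eta>" for z
      by (rule mollify_diff_le[OF e lip_compact_continuous[OF \<xi>] lip_compact_continuous[OF dlc] d(2)])
    have 1: "\<bar>mean (mollify (eps n) \<xi>) T - mean (mollify (eps n) d) T\<bar> \<le> \<eta>"
      unfolding mean_def integral_dens[symmetric, OF bm(1)] integral_dens[symmetric, OF bm(3)]
      by (intro FT.integral_diff_le prob_integrable_lip_compact[OF FT.prob_space_axioms _ m]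
          prob_integrable_lip_compact[OF FT.prob_space_axioms _ md] close) auto
    have 2: "\<bar>(\<integral>z. mollify (eps n) \<xi> z \<partial>f0) - (\<integral>z. mollify (eps n) d z \<partial>f0)\<bar> \<le> \<eta>"
      by (intro F0.integral_diff_le prob_integrable_lip_compact[OF F0.prob_space_axioms f0_sets m]
          prob_integrable_lip_compact[OF F0.prob_space_axioms f0_sets md] close)
    note fi = flux_bound(2)[OF bm(2) gle] and fid = flux_bound(2)[OF bm(4) gled]
    have "norm (integral {0..T} (\<lambda>t. flux (mollify_grad (eps n) \<xi>) t - flux (mollify_grad (eps n) d) t)) \<le> (\<eta> * G) * K 0 T"
    proof (rule norm_integral_le_K[OF Henstock_Kurzweil_Integration.integrable_diff[OF fi fid]])
      fix t
      show "norm (flux (mollify_grad (eps n) \<xi>) t - flux (mollify_grad (eps n) d) t) \<le> \<eta> * G * rate t"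
        unfolding flux_diff[OF bm(2) bm(4) gle gled] real_norm_def G_def
        by (rule flux_bound(1)) (use bm mollify_grad_diff_le[OF e \<xi> dlc d(2)] in auto)
    qed
    then have 3: "\<bar>integral {0..T} (flux (mollify_grad (eps n) \<xi>)) - integral {0..T} (flux (mollify_grad (eps n) d))\<bar> \<le> (\<eta> * G) * K 0 T"
      using Henstock_Kurzweil_Integration.integral_diff[OF fi fid, of 0 T] by simp
    have "err \<le> \<eta> + \<eta> + (\<eta> * G) * K 0 T"
      using 1 2 3 T(2)[OF d(1)] unfolding err_def balance_at_def by linarith
    then show ?thesis by (simp add: algebra_simps)
  qed
  then have "eventually (\<lambda>\<eta>. err \<le> \<eta> * (2 + G * K 0 T)) (at_right 0)"
    by (subst eventually_at_right[of 0 1]) (auto intro!: exI[of _ 1])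
  moreover have "((\<lambda>\<eta>. \<eta> * (2 + G * K 0 T)) \<longlongrightarrow> 0 * (2 + G * K 0 T)) (at_right 0)"
    by (intro tendsto_intros)
  ultimately have "err \<le> 0" using tendsto_lowerbound by fastforce
  then show ?thesis by (simp add: err_def balance_at_def)
qed

text \<open>Time 0 is left out because nothing relates \<open>dens 0\<close> to \<open>f0\<close>;
  the datum enters only through the balance.\<close>

lemma balance_times_exist:
  "\<exists>G. G \<subseteq> good_times \<inter> {0<..} \<and> (AE t in lborel. 0 \<le> t \<longrightarrow> t \<in> G) \<and>
    (\<forall>T\<in>G. \<forall>n L R \<xi>. lip_compact L R \<xi> \<longrightarrow> balance_at \<xi> n T)"
proof -
  obtain \<D> :: "(phase \<Rightarrow> real) set" where \<D>: "countable \<D>" "\<And>d. d \<in> \<D> \<Longrightarrow> \<exists>L R. lip_compact L R d"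
    "\<And>\<xi> l R \<eta>. lip_compact l R \<xi> \<Longrightarrow> 0 < \<eta> \<Longrightarrow> \<exists>d\<in>\<D>. \<forall>z. \<bar>\<xi> z - d z\<bar> \<le> \<eta>"
    using countable_test_functions[where 'a=phase] by metis
  define G where "G = {T \<in> good_times. 0 < T \<and> (\<forall>n. \<forall>d\<in>\<D>. balance_at d n T)}"
  have bal: "AE t in lborel. \<forall>n. \<forall>d\<in>\<D>. 0 \<le> t \<longrightarrow> balance_at d n t"
    unfolding AE_all_countable AE_ball_countable[OF \<D>(1)]
    using \<D>(2) balance_at_AE by blast
  have "AE t in lborel. 0 \<le> t \<longrightarrow> t \<in> G"
    using bal good_times_AE AE_lborel_singleton[of 0]
    by eventually_elim (auto simp: G_def)
  moreover have "balance_at \<xi> n T" if TG: "T \<in> G" and \<xi>: "lip_compact L R \<xi>" for T n L R \<xi>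
    by (rule balance_at_dense[OF \<D>(2,3) _ _ \<xi>]) (use TG in \<open>auto simp: G_def\<close>)
  moreover have "G \<subseteq> good_times \<inter> {0<..}" by (auto simp: G_def)
  ultimately show ?thesis by blast
qed

definition law :: "real \<Rightarrow> phase measure" where
  "law t = distr f0 borel (\<lambda>z. flow 0 z t)"

lemma flow_borel: "0 \<le> t \<Longrightarrow> (\<lambda>z. flow 0 z t) \<in> borel_measurable borel"
  by (intro borel_measurable_continuous_onI flow_continuous_start)

lemma law_prob:
  assumes "0 \<le> t"
  shows "prob_space (law t)" "sets (law t) = sets borel"
proof -
  have "(\<lambda>z. flow 0 z t) \<in> f0 \<rightarrow>\<^sub>M borel"
    using flow_borel[OF assms] measurable_cong_sets[OF f0_sets refl] by blast
  then show "prob_space (law t)" unfolding law_def by (rule prob_space.prob_space_distr[OF f0_prob])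
qed (simp add: law_def)

text \<open>Subtracting two balances gives the weak identity between any two admissible times;
  \<open>transport_unique\<close> on \<open>{0..T}\<close> then equates the density at each
  \<open>T\<close> in \<open>G\<close> with the transported datum.\<close>

lemma law_eq_density: "AE t in lborel. 0 \<le> t \<longrightarrow> t \<in> good_times \<and> law t = measure_of_density (dens t)"
proof -
  obtain G where G: "G \<subseteq> good_times \<inter> {0<..}" "AE t in lborel. 0 \<le> t \<longrightarrow> t \<in> G"
    "\<And>T n L R \<xi>. T \<in> G \<Longrightarrow> lip_compact L R \<xi> \<Longrightarrow> balance_at \<xi> n T"
    using balance_times_exist by blast
  \<comment> \<open>The curve must start from \<open>f0\<close>, so the density at time 0 is
    overridden.\<close>
  define \<mu> where "\<mu> t = (if t = 0 then f0 else measure_of_density (dens t))" for t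
  have "law T = measure_of_density (dens T)" if TG: "T \<in> G" for T
  proof -
    have T: "T \<in> good_times" "0 < T" using TG G(1) by auto
    have \<mu>_prob: "prob_space (\<mu> t)" if "t \<in> insert 0 G" for t
      using that G(1) dens_prob[of t] f0_prob by (auto simp: \<mu>_def)
    have \<mu>_sets: "sets (\<mu> t) = sets borel" for t by (simp add: \<mu>_def f0_sets)
    have weak_n: "((\<lambda>r. \<integral>z. mollify_grad (eps n) \<xi> z \<bullet> vel r z \<partial>\<mu> r) has_integral
        ((\<integral>z. mollify (eps n) \<xi> z \<partial>\<mu> t) - (\<integral>z. mollify (eps n) \<xi> z \<partial>\<mu> s))) {s..t}"
      if \<xi>: "lip_compact L R \<xi>" and st: "s \<in> insert 0 G" "t \<in> insert 0 G" "0 \<le> s" "s \<le> t" for n L R \<xi> s t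
    proof -
      let ?D = "mollify_grad (eps n) \<xi>"
      note bm = mollify_borel[OF \<xi>, of n]
      have e: "0 < eps n" by simp
      note fi = flux_bound(2)[OF bm(2) mollify_grad_le[OF e \<xi>]]
      have val: "(\<integral>z. mollify (eps n) \<xi> z \<partial>\<mu> r) = (\<integral>z. mollify (eps n) \<xi> z \<partial>f0) + integral {0..r} (flux ?D)"
        if r: "r \<in> insert 0 G" for r
      proof (cases "r = 0")
        case False
        then have "balance_at \<xi> n r" using r G(3) \<xi> by auto
        then show ?thesis using False integral_dens[OF bm(1), of r] by (simp add: \<mu>_def balance_at_def mean_def)
      qed (simp add: \<mu>_def)
      have "integral {0..s} (flux ?D) + integral {s..t} (flux ?D) = integral {0..t} (flux ?D)"
        by (rule Henstock_Kurzweil_Integration.integral_combine[OF st(3,4) fi])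
      then have "(\<integral>z. mollify (eps n) \<xi> z \<partial>\<mu> t) - (\<integral>z. mollify (eps n) \<xi> z \<partial>\<mu> s) = integral {s..t} (flux ?D)"
        unfolding val[OF st(1)] val[OF st(2)] by linarith
      then have "(flux ?D has_integral ((\<integral>z. mollify (eps n) \<xi> z \<partial>\<mu> t) - (\<integral>z. mollify (eps n) \<xi> z \<partial>\<mu> s))) {s..t}"
        using integrable_integral[OF fi, of s t] by simp
      \<comment> \<open>Overriding time 0 changes the integrand at a single point, which the
        integral does not see.\<close>
      then show ?thesis
      proof (rule has_integral_spike[where S="{0}", rotated 2])
        fix r assume "r \<in> {s..t} - {0}"
        have [measurable]: "vel r \<in> borel_measurable borel" "?D \<in> borel_measurable borel"
          using bm(2) by (auto intro: borel_measurable_continuous_onI continuous_on_b)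
        show "(\<integral>z. ?D z \<bullet> vel r z \<partial>\<mu> r) = flux ?D r"
        proof -
          have "(\<lambda>z. ?D z \<bullet> vel r z) \<in> borel_measurable borel" by measurable
          from integral_dens[OF this, of r] show ?thesis
            using \<open>r \<in> {s..t} - {0}\<close> by (simp add: \<mu>_def flux_def)
        qed
      qed simp
    qed
    have "(\<integral>z. \<phi> z \<partial>law T) = (\<integral>z. \<phi> z \<partial>measure_of_density (dens T))" if \<phi>: "lip_compact L R \<phi>" for \<phi> L R
    proof -
      have "(\<integral>z. \<phi> z \<partial>\<mu> T) = (\<integral>z. \<phi> (flow 0 z T) \<partial>\<mu> 0)"
      proof (rule transport_unique[where G="insert 0 G" and e=eps and \<mu>=\<mu>, OF \<mu>_prob \<mu>_sets])
        show "AE t in lborel. 0 \<le> t \<and> t \<le> T \<longrightarrow> t \<in> insert 0 G" using G(2) by eventually_elim auto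
        show "eps \<longlonglongrightarrow> 0" by (rule LIMSEQ_inverse_real_of_nat)
      qed (use TG T weak_n \<phi> in auto)
      moreover have "(\<integral>z. \<phi> z \<partial>law T) = (\<integral>z. \<phi> (flow 0 z T) \<partial>f0)"
        unfolding law_def using T flow_borel[of T] lip_compact_measurable[OF \<phi>]
        by (intro integral_distr) (auto simp: measurable_cong_sets[OF f0_sets refl])
      ultimately show ?thesis using T by (simp add: \<mu>_def)
    qed
    then show ?thesis
      using T law_prob[of T] dens_prob[of T] by (intro measure_eqI_lip_compact) auto
  qed
  then show ?thesis using G(2) by (rule_tac AE_mp[OF G(2)], intro AE_I2) (use G(1) in auto)
qed

text \<open>Weak continuity follows from continuity of trajectories by dominated convergence. As the
  representative is unique, the value of the solution at every time, not just almost every time, is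
  the transported datum.\<close>

lemma law_weak_representative: "weak_representative f f0 law"
  unfolding weak_representative_def
proof (intro conjI allI impI)
  show "law t \<in> Prob" if "0 \<le> t" for t using law_prob[OF that] by (simp add: Prob_def)
  show "law 0 = f0" unfolding law_def by (simp add: distr_id2 f0_sets)
  show "AE t in lborel. 0 \<le> t \<longrightarrow> law t = measure_of_density (f t)"
    using law_eq_density by eventually_elim (auto simp: measure_of_density_dens)
  show "weakly_continuous law"
    unfolding weakly_continuous_def
  proof (intro allI impI, elim conjE)
    fix \<phi> :: "phase \<Rightarrow> real" assume \<phi>: "continuous_on UNIV \<phi>" "bounded (range \<phi>)"
    interpret F0: prob_space f0 by (rule f0_prob)
    have [measurable]: "\<phi> \<in> borel_measurable borel" by (rule borel_measurable_continuous_onI[OF \<phi>(1)])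
    note [measurable_cong] = f0_sets
    have [measurable]: "(\<lambda>z. flow 0 z t) \<in> borel_measurable borel" if "0 \<le> t" for t by (rule flow_borel[OF that])
    obtain B where B: "\<And>z. \<bar>\<phi> z\<bar> \<le> B" using \<phi>(2) by (auto simp: bounded_iff)
    have law_int: "(\<integral>z. \<phi> z \<partial>law t) = (\<integral>z. \<phi> (flow 0 z t) \<partial>f0)" if "0 \<le> t" for t
      unfolding law_def using flow_borel[OF that]
      by (intro integral_distr) (auto simp: measurable_cong_sets[OF f0_sets refl])
    show "continuous_on {0..} (\<lambda>t. \<integral>z. \<phi> z \<partial>law t)"
      unfolding continuous_on_sequentially
    proof (intro allI ballI impI, elim conjE)
      fix x :: "nat \<Rightarrow> real" and a assume a: "a \<in> {0..}" and x: "\<forall>n. x n \<in> {0..}" "x \<longlonglongrightarrow> a"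
      have "(\<lambda>n. \<integral>z. \<phi> (flow 0 z (x n)) \<partial>f0) \<longlonglongrightarrow> (\<integral>z. \<phi> (flow 0 z a) \<partial>f0)"
      proof (rule integral_dominated_convergence[where w="\<lambda>_. B"])
        show "AE z in f0. (\<lambda>n. \<phi> (flow 0 z (x n))) \<longlonglongrightarrow> \<phi> (flow 0 z a)"
        proof (rule AE_I2)
          fix z
          have "(\<lambda>n. flow 0 z (x n)) \<longlonglongrightarrow> flow 0 z a"
            by (rule continuous_on_tendsto_compose[OF flow_continuous x(2)]) auto
          then show "(\<lambda>n. \<phi> (flow 0 z (x n))) \<longlonglongrightarrow> \<phi> (flow 0 z a)"
            by (rule continuous_on_tendsto_compose[OF \<phi>(1)]) auto
        qed
      qed (use a x B in \<open>auto intro!: measurable_compose[OF flow_borel] simp: measurable_cong_sets[OF f0_sets refl]\<close>)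
      then show "((\<lambda>t. \<integral>z. \<phi> z \<partial>law t) \<circ> x) \<longlonglongrightarrow> (\<integral>z. \<phi> z \<partial>law a)"
        using x(1) a by (simp add: o_def law_int)
    qed
  qed
qed

lemma at_time_law: "0 \<le> t \<Longrightarrow> at_time f f0 t = law t"
  by (rule at_time_eq[OF law_weak_representative])

lemma weighted_norm_AE: "AE t in lborel. 0 \<le> t \<longrightarrow> weighted_norm \<gamma> (f t) = ennreal (amp t)"
  using good_times_AE
proof eventually_elim
  case (elim t)
  show ?case
  proof
    assume "0 \<le> t"
    then have t: "t \<in> good_times" using elim by simp
    note [measurable] = f_good(2)[OF t]
    have [measurable]: "(\<lambda>z. f t (fst z, snd z)) \<in> borel_measurable borel" "(\<lambda>z. dens t (fst z, snd z)) \<in> borel_measurable borel"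
      by simp_all
    have "weighted_norm \<gamma> (f t) = weighted_norm \<gamma> (dens t)"
      unfolding weighted_norm_def case_prod_beta'
    proof (rule esssup_AE_cong)
      show "AE z in lborel. ennreal ((1 + norm (fst z)) powr \<gamma> * (1 + norm (snd z)) powr \<gamma> * \<bar>f t (fst z, snd z)\<bar>) =
        ennreal ((1 + norm (fst z)) powr \<gamma> * (1 + norm (snd z)) powr \<gamma> * \<bar>dens t (fst z, snd z)\<bar>)"
        using dens_eq_AE[OF t] by eventually_elim simp
    qed measurable
    then show "weighted_norm \<gamma> (f t) = ennreal (amp t)" by (simp add: amp_eq)
  qed
qed

end

subsection \<open>Stability\<close>

text \<open>Finite cost makes the mean distance a real number, to which Gronwall applies; couplings
  of infinite cost are settled in the final theorem.\<close>

locale two_solutions =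
  F: kinetic_solution \<gamma> f f0 + G: kinetic_solution \<gamma> g g0
  for \<gamma> :: real and f g :: "real \<Rightarrow> phase \<Rightarrow> real" and f0 g0 :: "phase measure" +
  fixes \<pi> :: "(phase \<times> phase) measure"
  assumes coupling: "\<pi> \<in> couplings f0 g0"
    and cost: "integrable \<pi> (\<lambda>p. norm (fst p - snd p))"
begin

sublocale P: prob_space \<pi>
  using coupling by (simp add: couplings_def)

lemma sets_\<pi> [measurable_cong]: "sets \<pi> = sets borel"
  and marginals: "distr \<pi> borel fst = f0" "distr \<pi> borel snd = g0"
  using coupling by (simp_all add: couplings_def)

text \<open>Truncating time at 0 makes both processes defined and continuous at all real times, and
  jointly measurable through \<open>flow_joint_continuous\<close>.\<close>

definition X :: "real \<Rightarrow> phase \<times> phase \<Rightarrow> phase" where "X t p = F.flow 0 (fst p) (max 0 t)"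
definition Y :: "real \<Rightarrow> phase \<times> phase \<Rightarrow> phase" where "Y t p = G.flow 0 (snd p) (max 0 t)"

definition k :: "real \<Rightarrow> real" where "k t = F.rate t + G.rate t"

sublocale L: local_weight k
proof
  show "k \<in> borel_measurable borel" unfolding k_def[abs_def] by (intro borel_measurable_add F.k_measurable G.k_measurable)
  show "0 \<le> k t" for t unfolding k_def using F.k_nonneg G.k_nonneg by (rule add_nonneg_nonneg)
  show "set_integrable lborel {s..t} k" for s t
    unfolding k_def[abs_def] by (intro set_integral_add F.k_set_integrable G.k_set_integrable)
qed

lemma fst_snd_measurable [measurable]:
  "fst \<in> borel_measurable (borel :: (phase \<times> phase) measure)" "snd \<in> borel_measurable (borel :: (phase \<times> phase) measure)"
  by (intro borel_measurable_continuous_onI continuous_intros)+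

lemma XY_measurable:
  shows "(\<lambda>(p, t). X t p) \<in> borel_measurable (\<pi> \<Otimes>\<^sub>M borel)" "(\<lambda>(p, t). Y t p) \<in> borel_measurable (\<pi> \<Otimes>\<^sub>M borel)"
proof -
  have F: "(\<lambda>(z, r). F.flow 0 z (max 0 r)) \<in> borel_measurable borel"
    and G: "(\<lambda>(z, r). G.flow 0 z (max 0 r)) \<in> borel_measurable borel"
    by (intro borel_measurable_continuous_onI F.flow_joint_continuous G.flow_joint_continuous)+
  have 1: "(\<lambda>q. (fst (fst q), snd q)) \<in> borel_measurable (\<pi> \<Otimes>\<^sub>M (borel :: real measure))"
    and 2: "(\<lambda>q. (snd (fst q), snd q)) \<in> borel_measurable (\<pi> \<Otimes>\<^sub>M (borel :: real measure))"
    by measurable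
  show "(\<lambda>(p, t). X t p) \<in> borel_measurable (\<pi> \<Otimes>\<^sub>M borel)"
    using measurable_compose[OF 1 F] by (simp add: X_def case_prod_beta')
  show "(\<lambda>(p, t). Y t p) \<in> borel_measurable (\<pi> \<Otimes>\<^sub>M borel)"
    using measurable_compose[OF 2 G] by (simp add: Y_def case_prod_beta')
qed

lemma XY_measurable_section [measurable]: "X t \<in> borel_measurable \<pi>" "Y t \<in> borel_measurable \<pi>"
  using measurable_compose[OF measurable_Pair2'[of t borel \<pi>] XY_measurable(1)]
    measurable_compose[OF measurable_Pair2'[of t borel \<pi>] XY_measurable(2)] by simp_all

lemma X_displacement: "0 \<le> t \<Longrightarrow> norm (X t p - fst p) \<le> F.K 0 t"
  and Y_displacement: "0 \<le> t \<Longrightarrow> norm (Y t p - snd p) \<le> G.K 0 t"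
  unfolding X_def Y_def using F.flow_displacement[of 0 t] G.flow_displacement[of 0 t] by simp_all

lemma fst_snd_coupling_measurable: "fst \<in> \<pi> \<rightarrow>\<^sub>M borel" "snd \<in> \<pi> \<rightarrow>\<^sub>M borel"
  by measurable

lemma law_XY:
  assumes "0 \<le> t"
  shows "distr \<pi> borel (X t) = F.law t" "distr \<pi> borel (Y t) = G.law t"
proof -
  have "distr (distr \<pi> borel fst) borel (\<lambda>z. F.flow 0 z t) = distr \<pi> borel ((\<lambda>z. F.flow 0 z t) \<circ> fst)"
    by (rule distr_distr[OF F.flow_borel[OF assms] fst_snd_coupling_measurable(1)])
  then show "distr \<pi> borel (X t) = F.law t" using assms by (simp add: F.law_def marginals o_def X_def[abs_def])
  have "distr (distr \<pi> borel snd) borel (\<lambda>z. G.flow 0 z t) = distr \<pi> borel ((\<lambda>z. G.flow 0 z t) \<circ> snd)"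
    by (rule distr_distr[OF G.flow_borel[OF assms] fst_snd_coupling_measurable(2)])
  then show "distr \<pi> borel (Y t) = G.law t" using assms by (simp add: G.law_def marginals o_def Y_def[abs_def])
qed

lemma XY_diff_bound:
  assumes "0 \<le> t"
  shows "norm (X t p - Y t p) \<le> F.K 0 t + G.K 0 t + norm (fst p - snd p)"
proof -
  have "X t p - Y t p = (X t p - fst p) + (fst p - snd p) - (Y t p - snd p)" by simp
  also have "norm \<dots> \<le> norm (X t p - fst p) + norm (fst p - snd p) + norm (Y t p - snd p)"
    by (intro order_trans[OF norm_triangle_ineq4] add_right_mono norm_triangle_ineq)
  finally show ?thesis using X_displacement[OF assms, of p] Y_displacement[OF assms, of p] by linarith
qed

lemma XY_integrable: "integrable \<pi> (\<lambda>p. norm (X t p - Y t p))"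
proof -
  have "integrable \<pi> (\<lambda>p. F.K 0 (max 0 t) + G.K 0 (max 0 t) + norm (fst p - snd p))" using cost by simp
  moreover have "X t = X (max 0 t)" "Y t = Y (max 0 t)" by (simp_all add: X_def[abs_def] Y_def[abs_def])
  then have "norm (norm (X t p - Y t p)) \<le> norm (F.K 0 (max 0 t) + G.K 0 (max 0 t) + norm (fst p - snd p))" for p
    using XY_diff_bound[of "max 0 t" p] by (simp add: abs_if)
  ultimately show ?thesis by (intro Bochner_Integration.integrable_bound[of \<pi> _ "\<lambda>p. norm (X t p - Y t p)"] AE_I2) auto
qed

section \<open>Evolution of the mean distance\<close>

definition gap :: "real \<Rightarrow> real" where "gap t = (\<integral>p. norm (X t p - Y t p) \<partial>\<pi>)"

lemma gap_nonneg: "0 \<le> gap t"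
  unfolding gap_def by (intro integral_nonneg_AE) auto

lemma gap_0: "gap 0 = (\<integral>p. norm (fst p - snd p) \<partial>\<pi>)"
  by (simp add: gap_def X_def Y_def)

text \<open>Gives the continuity of \<open>gap\<close> that Gronwall's inequality demands: each
  trajectory moves by at most the length of its own clock, uniformly over the coupling.\<close>

lemma gap_increment:
  assumes "s \<le> t"
  shows "\<bar>gap t - gap s\<bar> \<le> (F.K 0 (max 0 t) + G.K 0 (max 0 t)) - (F.K 0 (max 0 s) + G.K 0 (max 0 s))"
  unfolding gap_def
proof (rule P.integral_diff_le[OF XY_integrable XY_integrable])
  fix p
  have st: "0 \<le> max 0 s" "max 0 s \<le> max 0 t" using assms by auto
  have "norm (X t p - X s p) \<le> F.K (max 0 s) (max 0 t)"
    unfolding X_def by (rule F.trajectory_displacement[OF F.trajectory_restart[OF F.flow_trajectory st(1)] st(2)])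
  moreover have "norm (Y t p - Y s p) \<le> G.K (max 0 s) (max 0 t)"
    unfolding Y_def by (rule G.trajectory_displacement[OF G.trajectory_restart[OF G.flow_trajectory st(1)] st(2)])
  moreover have "\<bar>norm (X t p - Y t p) - norm (X s p - Y s p)\<bar> \<le> norm (X t p - X s p) + norm (Y t p - Y s p)"
  proof -
    have "\<bar>norm (X t p - Y t p) - norm (X s p - Y s p)\<bar> \<le> norm ((X t p - Y t p) - (X s p - Y s p))"
      by (rule norm_triangle_ineq3)
    also have "(X t p - Y t p) - (X s p - Y s p) = (X t p - X s p) - (Y t p - Y s p)" by simp
    finally show ?thesis using norm_triangle_ineq4[of "X t p - X s p" "Y t p - Y s p"] by linarith
  qed
  ultimately show "\<bar>norm (X t p - Y t p) - norm (X s p - Y s p)\<bar> \<le>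
      (F.K 0 (max 0 t) + G.K 0 (max 0 t)) - (F.K 0 (max 0 s) + G.K 0 (max 0 s))"
    using F.K_combine[OF st] G.K_combine[OF st] by linarith
qed

lemma gap_continuous: "continuous_on UNIV gap"
  unfolding continuous_on_def
proof
  fix a :: real
  define h where "h t = F.K 0 (max 0 t) + G.K 0 (max 0 t)" for t
  have hc: "continuous_on UNIV h"
    unfolding h_def
    by (intro continuous_intros continuous_on_compose2[OF F.continuous_on_K] continuous_on_compose2[OF G.continuous_on_K]) auto
  have le: "\<bar>gap t - gap a\<bar> \<le> \<bar>h t - h a\<bar>" for t
    using gap_increment[of t a] gap_increment[of a t] by (cases "t \<le> a") (auto simp: h_def abs_minus_commute)
  have "(h \<longlongrightarrow> h a) (at a)" using hc by (simp add: continuous_on_def)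
  then have "((\<lambda>t. \<bar>h t - h a\<bar>) \<longlongrightarrow> 0) (at a)" using LIM_zero tendsto_rabs_zero by blast
  then have "((\<lambda>t. gap t - gap a) \<longlongrightarrow> 0) (at a)"
    by (rule Lim_null_comparison[rotated]) (auto intro!: always_eventually le)
  then show "(gap \<longlongrightarrow> gap a) (at a)" by (simp add: LIM_zero_iff)
qed

text \<open>Each field is an average over a second point \<open>q\<close> drawn from the coupling. A
  linear bound fails pointwise in \<open>y\<close> because of the singularity and the jump; after
  Tonelli the \<open>y\<close>-integral is innermost, where the weight dominates
  \<open>G.dens\<close> and the centres \<open>X s q\<close> and \<open>Y s q\<close> are
  fixed.\<close>

lemma velocity_gap:
  assumes s: "0 \<le> s" "s \<in> F.good_times" "s \<in> G.good_times"
      "F.law s = measure_of_density (F.dens s)" "G.law s = measure_of_density (G.dens s)"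
  shows "(\<integral>\<^sup>+p. ennreal (norm (F.vel s (Y s p) - G.vel s (Y s p))) \<partial>\<pi>) \<le> ennreal (G.rate s * gap s)"
proof -
  let ?d = "\<lambda>y q. norm (pair_kernel (y - X s q) - pair_kernel (y - Y s q))"
  have [measurable]: "G.dens s \<in> borel_measurable borel" "F.vel s \<in> borel_measurable borel" "G.vel s \<in> borel_measurable borel"
    by (auto intro: borel_measurable_continuous_onI F.continuous_on_b G.continuous_on_b)
  have Fv: "integrable \<pi> (\<lambda>q. pair_kernel (y - X s q))" "F.vel s y = (\<integral>q. pair_kernel (y - X s q) \<partial>\<pi>)" for y
    using velocity_density[OF F.\<gamma> F.dens_dominated, of s y] F.dens_nonneg
    unfolding s(4)[symmetric] law_XY(1)[OF s(1), symmetric] F.vel_def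
    by (simp_all add: integrable_distr_eq integral_distr)
  have Gv: "integrable \<pi> (\<lambda>q. pair_kernel (y - Y s q))" "G.vel s y = (\<integral>q. pair_kernel (y - Y s q) \<partial>\<pi>)" for y
    using velocity_density[OF G.\<gamma> G.dens_dominated, of s y] G.dens_nonneg
    unfolding s(5)[symmetric] law_XY(2)[OF s(1), symmetric] G.vel_def
    by (simp_all add: integrable_distr_eq integral_distr)
  have vd: "ennreal (norm (F.vel s y - G.vel s y)) \<le> (\<integral>\<^sup>+q. ennreal (?d y q) \<partial>\<pi>)" for y
  proof -
    have "F.vel s y - G.vel s y = (\<integral>q. pair_kernel (y - X s q) - pair_kernel (y - Y s q) \<partial>\<pi>)"
      unfolding Fv(2) Gv(2) by (rule Bochner_Integration.integral_diff[OF Fv(1) Gv(1), symmetric])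
    then show ?thesis
      using integral_norm_bound_ennreal[OF Bochner_Integration.integrable_diff[OF Fv(1) Gv(1)], of y y] by simp
  qed
  interpret PL: pair_sigma_finite \<pi> "lborel :: phase measure" ..
  have "(\<integral>\<^sup>+p. ennreal (norm (F.vel s (Y s p) - G.vel s (Y s p))) \<partial>\<pi>)
      = (\<integral>\<^sup>+y. ennreal (norm (F.vel s y - G.vel s y)) \<partial>distr \<pi> borel (Y s))"
    by (subst nn_integral_distr) auto
  also have "\<dots> = (\<integral>\<^sup>+y. ennreal (G.dens s y) * ennreal (norm (F.vel s y - G.vel s y)) \<partial>lborel)"
    unfolding law_XY(2)[OF s(1)] s(5) measure_of_density_def by (subst nn_integral_density) auto
  also have "\<dots> \<le> (\<integral>\<^sup>+y. ennreal (G.dens s y) * (\<integral>\<^sup>+q. ennreal (?d y q) \<partial>\<pi>) \<partial>lborel)"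
    by (intro nn_integral_mono mult_left_mono vd) auto
  also have "\<dots> = (\<integral>\<^sup>+y. (\<integral>\<^sup>+q. ennreal (G.dens s y * ?d y q) \<partial>\<pi>) \<partial>lborel)"
    by (simp add: nn_integral_cmult[symmetric] ennreal_mult G.dens_nonneg)
  also have "\<dots> = (\<integral>\<^sup>+q. (\<integral>\<^sup>+y. ennreal (G.dens s y * ?d y q) \<partial>lborel) \<partial>\<pi>)"
    by (rule PL.Fubini') measurable
  also have "\<dots> \<le> (\<integral>\<^sup>+q. ennreal (G.rate s * norm (X s q - Y s q)) \<partial>\<pi>)"
  proof (intro nn_integral_mono)
    fix q
    have "(\<integral>\<^sup>+y. ennreal (\<bar>G.dens s y\<bar> * ?d y q) \<partial>lborel) \<le> ennreal (G.amp s * (kernel_const \<gamma> * norm (X s q - Y s q)))"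
      by (rule dominated_nn_integral_le[OF G.dens_dominated _ _ pair_kernel_diff_weight_bound[OF G.\<gamma>]]) auto
    then show "(\<integral>\<^sup>+y. ennreal (G.dens s y * ?d y q) \<partial>lborel) \<le> ennreal (G.rate s * norm (X s q - Y s q))"
      by (simp add: G.dens_nonneg G.rate_def mult.assoc)
  qed
  also have "\<dots> = ennreal (G.rate s * gap s)"
    unfolding gap_def using G.k_nonneg[of s] XY_integrable[of s]
    by (subst nn_integral_eq_integral) auto
  finally show ?thesis .
qed

text \<open>The relative speed splits into the increment of the first field from \<open>Y\<close> to
  \<open>X\<close>, with Lipschitz constant \<open>F.rate\<close>, and the difference of the two
  fields at \<open>Y\<close>, of mean at most \<open>G.rate * gap\<close>; the two rates add up to
  \<open>k\<close>.\<close>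

lemma gap_growth:
  assumes r: "0 \<le> r"
  shows "gap r \<le> gap 0 + integral {0..r} (\<lambda>s. k s * gap s)"
proof -
  define h where "h p s = norm (F.vel s (X s p) - G.vel s (Y s p))" for p s
  have hm: "(\<lambda>(p, s). h p s) \<in> borel_measurable (\<pi> \<Otimes>\<^sub>M borel)"
  proof -
    have 1: "(\<lambda>q. X (snd q) (fst q)) \<in> borel_measurable (\<pi> \<Otimes>\<^sub>M borel)" "(\<lambda>q. Y (snd q) (fst q)) \<in> borel_measurable (\<pi> \<Otimes>\<^sub>M borel)"
      by (rule XY_measurable(1)[unfolded case_prod_beta'], rule XY_measurable(2)[unfolded case_prod_beta'])
    have "(\<lambda>q. F.vel (snd q) (X (snd q) (fst q))) \<in> borel_measurable (\<pi> \<Otimes>\<^sub>M borel)"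
      "(\<lambda>q. G.vel (snd q) (Y (snd q) (fst q))) \<in> borel_measurable (\<pi> \<Otimes>\<^sub>M borel)"
      by (rule F.b_measurable_compose[OF measurable_snd 1(1)], rule G.b_measurable_compose[OF measurable_snd 1(2)])
    then show ?thesis unfolding h_def case_prod_beta' by measurable
  qed
  have hb: "\<bar>h p s\<bar> \<le> 1 * k s" for p s
    using norm_triangle_ineq4[of "F.vel s (X s p)" "G.vel s (Y s p)"] F.b_bound[of s "X s p"] G.b_bound[of s "Y s p"]
    by (simp add: h_def k_def)
  note swap = L.integral_swap[OF P.finite_measure_axioms hm hb, of 0 r]
  have pt: "norm (X r p - Y r p) \<le> norm (fst p - snd p) + integral {0..r} (h p)" for p
  proof -
    have Xi: "(\<lambda>s. F.vel s (F.flow 0 (fst p) s)) integrable_on {0..r}"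
      and Yi: "(\<lambda>s. G.vel s (G.flow 0 (snd p) s)) integrable_on {0..r}"
      by (rule F.trajectory_integrable[OF F.flow_trajectory] G.trajectory_integrable[OF G.flow_trajectory])+
    have hint: "h p integrable_on {0..r}"
    proof (rule L.integrable_on_bounded_by(1)[where c=1])
      have "(\<lambda>s. (\<lambda>(p, s). h p s) (p, s)) \<in> borel_measurable borel"
        by (rule measurable_Pair2[OF hm]) (simp add: sets_eq_imp_space_eq[OF sets_\<pi>])
      then show "h p \<in> borel_measurable borel" by simp
    qed (use hb[of p] in auto)
    define I where "I = integral {0..r} (\<lambda>s. F.vel s (F.flow 0 (fst p) s) - G.vel s (G.flow 0 (snd p) s))"
    have eq: "X r p - Y r p = (fst p - snd p) + I"
      unfolding I_def Henstock_Kurzweil_Integration.integral_diff[OF Xi Yi]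
      using F.flow_increment[of 0 0 r "fst p"] G.flow_increment[of 0 0 r "snd p"] r by (simp add: X_def Y_def)
    have "norm I \<le> integral {0..r} (h p)"
      unfolding I_def
    proof (rule Henstock_Kurzweil_Integration.integral_norm_bound_integral)
      show "(\<lambda>s. F.vel s (F.flow 0 (fst p) s) - G.vel s (G.flow 0 (snd p) s)) integrable_on {0..r}"
        by (rule Henstock_Kurzweil_Integration.integrable_diff[OF Xi Yi])
      show "h p integrable_on {0..r}" by (rule hint)
      fix s assume "s \<in> {0..r}"
      then have "max 0 s = s" by simp
      then show "norm (F.vel s (F.flow 0 (fst p) s) - G.vel s (G.flow 0 (snd p) s)) \<le> h p s"
        unfolding h_def X_def Y_def by simp
    qed
    moreover have "norm (X r p - Y r p) \<le> norm (fst p - snd p) + norm I"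
      unfolding eq by (rule norm_triangle_ineq)
    ultimately show ?thesis by linarith
  qed
  have "gap r \<le> (\<integral>p. norm (fst p - snd p) + integral {0..r} (h p) \<partial>\<pi>)"
    unfolding gap_def using cost swap(2) by (intro integral_mono XY_integrable pt) auto
  also have "\<dots> = gap 0 + integral {0..r} (\<lambda>s. \<integral>p. h p s \<partial>\<pi>)"
    using cost swap(2,3) by (simp add: gap_0)
  \<comment> \<open>The identification of laws with densities holds at almost every time only, so
    the comparison is made between Lebesgue integrals and then translated back.\<close>
  also have "integral {0..r} (\<lambda>s. \<integral>p. h p s \<partial>\<pi>) \<le> integral {0..r} (\<lambda>s. k s * gap s)"
  proof -
    have m1: "(\<lambda>s. \<integral>p. h p s \<partial>\<pi>) \<in> borel_measurable borel"
    proof -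
      have "(\<lambda>(s, p). h p s) \<in> borel_measurable (borel \<Otimes>\<^sub>M \<pi>)"
        using measurable_pair_swap[OF hm] by (simp add: case_prod_beta')
      then show ?thesis by (rule P.borel_measurable_lebesgue_integral)
    qed
    have i1: "set_integrable lborel {0..r} (\<lambda>s. \<integral>p. h p s \<partial>\<pi>)"
    proof (rule L.integrable_on_bounded_by(2)[OF m1, where c=1])
      fix s
      have "\<bar>\<integral>p. h p s \<partial>\<pi>\<bar> \<le> (\<integral>p. \<bar>h p s\<bar> \<partial>\<pi>)" by (rule integral_abs_bound)
      also have "\<dots> \<le> (\<integral>p. k s \<partial>\<pi>)"
      proof (rule integral_mono_AE')
        show "AE p in \<pi>. \<bar>h p s\<bar> \<le> k s" using hb[of _ s] by simp
      qed (auto simp: L.k_nonneg)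
      finally show "norm (\<integral>p. h p s \<partial>\<pi>) \<le> 1 * k s" by (simp add: P.prob_space)
    qed
    have i2: "set_integrable lborel {0..r} (\<lambda>s. k s * gap s)"
    proof -
      have "bounded (gap ` {0..r})"
        by (intro compact_imp_bounded compact_continuous_image continuous_on_subset[OF gap_continuous]) auto
      then obtain B where B: "\<And>s. s \<in> {0..r} \<Longrightarrow> \<bar>gap s\<bar> \<le> B" unfolding bounded_iff by fastforce
      have [measurable]: "gap \<in> borel_measurable borel" by (rule borel_measurable_continuous_onI[OF gap_continuous])
      show ?thesis
      proof (rule L.integrable_on_bounded_by(2)[where c=B])
        show "norm (k s * gap s) \<le> B * k s" if "s \<in> {0..r}" for s
          using mult_right_mono[OF B[OF that] L.k_nonneg[of s]] L.k_nonneg[of s] by (simp add: abs_mult mult.commute)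
      qed measurable
    qed
    have "AE s in lborel. s \<in> {0..r} \<longrightarrow> (\<integral>p. h p s \<partial>\<pi>) \<le> k s * gap s"
      using F.law_eq_density G.law_eq_density
    proof eventually_elim
      case (elim s)
      show ?case
      proof
        assume "s \<in> {0..r}"
        then have s: "0 \<le> s" by simp
        have [measurable]: "F.vel s \<in> borel_measurable borel" "G.vel s \<in> borel_measurable borel"
          by (auto intro: borel_measurable_continuous_onI F.continuous_on_b G.continuous_on_b)
        define d where "d p = norm (F.vel s (Y s p) - G.vel s (Y s p))" for p
        have [measurable]: "d \<in> borel_measurable \<pi>" unfolding d_def[abs_def] by measurable
        have dle: "(\<integral>\<^sup>+p. ennreal (d p) \<partial>\<pi>) \<le> ennreal (G.rate s * gap s)"
          unfolding d_def using velocity_gap[OF s] elim s by simp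
        have di: "integrable \<pi> d"
          by (rule integrableI_bounded) (use dle in \<open>auto simp: d_def intro: le_less_trans\<close>)
        have dI: "(\<integral>p. d p \<partial>\<pi>) \<le> G.rate s * gap s"
        proof -
          have "ennreal (\<integral>p. d p \<partial>\<pi>) \<le> ennreal (G.rate s * gap s)"
            using dle by (subst nn_integral_eq_integral[symmetric, OF di]) (auto simp: d_def)
          then show ?thesis using G.k_nonneg[of s] gap_nonneg[of s] by (simp add: ennreal_le_iff)
        qed
        have "(\<integral>p. h p s \<partial>\<pi>) \<le> (\<integral>p. F.rate s * norm (X s p - Y s p) + d p \<partial>\<pi>)"
        proof (rule integral_mono_AE')
          show "integrable \<pi> (\<lambda>p. F.rate s * norm (X s p - Y s p) + d p)" using XY_integrable[of s] di by simp
          show "AE p in \<pi>. h p s \<le> F.rate s * norm (X s p - Y s p) + d p"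
          proof (rule AE_I2)
            fix p
            show "h p s \<le> F.rate s * norm (X s p - Y s p) + d p"
              using F.b_lipschitz[of s "X s p" "Y s p"]
                norm_triangle_ineq[of "F.vel s (X s p) - F.vel s (Y s p)" "F.vel s (Y s p) - G.vel s (Y s p)"]
              by (simp add: h_def d_def)
          qed
          show "AE p in \<pi>. 0 \<le> F.rate s * norm (X s p - Y s p) + d p"
            using F.k_nonneg[of s] by (simp add: d_def)
        qed
        also have "\<dots> = F.rate s * gap s + (\<integral>p. d p \<partial>\<pi>)"
          using XY_integrable[of s] di by (simp add: gap_def)
        also have "\<dots> \<le> k s * gap s" using dI by (simp add: k_def distrib_right)
        finally show "(\<integral>p. h p s \<partial>\<pi>) \<le> k s * gap s" .
      qed
    qed
    then have "(LINT s:{0..r}|lborel. (\<integral>p. h p s \<partial>\<pi>)) \<le> (LINT s:{0..r}|lborel. k s * gap s)"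
      by (intro set_integral_mono_AE i1 i2)
    then show ?thesis unfolding set_borel_integral_eq_integral(2)[OF i1] set_borel_integral_eq_integral(2)[OF i2] .
  qed
  finally show ?thesis by simp
qed

text \<open>The coupling pushed forward by both flows need not be optimal; being admissible, it
  bounds the infimum from above.\<close>

lemma W1_law_le:
  assumes t: "0 \<le> t"
  shows "W1 (F.law t) (G.law t) \<le> (\<integral>\<^sup>+(z, z'). ennreal (norm (z - z')) \<partial>\<pi>) * ennreal (exp (L.K 0 t))"
proof -
  have "gap t \<le> gap 0 * exp (L.K 0 t)"
    by (rule L.gronwall[OF t gap_continuous gap_nonneg gap_nonneg gap_growth])
  define \<pi>t where "\<pi>t = distr \<pi> borel (\<lambda>p. (X t p, Y t p))"
  have m: "(\<lambda>p. (X t p, Y t p)) \<in> borel_measurable \<pi>" by measurable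
  have "\<pi>t \<in> couplings (F.law t) (G.law t)"
    unfolding couplings_def
  proof (intro CollectI conjI)
    show "prob_space \<pi>t" unfolding \<pi>t_def by (rule P.prob_space_distr[OF m])
    show "sets \<pi>t = sets borel" by (simp add: \<pi>t_def)
    show "distr \<pi>t borel fst = F.law t" "distr \<pi>t borel snd = G.law t"
      unfolding \<pi>t_def law_XY[OF t, symmetric] using m by (simp_all add: distr_distr o_def)
  qed
  then have "W1 (F.law t) (G.law t) \<le> (\<integral>\<^sup>+(z, z'). ennreal (norm (z - z')) \<partial>\<pi>t)"
    unfolding W1_def by (rule INF_lower)
  also have "\<dots> = (\<integral>\<^sup>+p. ennreal (norm (X t p - Y t p)) \<partial>\<pi>)"
    unfolding \<pi>t_def case_prod_beta' using m by (subst nn_integral_distr) auto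
  also have "\<dots> = ennreal (gap t)"
    unfolding gap_def by (rule nn_integral_eq_integral[OF XY_integrable]) simp
  also have "\<dots> \<le> ennreal (gap 0 * exp (L.K 0 t))" by (intro ennreal_leI) fact
  also have "\<dots> = ennreal (gap 0) * ennreal (exp (L.K 0 t))" by (intro ennreal_mult gap_nonneg) simp
  also have "ennreal (gap 0) = (\<integral>\<^sup>+(z, z'). ennreal (norm (z - z')) \<partial>\<pi>)"
    unfolding gap_0 case_prod_beta' by (rule nn_integral_eq_integral[OF cost, symmetric]) simp
  finally show ?thesis .
qed

text \<open>The norms of \<open>f\<close> and of the corrected density agree at almost every time
  and their integral is finite, so nothing is lost through \<open>enn2real\<close>.\<close>

lemma K_eq:
  assumes t: "0 \<le> t"
  shows "L.K 0 t = kernel_const \<gamma> * enn2real (\<integral>\<^sup>+s\<in>{0..t}. (weighted_norm \<gamma> (f s) + weighted_norm \<gamma> (g s)) \<partial>lborel)"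
proof -
  have ai: "set_integrable lborel {0..t} (\<lambda>s. F.amp s + G.amp s)"
    by (intro set_integral_add F.amp_set_integrable G.amp_set_integrable)
  have "(\<integral>\<^sup>+s\<in>{0..t}. (weighted_norm \<gamma> (f s) + weighted_norm \<gamma> (g s)) \<partial>lborel)
      = (\<integral>\<^sup>+s. ennreal (indicator {0..t} s *\<^sub>R (F.amp s + G.amp s)) \<partial>lborel)"
  proof (rule nn_integral_cong_AE)
    show "AE s in lborel. (weighted_norm \<gamma> (f s) + weighted_norm \<gamma> (g s)) * indicator {0..t} s
      = ennreal (indicator {0..t} s *\<^sub>R (F.amp s + G.amp s))"
      using F.weighted_norm_AE G.weighted_norm_AE
      by eventually_elim (auto simp: indicator_def F.amp_nonneg G.amp_nonneg)
  qed
  also have "\<dots> = ennreal (LINT s:{0..t}|lborel. F.amp s + G.amp s)"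
    using ai unfolding set_integrable_def set_lebesgue_integral_def
    by (intro nn_integral_eq_integral) (auto simp: F.amp_nonneg G.amp_nonneg)
  finally have "enn2real (\<integral>\<^sup>+s\<in>{0..t}. (weighted_norm \<gamma> (f s) + weighted_norm \<gamma> (g s)) \<partial>lborel) = (LINT s:{0..t}|lborel. F.amp s + G.amp s)"
    unfolding set_lebesgue_integral_def
    by (simp add: integral_nonneg_AE F.amp_nonneg G.amp_nonneg)
  also have "\<dots> = integral {0..t} (\<lambda>s. F.amp s + G.amp s)"
    by (rule set_borel_integral_eq_integral(2)[OF ai])
  finally have "kernel_const \<gamma> * enn2real (\<integral>\<^sup>+s\<in>{0..t}. (weighted_norm \<gamma> (f s) + weighted_norm \<gamma> (g s)) \<partial>lborel)
      = integral {0..t} (\<lambda>s. kernel_const \<gamma> * (F.amp s + G.amp s))" by simp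
  also have "(\<lambda>s. kernel_const \<gamma> * (F.amp s + G.amp s)) = k"
    by (simp add: k_def F.rate_def G.rate_def fun_eq_iff algebra_simps)
  finally show ?thesis by simp
qed

end

theorem theorem1:
  fixes \<gamma> :: real
  assumes "\<gamma> > 2"
  shows "\<exists>C::real. \<forall>f g f0 g0.
    weak_solution f f0 \<and> f \<in> L1_loc (Prob1_densities \<inter> Linf_weighted \<gamma>) (weighted_norm \<gamma>) \<and>
    weak_solution g g0 \<and> g \<in> L1_loc (Prob1_densities \<inter> Linf_weighted \<gamma>) (weighted_norm \<gamma>) \<longrightarrow>
    (\<forall>t\<ge>0. W1 (at_time f f0 t) (at_time g g0 t)
      \<le> W1 f0 g0 * ennreal (exp (C * enn2real
          (\<integral>\<^sup>+s\<in>{0..t}. (weighted_norm \<gamma> (f s) + weighted_norm \<gamma> (g s)) \<partial>lborel))))"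
proof (intro exI[of _ "kernel_const \<gamma>"] allI impI, elim conjE)
  fix f g :: "real \<Rightarrow> phase \<Rightarrow> real" and f0 g0 :: "phase measure" and t :: real
  assume sol: "weak_solution f f0" "f \<in> L1_loc (Prob1_densities \<inter> Linf_weighted \<gamma>) (weighted_norm \<gamma>)"
    "weak_solution g g0" "g \<in> L1_loc (Prob1_densities \<inter> Linf_weighted \<gamma>) (weighted_norm \<gamma>)" and t: "0 \<le> t"
  interpret F: kinetic_solution \<gamma> f f0 by unfold_locales (use assms sol in auto)
  interpret G: kinetic_solution \<gamma> g g0 by unfold_locales (use assms sol in auto)
  define E where "E = ennreal (exp (kernel_const \<gamma> * enn2real
          (\<integral>\<^sup>+s\<in>{0..t}. (weighted_norm \<gamma> (f s) + weighted_norm \<gamma> (g s)) \<partial>lborel)))"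
  have E: "E \<noteq> 0" "E \<noteq> \<top>" "E < \<top>" by (simp_all add: E_def)
  have le: "W1 (F.law t) (G.law t) \<le> (\<integral>\<^sup>+(z, z'). ennreal (norm (z - z')) \<partial>\<pi>) * E"
    if \<pi>: "\<pi> \<in> couplings f0 g0" for \<pi>
  proof (cases "(\<integral>\<^sup>+(z, z'). ennreal (norm (z - z')) \<partial>\<pi>) = \<top>")
    case True
    \<comment> \<open>A coupling of infinite cost gives the bound infinity, because \<open>E\<close>
      is nonzero.\<close>
    then show ?thesis using E by (simp add: ennreal_top_mult)
  next
    case False
    have [measurable_cong]: "sets \<pi> = sets borel" using \<pi> by (simp add: couplings_def)
    have [measurable]: "(\<lambda>p :: phase \<times> phase. norm (fst p - snd p)) \<in> borel_measurable borel"
      by (intro borel_measurable_continuous_onI continuous_intros)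
    have "integrable \<pi> (\<lambda>p. norm (fst p - snd p))"
      by (rule integrableI_bounded) (use False in \<open>auto simp: case_prod_beta' less_top\<close>)
    then interpret two_solutions \<gamma> f g f0 g0 \<pi>
      using \<pi> by unfold_locales auto
    show ?thesis using W1_law_le[OF t] K_eq[OF t] by (simp add: E_def)
  qed
  \<comment> \<open>As \<open>E\<close> is positive and finite, dividing by it carries the factor
    across the infimum over couplings, which may fail to be attained.\<close>
  have "W1 (F.law t) (G.law t) / E \<le> W1 f0 g0"
    unfolding W1_def[of f0 g0]
  proof (rule INF_greatest)
    fix \<pi> assume "\<pi> \<in> couplings f0 g0"
    then show "W1 (F.law t) (G.law t) / E \<le> (\<integral>\<^sup>+(z, z'). ennreal (norm (z - z')) \<partial>\<pi>)"
      using le[of \<pi>] E by (intro divide_le_posI_ennreal) (auto simp: mult.commute zero_less_iff_neq_zero)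
  qed
  then have "W1 (F.law t) (G.law t) / E * E \<le> W1 f0 g0 * E" by (rule mult_right_mono) simp
  moreover have "W1 (F.law t) (G.law t) / E * E = W1 (F.law t) (G.law t)"
    using E by (simp add: ennreal_divide_times ennreal_divide_self)
  ultimately show "W1 (at_time f f0 t) (at_time g g0 t) \<le> W1 f0 g0 * ennreal (exp (kernel_const \<gamma> * enn2real
          (\<integral>\<^sup>+s\<in>{0..t}. (weighted_norm \<gamma> (f s) + weighted_norm \<gamma> (g s)) \<partial>lborel)))"
    by (simp add: F.at_time_law[OF t] G.at_time_law[OF t] E_def)
qed

end
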